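(* For every $n\ge 0$, there is an equivalence of categories between the category $\mathbf{PCat}_{n+1}$ of $(n+1)$-precategories and the category of (small) categories enriched in the monoidal category $\mathbf{PCat}_n$ of $n$-precategories equipped with the funny tensor product $\boxtimes$.
   Context: **Precategories.** For $n\ge 0$, an $n$-globular set is a family of sets $C_0,\dots,C_n$ with maps $\partial^-_i,\partial^+_i:C_{i+1}\to C_i$ ($0\le i<n$) such that $\partial^\epsilon_i\partial^-_{i+1}=\partial^\epsilon_i\partial^+_{i+1}$ for $\epsilon\in\{-,+\}$; $\partial^\epsilon_i$ also denotes iterated source/target down to dimension $i$, and $\partial^\epsilon$ the one-step source/target. Cells $u_1,\dots,u_p$ of dimensions $>i$ are $i$-composable if $\partial^+_i(u_j)=\partial^-_i(u_{j+1})$ for all $j$. An $n$-precategory is an $n$-globular set $C$ with identities $\mathrm{id}:C_{k-1}\to C_k$ ($0<k\le n$) and compositions $u\ast_i v\in C_{\max(k,l)}$ for $u\in C_k$, $v\in C_l$ $i$-composable with $0<k,l\le n$ and $i=\min(k,l)-1$, such that: (i) $\partial^-(\mathrm{id}_u)=u=\partial^+(\mathrm{id}_u)$; (ii) $\partial^\epsilon(u\ast_i v)$ equals $u\ast_i\partial^\epsilon(v)$ if $k<l$, $\partial^\epsilon(u)\ast_i v$ if $k>l$, and, if $k=l$, $\partial^-(u)$ for $\epsilon=-$ and $\partial^+(v)$ for $\epsilon=+$; (iii) for $u\in C_{k-1}$, $v\in C_l$, $i=\min(k,l)-1$: $\mathrm{id}_u\ast_i v=v$ if $k\le l$ and $\mathrm{id}_u\ast_i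 v=\mathrm{id}_{u\ast_i v}$ if $k>l$, and symmetrically for identities on the right; (iv) $(u\ast_i v)\ast_i w=u\ast_i(v\ast_i w)$ whenever both sides are defined; (v) for $i<j$, $u\in C_{i+1}$ and $v\ast_j v'$ defined with $u,v$ $i$-composable, $u\ast_i(v\ast_j v')=(u\ast_i v)\ast_j(u\ast_i v')$, and symmetrically $(v\ast_j v')\ast_i u=(v\ast_i u)\ast_j(v'\ast_i u)$ when $v,u$ are $i$-composable. Morphisms ($n$-prefunctors) are morphisms of globular sets preserving identities and compositions; they form the category $\mathbf{PCat}_n$ (complete and cocomplete). **Funny tensor product.** For an $n$-precategory $C$, let $C_{(0)}$ be its $0$-skeleton, i.e. the $n$-precategory with $0$-cells $C_0$ and only identity cells in positive dimensions, and $j_C:C_{(0)}\to C$ the canonical morphism. $C\boxtimes D$ is the pushout of $j_C\times D_{(0)}:C_{(0)}\times D_{(0)}\to C\times D_{(0)}$ and $C_{(0)}\times j_D:C_{(0)}\times D_{(0)}\to C_{(0)}\times D$, with coprojections $l_{C,D}:C\times D_{(0)}\to C\boxtimes D$ and $r_{C,D}:C_{(0)}\times D\to C\boxtimes D$; it is functorial in $C,D$. The unit is the terminal $n$-precategory $\mathbf 1$. Left unitor $\lambda_C:\mathbf 1\boxtimes C\to C$: the unique morphism with $\lambda_C\circ r_{\mathbf 1,C}=\pi_2$ and $\lambda_C\circ l_{\mathbf 1,C}=j_C\circ\pi_2$; the right unitor is defined symmetrically. Associator: both $(C\boxtimes D)\boxtimes E$ and $C\boxtimes(D\boxtimes E)$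 are (up to reassociating products) colimits of the diagram of three arrows from $C_{(0)}\times D_{(0)}\times E_{(0)}$ to $C\times D_{(0)}\times E_{(0)}$, $C_{(0)}\times D\times E_{(0)}$ and $C_{(0)}\times D_{(0)}\times E$, and the associator is the induced isomorphism. *)

theory Defs
  imports Main
begin

section \<open>Categories, functors, equivalences\<close>

text \<open>
  Categories are given by a set of objects, hom-sets, identities and composition. Hom-sets of
  different pairs of objects may overlap, so \<open>Comp \<C> A B D g f\<close> (the composite
  \<open>A \<rightarrow> B \<rightarrow> D\<close> of \<open>f\<close> followed by \<open>g\<close>) takes the objects as arguments. Values on
  arguments outside the carriers are irrelevant.
\<close>

record ('o, 'm) cat =
  Obj :: "'o set"
  Hom :: "'o \<Rightarrow> 'o \<Rightarrow> 'm set"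
  Ide :: "'o \<Rightarrow> 'm"
  Comp :: "'o \<Rightarrow> 'o \<Rightarrow> 'o \<Rightarrow> 'm \<Rightarrow> 'm \<Rightarrow> 'm"

locale category =
  fixes \<C> :: "('o, 'm, 'z) cat_scheme"
  assumes Ide_in_Hom: "A \<in> Obj \<C> \<Longrightarrow> Ide \<C> A \<in> Hom \<C> A A"
    and Comp_in_Hom:
      "\<lbrakk>A \<in> Obj \<C>; B \<in> Obj \<C>; D \<in> Obj \<C>; f \<in> Hom \<C> A B; g \<in> Hom \<C> B D\<rbrakk>
       \<Longrightarrow> Comp \<C> A B D g f \<in> Hom \<C> A D"
    and Comp_Ide_left:
      "\<lbrakk>A \<in> Obj \<C>; B \<in> Obj \<C>; f \<in> Hom \<C> A B\<rbrakk> \<Longrightarrow> Comp \<C> A B B (Ide \<C> B) f = f"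
    and Comp_Ide_right:
      "\<lbrakk>A \<in> Obj \<C>; B \<in> Obj \<C>; f \<in> Hom \<C> A B\<rbrakk> \<Longrightarrow> Comp \<C> A A B f (Ide \<C> A) = f"
    and Comp_assoc:
      "\<lbrakk>A \<in> Obj \<C>; B \<in> Obj \<C>; D \<in> Obj \<C>; E \<in> Obj \<C>;
        f \<in> Hom \<C> A B; g \<in> Hom \<C> B D; h \<in> Hom \<C> D E\<rbrakk>
       \<Longrightarrow> Comp \<C> A D E h (Comp \<C> A B D g f) = Comp \<C> A B E (Comp \<C> B D E h g) f"

definition iso_in :: "('o, 'm, 'z) cat_scheme \<Rightarrow> 'o \<Rightarrow> 'o \<Rightarrow> 'm \<Rightarrow> bool" where
  "iso_in \<C> A B f \<longleftrightarrow> f \<in> Hom \<C> A B \<and>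
     (\<exists>g \<in> Hom \<C> B A. Comp \<C> A B A g f = Ide \<C> A \<and> Comp \<C> B A B f g = Ide \<C> B)"

record ('o, 'm, 'p, 'q) funct =
  fun_obj :: "'o \<Rightarrow> 'p"
  fun_map :: "'o \<Rightarrow> 'o \<Rightarrow> 'm \<Rightarrow> 'q"

locale is_functor =
  fixes \<C> :: "('o, 'm, 'y) cat_scheme" and \<D> :: "('p, 'q, 'z) cat_scheme"
    and F :: "('o, 'm, 'p, 'q) funct"
  assumes fun_obj: "A \<in> Obj \<C> \<Longrightarrow> fun_obj F A \<in> Obj \<D>"
    and fun_map:
      "\<lbrakk>A \<in> Obj \<C>; B \<in> Obj \<C>; f \<in> Hom \<C> A B\<rbrakk>
       \<Longrightarrow> fun_map F A B f \<in> Hom \<D> (fun_obj F A) (fun_obj F B)"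
    and fun_map_Ide: "A \<in> Obj \<C> \<Longrightarrow> fun_map F A A (Ide \<C> A) = Ide \<D> (fun_obj F A)"
    and fun_map_Comp:
      "\<lbrakk>A \<in> Obj \<C>; B \<in> Obj \<C>; D \<in> Obj \<C>; f \<in> Hom \<C> A B; g \<in> Hom \<C> B D\<rbrakk>
       \<Longrightarrow> fun_map F A D (Comp \<C> A B D g f)
         = Comp \<D> (fun_obj F A) (fun_obj F B) (fun_obj F D) (fun_map F B D g) (fun_map F A B f)"

definition id_functor :: "('o, 'm, 'o, 'm) funct" where
  "id_functor = \<lparr>fun_obj = (\<lambda>A. A), fun_map = (\<lambda>A B f. f)\<rparr>"

definition comp_functor ::
  "('p, 'q, 'r, 's) funct \<Rightarrow> ('o, 'm, 'p, 'q) funct \<Rightarrow> ('o, 'm, 'r, 's) funct" where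
  "comp_functor G F =
     \<lparr>fun_obj = (\<lambda>A. fun_obj G (fun_obj F A)),
      fun_map = (\<lambda>A B f. fun_map G (fun_obj F A) (fun_obj F B) (fun_map F A B f))\<rparr>"

definition natural_iso ::
  "('o, 'm, 'y) cat_scheme \<Rightarrow> ('p, 'q, 'z) cat_scheme \<Rightarrow>
   ('o, 'm, 'p, 'q) funct \<Rightarrow> ('o, 'm, 'p, 'q) funct \<Rightarrow> ('o \<Rightarrow> 'q) \<Rightarrow> bool" where
  "natural_iso \<C> \<D> F G \<eta> \<longleftrightarrow>
     (\<forall>A \<in> Obj \<C>. iso_in \<D> (fun_obj F A) (fun_obj G A) (\<eta> A)) \<and>
     (\<forall>A \<in> Obj \<C>. \<forall>B \<in> Obj \<C>. \<forall>f \<in> Hom \<C> A B.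
        Comp \<D> (fun_obj F A) (fun_obj F B) (fun_obj G B) (\<eta> B) (fun_map F A B f)
      = Comp \<D> (fun_obj F A) (fun_obj G A) (fun_obj G B) (fun_map G A B f) (\<eta> A))"

definition equivalent_categories ::
  "('o, 'm, 'y) cat_scheme \<Rightarrow> ('p, 'q, 'z) cat_scheme \<Rightarrow> bool" where
  "equivalent_categories \<C> \<D> \<longleftrightarrow>
     category \<C> \<and> category \<D> \<and>
     (\<exists>F G \<eta> \<epsilon>. is_functor \<C> \<D> F \<and> is_functor \<D> \<C> G \<and>
        natural_iso \<C> \<C> id_functor (comp_functor G F) \<eta> \<and>
        natural_iso \<D> \<D> (comp_functor F G) id_functor \<epsilon>)"

definition is_pushout ::
  "('o, 'm, 'z) cat_scheme \<Rightarrow> 'o \<Rightarrow> 'o \<Rightarrow> 'o \<Rightarrow> 'm \<Rightarrow> 'm \<Rightarrow> 'o \<Rightarrow> 'm \<Rightarrow> 'm \<Rightarrow> bool" where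
  "is_pushout \<C> A X Y f g P p q \<longleftrightarrow>
     A \<in> Obj \<C> \<and> X \<in> Obj \<C> \<and> Y \<in> Obj \<C> \<and> f \<in> Hom \<C> A X \<and> g \<in> Hom \<C> A Y \<and>
     P \<in> Obj \<C> \<and> p \<in> Hom \<C> X P \<and> q \<in> Hom \<C> Y P \<and>
     Comp \<C> A X P p f = Comp \<C> A Y P q g \<and>
     (\<forall>Z \<in> Obj \<C>. \<forall>p' \<in> Hom \<C> X Z. \<forall>q' \<in> Hom \<C> Y Z.
        Comp \<C> A X Z p' f = Comp \<C> A Y Z q' g \<longrightarrow>
        (\<exists>!h. h \<in> Hom \<C> P Z \<and> Comp \<C> X P Z h p = p' \<and> Comp \<C> Y P Z h q = q'))"


section \<open>Enriched categories\<close>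

text \<open>
  The data of a monoidal category: \<open>tens_map \<V> A A' B B' f g\<close> is
  \<open>f \<otimes> g : A \<otimes> B \<rightarrow> A' \<otimes> B'\<close>, \<open>assoc \<V> A B D : (A \<otimes> B) \<otimes> D \<rightarrow> A \<otimes> (B \<otimes> D)\<close>,
  \<open>lunit \<V> A : I \<otimes> A \<rightarrow> A\<close> and \<open>runit \<V> A : A \<otimes> I \<rightarrow> A\<close>. Enriched categories and enriched
  functors are formulated in terms of these data only.
\<close>

record ('o, 'm) moncat = "('o, 'm) cat" +
  tens :: "'o \<Rightarrow> 'o \<Rightarrow> 'o"
  tens_map :: "'o \<Rightarrow> 'o \<Rightarrow> 'o \<Rightarrow> 'o \<Rightarrow> 'm \<Rightarrow> 'm \<Rightarrow> 'm"
  munit :: "'o"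
  assoc :: "'o \<Rightarrow> 'o \<Rightarrow> 'o \<Rightarrow> 'm"
  lunit :: "'o \<Rightarrow> 'm"
  runit :: "'o \<Rightarrow> 'm"

text \<open>
  Composition in enriched categories is written in diagrammatic order,
  \<open>ecomp E x y z : E(x,y) \<otimes> E(y,z) \<rightarrow> E(x,z)\<close>.
\<close>

record ('x, 'o, 'm) ecat =
  eobj :: "'x set"
  ehom :: "'x \<Rightarrow> 'x \<Rightarrow> 'o"
  eid :: "'x \<Rightarrow> 'm"
  ecomp :: "'x \<Rightarrow> 'x \<Rightarrow> 'x \<Rightarrow> 'm"

locale enriched_category =
  fixes \<V> :: "('o, 'm, 'z) moncat_scheme" and E :: "('x, 'o, 'm) ecat"
  assumes ehom: "\<lbrakk>x \<in> eobj E; y \<in> eobj E\<rbrakk> \<Longrightarrow> ehom E x y \<in> Obj \<V>"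
    and eid: "x \<in> eobj E \<Longrightarrow> eid E x \<in> Hom \<V> (munit \<V>) (ehom E x x)"
    and ecomp:
      "\<lbrakk>x \<in> eobj E; y \<in> eobj E; z \<in> eobj E\<rbrakk>
       \<Longrightarrow> ecomp E x y z \<in> Hom \<V> (tens \<V> (ehom E x y) (ehom E y z)) (ehom E x z)"
    and ecomp_assoc:
      "\<lbrakk>x \<in> eobj E; y \<in> eobj E; z \<in> eobj E; w \<in> eobj E\<rbrakk> \<Longrightarrow>
       Comp \<V> (tens \<V> (tens \<V> (ehom E x y) (ehom E y z)) (ehom E z w))
              (tens \<V> (ehom E x z) (ehom E z w))
              (ehom E x w)
         (ecomp E x z w)
         (tens_map \<V> (tens \<V> (ehom E x y) (ehom E y z)) (ehom E x z) (ehom E z w) (ehom E z w)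
            (ecomp E x y z) (Ide \<V> (ehom E z w)))
       = Comp \<V> (tens \<V> (tens \<V> (ehom E x y) (ehom E y z)) (ehom E z w))
                (tens \<V> (ehom E x y) (tens \<V> (ehom E y z) (ehom E z w)))
                (ehom E x w)
           (Comp \<V> (tens \<V> (ehom E x y) (tens \<V> (ehom E y z) (ehom E z w)))
                   (tens \<V> (ehom E x y) (ehom E y w))
                   (ehom E x w)
              (ecomp E x y w)
              (tens_map \<V> (ehom E x y) (ehom E x y)
                 (tens \<V> (ehom E y z) (ehom E z w)) (ehom E y w)
                 (Ide \<V> (ehom E x y)) (ecomp E y z w)))
           (assoc \<V> (ehom E x y) (ehom E y z) (ehom E z w))"
    and eid_left:
      "\<lbrakk>x \<in> eobj E; y \<in> eobj E\<rbrakk> \<Longrightarrow>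
       Comp \<V> (tens \<V> (munit \<V>) (ehom E x y)) (tens \<V> (ehom E x x) (ehom E x y)) (ehom E x y)
         (ecomp E x x y)
         (tens_map \<V> (munit \<V>) (ehom E x x) (ehom E x y) (ehom E x y)
            (eid E x) (Ide \<V> (ehom E x y)))
       = lunit \<V> (ehom E x y)"
    and eid_right:
      "\<lbrakk>x \<in> eobj E; y \<in> eobj E\<rbrakk> \<Longrightarrow>
       Comp \<V> (tens \<V> (ehom E x y) (munit \<V>)) (tens \<V> (ehom E x y) (ehom E y y)) (ehom E x y)
         (ecomp E x y y)
         (tens_map \<V> (ehom E x y) (ehom E x y) (munit \<V>) (ehom E y y)
            (Ide \<V> (ehom E x y)) (eid E y))
       = runit \<V> (ehom E x y)"

record ('x, 'm) efun =
  efobj :: "'x \<Rightarrow> 'x"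
  efmap :: "'x \<Rightarrow> 'x \<Rightarrow> 'm"

text \<open>
  The last two conditions only fix the value \<open>undefined\<close> outside the objects, so that
  enriched functors are equal iff they agree on objects and on hom-objects.
\<close>

locale enriched_functor =
  fixes \<V> :: "('o, 'm, 'z) moncat_scheme" and E E' :: "('x, 'o, 'm) ecat"
    and F :: "('x, 'm) efun"
  assumes efobj: "x \<in> eobj E \<Longrightarrow> efobj F x \<in> eobj E'"
    and efmap:
      "\<lbrakk>x \<in> eobj E; y \<in> eobj E\<rbrakk>
       \<Longrightarrow> efmap F x y \<in> Hom \<V> (ehom E x y) (ehom E' (efobj F x) (efobj F y))"
    and efmap_eid:
      "x \<in> eobj E \<Longrightarrow>
       Comp \<V> (munit \<V>) (ehom E x x) (ehom E' (efobj F x) (efobj F x)) (efmap F x x) (eid E x)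
       = eid E' (efobj F x)"
    and efmap_ecomp:
      "\<lbrakk>x \<in> eobj E; y \<in> eobj E; z \<in> eobj E\<rbrakk> \<Longrightarrow>
       Comp \<V> (tens \<V> (ehom E x y) (ehom E y z)) (ehom E x z) (ehom E' (efobj F x) (efobj F z))
         (efmap F x z) (ecomp E x y z)
       = Comp \<V> (tens \<V> (ehom E x y) (ehom E y z))
           (tens \<V> (ehom E' (efobj F x) (efobj F y)) (ehom E' (efobj F y) (efobj F z)))
           (ehom E' (efobj F x) (efobj F z))
           (ecomp E' (efobj F x) (efobj F y) (efobj F z))
           (tens_map \<V> (ehom E x y) (ehom E' (efobj F x) (efobj F y))
              (ehom E y z) (ehom E' (efobj F y) (efobj F z))
              (efmap F x y) (efmap F y z))"
    and efobj_undefined: "x \<notin> eobj E \<Longrightarrow> efobj F x = undefined"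
    and efmap_undefined: "\<not> (x \<in> eobj E \<and> y \<in> eobj E) \<Longrightarrow> efmap F x y = undefined"

definition EnrCat ::
  "('o, 'm, 'z) moncat_scheme \<Rightarrow> (('x, 'o, 'm) ecat, ('x, 'm) efun) cat" where
  "EnrCat \<V> =
     \<lparr>Obj = {E. enriched_category \<V> E},
      Hom = (\<lambda>E E'. {F. enriched_functor \<V> E E' F}),
      Ide = (\<lambda>E. \<lparr>efobj = (\<lambda>x. if x \<in> eobj E then x else undefined),
                   efmap = (\<lambda>x y. if x \<in> eobj E \<and> y \<in> eobj E then Ide \<V> (ehom E x y)
                                  else undefined)\<rparr>),
      Comp = (\<lambda>E E' E'' G F.
        \<lparr>efobj = (\<lambda>x. if x \<in> eobj E then efobj G (efobj F x) else undefined),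
         efmap = (\<lambda>x y. if x \<in> eobj E \<and> y \<in> eobj E
           then Comp \<V> (ehom E x y) (ehom E' (efobj F x) (efobj F y))
                  (ehom E'' (efobj G (efobj F x)) (efobj G (efobj F y)))
                  (efmap G (efobj F x) (efobj F y)) (efmap F x y)
           else undefined)\<rparr>)\<rparr>"


section \<open>Precategories\<close>

text \<open>
  \<open>Src\<close> and \<open>Tgt\<close> stand for the signs \<open>-\<close> and \<open>+\<close>.
\<close>

datatype sign = Src | Tgt

text \<open>
  \<open>cells C k\<close> is \<open>C\<^sub>k\<close>; \<open>bd C e i\<close> is the one-step boundary from dimension
  \<open>i + 1\<close> to \<open>i\<close>; \<open>idn C k\<close> is the identity operation from dimension \<open>k\<close> to \<open>k + 1\<close>;
  \<open>cmp C k l u v\<close> is \<open>u *\<^sub>i v\<close> for \<open>u\<close> of dimension \<open>k\<close> and \<open>v\<close> of dimension \<open>l\<close>, where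
  \<open>i = min k l - 1\<close> is determined by \<open>k\<close> and \<open>l\<close>. Cells of different dimensions are not
  required to be different, so dimensions are always passed explicitly. As usual for records,
  values outside the carriers, and in dimensions above \<open>n\<close>, are irrelevant.
\<close>

record 'a precat =
  cells :: "nat \<Rightarrow> 'a set"
  bd :: "sign \<Rightarrow> nat \<Rightarrow> 'a \<Rightarrow> 'a"
  idn :: "nat \<Rightarrow> 'a \<Rightarrow> 'a"
  cmp :: "nat \<Rightarrow> nat \<Rightarrow> 'a \<Rightarrow> 'a \<Rightarrow> 'a"

text \<open>Iterated source or target of a cell of dimension \<open>k\<close>, down to dimension \<open>i \<le> k\<close>.\<close>

primrec bdto :: "'a precat \<Rightarrow> sign \<Rightarrow> nat \<Rightarrow> nat \<Rightarrow> 'a \<Rightarrow> 'a" where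
  "bdto C e i 0 u = u"
| "bdto C e i (Suc k) u = (if Suc k \<le> i then u else bdto C e i k (bd C e k u))"

text \<open>
  \<open>i_composable C i k l u v\<close>: the cells \<open>u \<in> C\<^sub>k\<close> and \<open>v \<in> C\<^sub>l\<close> are \<open>i\<close>-composable.
  \<open>comp_defined n C i k l u v\<close>: moreover the composite \<open>u *\<^sub>i v\<close> is one of the operations
  of an \<open>n\<close>-precategory.
\<close>

definition i_composable :: "'a precat \<Rightarrow> nat \<Rightarrow> nat \<Rightarrow> nat \<Rightarrow> 'a \<Rightarrow> 'a \<Rightarrow> bool" where
  "i_composable C i k l u v \<longleftrightarrow>
     i < k \<and> i < l \<and> u \<in> cells C k \<and> v \<in> cells C l \<and> bdto C Tgt i k u = bdto C Src i l v"

definition comp_defined :: "nat \<Rightarrow> 'a precat \<Rightarrow> nat \<Rightarrow> nat \<Rightarrow> nat \<Rightarrow> 'a \<Rightarrow> 'a \<Rightarrow> bool" where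
  "comp_defined n C i k l u v \<longleftrightarrow>
     0 < k \<and> k \<le> n \<and> 0 < l \<and> l \<le> n \<and> i = min k l - 1 \<and> i_composable C i k l u v"

locale precategory =
  fixes n :: nat and C :: "'a precat"
  assumes bd_cells: "\<lbrakk>i < n; u \<in> cells C (Suc i)\<rbrakk> \<Longrightarrow> bd C e i u \<in> cells C i"
    and globular:
      "\<lbrakk>Suc i < n; u \<in> cells C (Suc (Suc i))\<rbrakk>
       \<Longrightarrow> bd C e i (bd C Src (Suc i) u) = bd C e i (bd C Tgt (Suc i) u)"
    and idn_cells: "\<lbrakk>k < n; u \<in> cells C k\<rbrakk> \<Longrightarrow> idn C k u \<in> cells C (Suc k)"
    and cmp_cells: "comp_defined n C i k l u v \<Longrightarrow> cmp C k l u v \<in> cells C (max k l)"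
    and bd_idn: "\<lbrakk>k < n; u \<in> cells C k\<rbrakk> \<Longrightarrow> bd C e k (idn C k u) = u"
    and bd_cmp_less:
      "\<lbrakk>comp_defined n C i k l u v; k < l\<rbrakk>
       \<Longrightarrow> bd C e (l - 1) (cmp C k l u v) = cmp C k (l - 1) u (bd C e (l - 1) v)"
    and bd_cmp_greater:
      "\<lbrakk>comp_defined n C i k l u v; l < k\<rbrakk>
       \<Longrightarrow> bd C e (k - 1) (cmp C k l u v) = cmp C (k - 1) l (bd C e (k - 1) u) v"
    and src_cmp_eq:
      "comp_defined n C i k k u v \<Longrightarrow> bd C Src (k - 1) (cmp C k k u v) = bd C Src (k - 1) u"
    and tgt_cmp_eq:
      "comp_defined n C i k k u v \<Longrightarrow> bd C Tgt (k - 1) (cmp C k k u v) = bd C Tgt (k - 1) v"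
    and idn_cmp_le:
      "\<lbrakk>u \<in> cells C k; comp_defined n C i (Suc k) l (idn C k u) v; Suc k \<le> l\<rbrakk>
       \<Longrightarrow> cmp C (Suc k) l (idn C k u) v = v"
    and idn_cmp_greater:
      "\<lbrakk>u \<in> cells C k; comp_defined n C i (Suc k) l (idn C k u) v; l < Suc k\<rbrakk>
       \<Longrightarrow> cmp C (Suc k) l (idn C k u) v = idn C k (cmp C k l u v)"
    and cmp_idn_le:
      "\<lbrakk>u \<in> cells C k; comp_defined n C i l (Suc k) v (idn C k u); Suc k \<le> l\<rbrakk>
       \<Longrightarrow> cmp C l (Suc k) v (idn C k u) = v"
    and cmp_idn_greater:
      "\<lbrakk>u \<in> cells C k; comp_defined n C i l (Suc k) v (idn C k u); l < Suc k\<rbrakk>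
       \<Longrightarrow> cmp C l (Suc k) v (idn C k u) = idn C k (cmp C l k v u)"
    and cmp_assoc:
      "\<lbrakk>comp_defined n C i k l u v; comp_defined n C i (max k l) m (cmp C k l u v) w;
        comp_defined n C i l m v w; comp_defined n C i k (max l m) u (cmp C l m v w)\<rbrakk>
       \<Longrightarrow> cmp C (max k l) m (cmp C k l u v) w = cmp C k (max l m) u (cmp C l m v w)"
    and cmp_distrib_left:
      "\<lbrakk>i < j; u \<in> cells C (Suc i); comp_defined n C j k l v v';
        i_composable C i (Suc i) k u v\<rbrakk>
       \<Longrightarrow> cmp C (Suc i) (max k l) u (cmp C k l v v')
         = cmp C k l (cmp C (Suc i) k u v) (cmp C (Suc i) l u v')"
    and cmp_distrib_right:
      "\<lbrakk>i < j; u \<in> cells C (Suc i); comp_defined n C j k l v v';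
        i_composable C i k (Suc i) v u\<rbrakk>
       \<Longrightarrow> cmp C (max k l) (Suc i) (cmp C k l v v') u
         = cmp C k l (cmp C k (Suc i) v u) (cmp C l (Suc i) v' u)"

type_synonym 'a pmap = "nat \<Rightarrow> 'a \<Rightarrow> 'a"

definition prestrict :: "nat \<Rightarrow> 'a precat \<Rightarrow> 'a pmap \<Rightarrow> 'a pmap" where
  "prestrict n C f = (\<lambda>k u. if k \<le> n \<and> u \<in> cells C k then f k u else undefined)"

text \<open>
  \<open>n\<close>-prefunctors; the last condition fixes the value \<open>undefined\<close> outside the cells, so that
  two prefunctors are equal iff they agree on all cells of dimension at most \<open>n\<close>.
\<close>

locale prefunctor =
  fixes n :: nat and C D :: "'a precat" and f :: "'a pmap"
  assumes map_cells: "\<lbrakk>k \<le> n; u \<in> cells C k\<rbrakk> \<Longrightarrow> f k u \<in> cells D k"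
    and map_bd: "\<lbrakk>i < n; u \<in> cells C (Suc i)\<rbrakk> \<Longrightarrow> f i (bd C e i u) = bd D e i (f (Suc i) u)"
    and map_idn: "\<lbrakk>k < n; u \<in> cells C k\<rbrakk> \<Longrightarrow> f (Suc k) (idn C k u) = idn D k (f k u)"
    and map_cmp:
      "comp_defined n C i k l u v \<Longrightarrow> f (max k l) (cmp C k l u v) = cmp D k l (f k u) (f l v)"
    and map_undefined: "prestrict n C f = f"

definition pcomp :: "nat \<Rightarrow> 'a precat \<Rightarrow> 'a pmap \<Rightarrow> 'a pmap \<Rightarrow> 'a pmap" where
  "pcomp n C g f = prestrict n C (\<lambda>k u. g k (f k u))"

definition pid :: "nat \<Rightarrow> 'a precat \<Rightarrow> 'a pmap" where
  "pid n C = prestrict n C (\<lambda>k u. u)"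

text \<open>
  The category of \<open>n\<close>-precategories that are small with respect to the type \<open>'a\<close>, i.e. whose
  cells are elements of \<open>'a\<close>.
\<close>

definition PCat :: "nat \<Rightarrow> ('a precat, 'a pmap) cat" where
  "PCat n =
     \<lparr>Obj = {C. precategory n C},
      Hom = (\<lambda>C D. {f. prefunctor n C D f}),
      Ide = pid n,
      Comp = (\<lambda>A B D g f. pcomp n A g f)\<rparr>"


section \<open>Terminal precategory, products and 0-skeleta\<close>

definition pterminal :: "'a precat" where
  "pterminal = \<lparr>cells = (\<lambda>k. {undefined}), bd = (\<lambda>e i u. undefined),
                idn = (\<lambda>k u. undefined), cmp = (\<lambda>k l u v. undefined)\<rparr>"

text \<open>
  For infinite \<open>'a\<close>, pairs of elements of \<open>'a\<close> are encoded as elements of \<open>'a\<close> by an arbitrary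
  injection; this makes binary products exist in \<^term>\<open>PCat n\<close>.
\<close>

definition pcode :: "'a \<times> 'a \<Rightarrow> 'a" where
  "pcode = (SOME c. inj c)"

definition pfst :: "'a \<Rightarrow> 'a" where
  "pfst p = fst (inv pcode p)"

definition psnd :: "'a \<Rightarrow> 'a" where
  "psnd p = snd (inv pcode p)"

definition pprod :: "'a precat \<Rightarrow> 'a precat \<Rightarrow> 'a precat" where
  "pprod C D =
     \<lparr>cells = (\<lambda>k. pcode ` (cells C k \<times> cells D k)),
      bd = (\<lambda>e i p. pcode (bd C e i (pfst p), bd D e i (psnd p))),
      idn = (\<lambda>k p. pcode (idn C k (pfst p), idn D k (psnd p))),
      cmp = (\<lambda>k l p q. pcode (cmp C k l (pfst p) (pfst q), cmp D k l (psnd p) (psnd q)))\<rparr>"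

definition pproj1 :: "nat \<Rightarrow> 'a precat \<Rightarrow> 'a precat \<Rightarrow> 'a pmap" where
  "pproj1 n C D = prestrict n (pprod C D) (\<lambda>k. pfst)"

definition pproj2 :: "nat \<Rightarrow> 'a precat \<Rightarrow> 'a precat \<Rightarrow> 'a pmap" where
  "pproj2 n C D = prestrict n (pprod C D) (\<lambda>k. psnd)"

definition pprod_map :: "nat \<Rightarrow> 'a precat \<Rightarrow> 'a precat \<Rightarrow> 'a pmap \<Rightarrow> 'a pmap \<Rightarrow> 'a pmap" where
  "pprod_map n C D f g = prestrict n (pprod C D) (\<lambda>k p. pcode (f k (pfst p), g k (psnd p)))"

definition pprod_assoc :: "nat \<Rightarrow> 'a precat \<Rightarrow> 'a precat \<Rightarrow> 'a precat \<Rightarrow> 'a pmap" where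
  "pprod_assoc n C D E = prestrict n (pprod (pprod C D) E)
     (\<lambda>k p. pcode (pfst (pfst p), pcode (psnd (pfst p), psnd p)))"

text \<open>
  In the 0-skeleton the iterated identity of a 0-cell \<open>x\<close> is represented by \<open>x\<close> itself, in
  every dimension; the canonical morphism \<open>pskel_incl\<close> sends it to the iterated identity in \<open>C\<close>.
\<close>

definition pskel :: "'a precat \<Rightarrow> 'a precat" where
  "pskel C = \<lparr>cells = (\<lambda>k. cells C 0), bd = (\<lambda>e i x. x),
              idn = (\<lambda>k x. x), cmp = (\<lambda>k l x y. x)\<rparr>"

primrec idn_iter :: "'a precat \<Rightarrow> nat \<Rightarrow> 'a \<Rightarrow> 'a" where
  "idn_iter C 0 x = x"
| "idn_iter C (Suc k) x = idn C k (idn_iter C k x)"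

definition pskel_incl :: "nat \<Rightarrow> 'a precat \<Rightarrow> 'a pmap" where
  "pskel_incl n C = prestrict n (pskel C) (idn_iter C)"

definition pskel_map :: "nat \<Rightarrow> 'a precat \<Rightarrow> 'a pmap \<Rightarrow> 'a pmap" where
  "pskel_map n C f = prestrict n (pskel C) (\<lambda>k. f 0)"


section \<open>The funny tensor product\<close>

text \<open>
  For infinite \<open>'a\<close> the pushouts below exist in \<^term>\<open>PCat n\<close>, and one of them is chosen. The
  morphisms introduced by \<open>THE\<close> are determined by the universal property of these pushouts.
\<close>

definition funny_pushout ::
  "nat \<Rightarrow> 'a precat \<Rightarrow> 'a precat \<Rightarrow> 'a precat \<Rightarrow> 'a pmap \<Rightarrow> 'a pmap \<Rightarrow> bool" where
  "funny_pushout n C D P l r \<longleftrightarrow>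
     is_pushout (PCat n)
       (pprod (pskel C) (pskel D)) (pprod C (pskel D)) (pprod (pskel C) D)
       (pprod_map n (pskel C) (pskel D) (pskel_incl n C) (pid n (pskel D)))
       (pprod_map n (pskel C) (pskel D) (pid n (pskel C)) (pskel_incl n D))
       P l r"

definition funny :: "nat \<Rightarrow> 'a precat \<Rightarrow> 'a precat \<Rightarrow> 'a precat \<times> 'a pmap \<times> 'a pmap" where
  "funny n C D = (SOME (P, l, r). funny_pushout n C D P l r)"

definition ftens :: "nat \<Rightarrow> 'a precat \<Rightarrow> 'a precat \<Rightarrow> 'a precat" where
  "ftens n C D = fst (funny n C D)"

definition finl :: "nat \<Rightarrow> 'a precat \<Rightarrow> 'a precat \<Rightarrow> 'a pmap" where
  "finl n C D = fst (snd (funny n C D))"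

definition finr :: "nat \<Rightarrow> 'a precat \<Rightarrow> 'a precat \<Rightarrow> 'a pmap" where
  "finr n C D = snd (snd (funny n C D))"

definition ftens_map ::
  "nat \<Rightarrow> 'a precat \<Rightarrow> 'a precat \<Rightarrow> 'a precat \<Rightarrow> 'a precat \<Rightarrow> 'a pmap \<Rightarrow> 'a pmap \<Rightarrow> 'a pmap" where
  "ftens_map n C C' D D' f g =
     (THE h. prefunctor n (ftens n C D) (ftens n C' D') h \<and>
        pcomp n (pprod C (pskel D)) h (finl n C D)
          = pcomp n (pprod C (pskel D)) (finl n C' D')
              (pprod_map n C (pskel D) f (pskel_map n D g)) \<and>
        pcomp n (pprod (pskel C) D) h (finr n C D)
          = pcomp n (pprod (pskel C) D) (finr n C' D')
              (pprod_map n (pskel C) D (pskel_map n C f) g))"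

definition flunit :: "nat \<Rightarrow> 'a precat \<Rightarrow> 'a pmap" where
  "flunit n C =
     (THE h. prefunctor n (ftens n pterminal C) C h \<and>
        pcomp n (pprod (pskel pterminal) C) h (finr n pterminal C)
          = pproj2 n (pskel pterminal) C \<and>
        pcomp n (pprod pterminal (pskel C)) h (finl n pterminal C)
          = pcomp n (pprod pterminal (pskel C)) (pskel_incl n C)
              (pproj2 n pterminal (pskel C)))"

definition frunit :: "nat \<Rightarrow> 'a precat \<Rightarrow> 'a pmap" where
  "frunit n C =
     (THE h. prefunctor n (ftens n C pterminal) C h \<and>
        pcomp n (pprod C (pskel pterminal)) h (finl n C pterminal)
          = pproj1 n C (pskel pterminal) \<and>
        pcomp n (pprod (pskel C) pterminal) h (finr n C pterminal)
          = pcomp n (pprod (pskel C) pterminal) (pskel_incl n C)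
              (pproj1 n (pskel C) pterminal))"

text \<open>
  The three colimit coprojections into \<open>(C \<boxtimes> D) \<boxtimes> E\<close>, from the products
  \<open>(C \<times> D\<^sub>0) \<times> E\<^sub>0\<close>, \<open>(C\<^sub>0 \<times> D) \<times> E\<^sub>0\<close> and \<open>(C\<^sub>0 \<times> D\<^sub>0) \<times> E\<close> (a subscript 0 denoting the
  0-skeleton), and the three into \<open>C \<boxtimes> (D \<boxtimes> E)\<close>, from \<open>C \<times> (D\<^sub>0 \<times> E\<^sub>0)\<close>,
  \<open>C\<^sub>0 \<times> (D \<times> E\<^sub>0)\<close> and \<open>C\<^sub>0 \<times> (D\<^sub>0 \<times> E)\<close>. The morphism from \<open>C\<^sub>0 \<times> D\<^sub>0\<close> to the 0-skeleton of
  \<open>C \<boxtimes> D\<close> is the 0-skeleton of \<open>finl n C D\<close>, since the 0-skeleton of \<open>C \<times> D\<^sub>0\<close> has the same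
  cells as \<open>C\<^sub>0 \<times> D\<^sub>0\<close>; similarly for the other bracketing.
\<close>

definition finL1 :: "nat \<Rightarrow> 'a precat \<Rightarrow> 'a precat \<Rightarrow> 'a precat \<Rightarrow> 'a pmap" where
  "finL1 n C D E = pcomp n (pprod (pprod C (pskel D)) (pskel E))
     (finl n (ftens n C D) E)
     (pprod_map n (pprod C (pskel D)) (pskel E) (finl n C D) (pid n (pskel E)))"

definition finL2 :: "nat \<Rightarrow> 'a precat \<Rightarrow> 'a precat \<Rightarrow> 'a precat \<Rightarrow> 'a pmap" where
  "finL2 n C D E = pcomp n (pprod (pprod (pskel C) D) (pskel E))
     (finl n (ftens n C D) E)
     (pprod_map n (pprod (pskel C) D) (pskel E) (finr n C D) (pid n (pskel E)))"

definition finL3 :: "nat \<Rightarrow> 'a precat \<Rightarrow> 'a precat \<Rightarrow> 'a precat \<Rightarrow> 'a pmap" where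
  "finL3 n C D E = pcomp n (pprod (pprod (pskel C) (pskel D)) E)
     (finr n (ftens n C D) E)
     (pprod_map n (pprod (pskel C) (pskel D)) E
        (pskel_map n (pprod C (pskel D)) (finl n C D)) (pid n E))"

definition finR1 :: "nat \<Rightarrow> 'a precat \<Rightarrow> 'a precat \<Rightarrow> 'a precat \<Rightarrow> 'a pmap" where
  "finR1 n C D E = pcomp n (pprod C (pprod (pskel D) (pskel E)))
     (finl n C (ftens n D E))
     (pprod_map n C (pprod (pskel D) (pskel E))
        (pid n C) (pskel_map n (pprod D (pskel E)) (finl n D E)))"

definition finR2 :: "nat \<Rightarrow> 'a precat \<Rightarrow> 'a precat \<Rightarrow> 'a precat \<Rightarrow> 'a pmap" where
  "finR2 n C D E = pcomp n (pprod (pskel C) (pprod D (pskel E)))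
     (finr n C (ftens n D E))
     (pprod_map n (pskel C) (pprod D (pskel E)) (pid n (pskel C)) (finl n D E))"

definition finR3 :: "nat \<Rightarrow> 'a precat \<Rightarrow> 'a precat \<Rightarrow> 'a precat \<Rightarrow> 'a pmap" where
  "finR3 n C D E = pcomp n (pprod (pskel C) (pprod (pskel D) E))
     (finr n C (ftens n D E))
     (pprod_map n (pskel C) (pprod (pskel D) E) (pid n (pskel C)) (finr n D E))"

definition fassoc :: "nat \<Rightarrow> 'a precat \<Rightarrow> 'a precat \<Rightarrow> 'a precat \<Rightarrow> 'a pmap" where
  "fassoc n C D E =
     (THE h. prefunctor n (ftens n (ftens n C D) E) (ftens n C (ftens n D E)) h \<and>
        pcomp n (pprod (pprod C (pskel D)) (pskel E)) h (finL1 n C D E)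
          = pcomp n (pprod (pprod C (pskel D)) (pskel E))
              (finR1 n C D E) (pprod_assoc n C (pskel D) (pskel E)) \<and>
        pcomp n (pprod (pprod (pskel C) D) (pskel E)) h (finL2 n C D E)
          = pcomp n (pprod (pprod (pskel C) D) (pskel E))
              (finR2 n C D E) (pprod_assoc n (pskel C) D (pskel E)) \<and>
        pcomp n (pprod (pprod (pskel C) (pskel D)) E) h (finL3 n C D E)
          = pcomp n (pprod (pprod (pskel C) (pskel D)) E)
              (finR3 n C D E) (pprod_assoc n (pskel C) (pskel D) E))"

definition FunnyPCat :: "nat \<Rightarrow> ('a precat, 'a pmap) moncat" where
  "FunnyPCat n =
     \<lparr>Obj = Obj (PCat n), Hom = Hom (PCat n), Ide = Ide (PCat n), Comp = Comp (PCat n),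
      tens = ftens n, tens_map = ftens_map n, munit = pterminal,
      assoc = fassoc n, lunit = flunit n, runit = frunit n\<rparr>"

end

theory Submission
  imports Defs
begin

text \<open>
  The boundary of a cell of dimension \<open>k + 1\<close> down to dimension \<open>0\<close> sorts the cells of positive
  dimension of an \<open>(n+1)\<close>-precategory into hom-\<open>n\<close>-precategories. What remains of the structure are
  the identities of the \<open>0\<close>-cells and the compositions \<open>u *\<^sub>0 v\<close>, in which \<open>u\<close> or \<open>v\<close> has dimension
  \<open>1\<close>: these are two families of whiskerings that agree on pairs of \<open>1\<close>-cells, which is exactly what
  a morphism out of the pushout \<open>H(x,y) \<boxtimes> H(y,z)\<close> is. The morphisms out of
  \<open>(C \<boxtimes> D) \<boxtimes> E\<close> are determined on three families of cells, so associativity splits into the three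
  cases of the associativity of \<open>*\<^sub>0\<close>; here one needs that the \<open>0\<close>-cells of \<open>C \<boxtimes> D\<close> are the pairs
  of \<open>0\<close>-cells. The passage to enriched categories is a functor that is fully faithful and essentially
  surjective.
\<close>

section \<open>Equivalences from fully faithful functors\<close>

text \<open>The tensor product is an arbitrarily chosen pushout in a category whose cells live in
  the fixed type \<open>'a\<close>, which raises two obstacles. First, the pushout must exist there.
  It is cut out of the product over all cocones as the part generated by the two legs; the product
  itself may be too large for \<open>'a\<close>, but its generated part has at most as many cells as
  there are terms over \<open>'a\<close>, and an infinite \<open>'a\<close> can code these. Second,
  after the choice nothing is known about the pushout except its universal property. Induction over
  its cells is therefore derived by mapping it into a subprecategory, and pairs of 0-cells are told
  apart by mapping it to the cartesian product. The associator depends on both: its third family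
  starts from 0-cells of C \<boxtimes> D, and a morphism can be specified there only once these
  cells split uniquely into pairs. The laws of enriched categories and functors are translated into
  equations between whiskered cells, and the comparison with precategories then works with
  whiskerings alone.\<close>

lemma iso_in_inverse:
  assumes "iso_in \<C> A B f"
  obtains g where "f \<in> Hom \<C> A B" "g \<in> Hom \<C> B A"
    "Comp \<C> A B A g f = Ide \<C> A" "Comp \<C> B A B f g = Ide \<C> B"
  using assms unfolding iso_in_def by blast

text \<open>Choosing a preimage \<open>G0 Y\<close> and an isomorphism \<open>e Y\<close> for every
  \<open>Y\<close> yields the inverse functor: an arrow is conjugated with these isomorphisms and
  lifted uniquely through \<open>F\<close>. The \<open>e Y\<close> form the counit, and the lifts of
  their inverses form the unit.\<close>

lemma equivalent_categories_if_fully_faithful: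
  assumes C: "category \<C>" and D: "category \<D>" and F: "is_functor \<C> \<D> F"
    and faithful: "\<And>A B f g. \<lbrakk>A \<in> Obj \<C>; B \<in> Obj \<C>; f \<in> Hom \<C> A B; g \<in> Hom \<C> A B;
      fun_map F A B f = fun_map F A B g\<rbrakk> \<Longrightarrow> f = g"
    and full: "\<And>A B h. \<lbrakk>A \<in> Obj \<C>; B \<in> Obj \<C>; h \<in> Hom \<D> (fun_obj F A) (fun_obj F B)\<rbrakk>
      \<Longrightarrow> \<exists>f \<in> Hom \<C> A B. fun_map F A B f = h"
    and eso: "\<And>Y. Y \<in> Obj \<D> \<Longrightarrow> \<exists>A \<in> Obj \<C>. \<exists>e. iso_in \<D> (fun_obj F A) Y e"
  shows "equivalent_categories \<C> \<D>"
proof -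
  interpret C: category \<C> by (rule C)
  interpret D: category \<D> by (rule D)
  interpret F: is_functor \<C> \<D> F by (rule F)
  obtain G0 e where G0: "\<And>Y. Y \<in> Obj \<D> \<Longrightarrow> G0 Y \<in> Obj \<C>"
    and e: "\<And>Y. Y \<in> Obj \<D> \<Longrightarrow> iso_in \<D> (fun_obj F (G0 Y)) Y (e Y)"
    using eso by metis
  let ?F = "fun_obj F" and ?o = "Comp \<D>"
  have "\<forall>Y. \<exists>g. Y \<in> Obj \<D> \<longrightarrow> g \<in> Hom \<D> Y (?F (G0 Y)) \<and>
    ?o (?F (G0 Y)) Y (?F (G0 Y)) g (e Y) = Ide \<D> (?F (G0 Y)) \<and>
    ?o Y (?F (G0 Y)) Y (e Y) g = Ide \<D> Y"
    using e by (meson iso_in_inverse)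
  then obtain d where d: "\<And>Y. Y \<in> Obj \<D> \<Longrightarrow> d Y \<in> Hom \<D> Y (?F (G0 Y))"
    and de: "\<And>Y. Y \<in> Obj \<D> \<Longrightarrow> ?o (?F (G0 Y)) Y (?F (G0 Y)) (d Y) (e Y) = Ide \<D> (?F (G0 Y))"
    and ed: "\<And>Y. Y \<in> Obj \<D> \<Longrightarrow> ?o Y (?F (G0 Y)) Y (e Y) (d Y) = Ide \<D> Y"
    by metis
  have eH: "\<And>Y. Y \<in> Obj \<D> \<Longrightarrow> e Y \<in> Hom \<D> (?F (G0 Y)) Y"
    using e unfolding iso_in_def by blast
  have "\<forall>A B h. \<exists>f. A \<in> Obj \<C> \<and> B \<in> Obj \<C> \<and> h \<in> Hom \<D> (?F A) (?F B) \<longrightarrow>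
      f \<in> Hom \<C> A B \<and> fun_map F A B f = h"
    using full by blast
  then obtain lift where lift: "\<And>A B h. \<lbrakk>A \<in> Obj \<C>; B \<in> Obj \<C>; h \<in> Hom \<D> (?F A) (?F B)\<rbrakk> \<Longrightarrow>
      lift A B h \<in> Hom \<C> A B \<and> fun_map F A B (lift A B h) = h"
    by metis
  note Fo[simp] = F.fun_obj
  define conj where "conj X Y h = ?o (?F (G0 X)) Y (?F (G0 Y)) (d Y) (?o (?F (G0 X)) X Y h (e X))" for X Y h
  have conj: "conj X Y h \<in> Hom \<D> (?F (G0 X)) (?F (G0 Y))"
    if "X \<in> Obj \<D>" "Y \<in> Obj \<D>" "h \<in> Hom \<D> X Y" for X Y h
    unfolding conj_def using that d eH G0 by (meson D.Comp_in_Hom Fo)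
  have e_conj: "?o (?F (G0 X)) (?F (G0 Y)) Y (e Y) (conj X Y h) = ?o (?F (G0 X)) X Y h (e X)"
    if "X \<in> Obj \<D>" "Y \<in> Obj \<D>" "h \<in> Hom \<D> X Y" for X Y h
  proof -
    have he: "?o (?F (G0 X)) X Y h (e X) \<in> Hom \<D> (?F (G0 X)) Y"
      using that eH G0 by (meson D.Comp_in_Hom Fo)
    show ?thesis unfolding conj_def
      using that he G0 D.Comp_assoc[of "?F (G0 X)" Y "?F (G0 Y)" Y "?o (?F (G0 X)) X Y h (e X)" "d Y" "e Y"]
      by (simp add: eH d ed D.Comp_Ide_left)
  qed
  \<comment> \<open>Cancelling the isomorphism \<open>e Y\<close> shows that
    \<open>conj X Y h\<close> is the only filler of the naturality square. Functoriality of
    \<open>G\<close> thus reduces to pasting squares.\<close>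
  have conj_unique: "g = conj X Y h"
    if XY: "X \<in> Obj \<D>" "Y \<in> Obj \<D>" and g: "g \<in> Hom \<D> (?F (G0 X)) (?F (G0 Y))"
      and eq: "?o (?F (G0 X)) (?F (G0 Y)) Y (e Y) g = ?o (?F (G0 X)) X Y h (e X)" for X Y g h
  proof -
    have "g = ?o (?F (G0 X)) (?F (G0 Y)) (?F (G0 Y)) (?o (?F (G0 Y)) Y (?F (G0 Y)) (d Y) (e Y)) g"
      using XY g G0 by (simp add: de D.Comp_Ide_left)
    also have "\<dots> = ?o (?F (G0 X)) Y (?F (G0 Y)) (d Y) (?o (?F (G0 X)) (?F (G0 Y)) Y (e Y) g)"
      using D.Comp_assoc[of "?F (G0 X)" "?F (G0 Y)" Y "?F (G0 Y)" g "e Y" "d Y"] XY g G0 d eH by simp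
    finally show ?thesis using eq conj_def by simp
  qed
  define G where "G = \<lparr>funct.fun_obj = G0, fun_map = (\<lambda>X Y h. lift (G0 X) (G0 Y) (conj X Y h))\<rparr>"
  have Gm: "fun_map G X Y h \<in> Hom \<C> (G0 X) (G0 Y)"
    and FGm: "fun_map F (G0 X) (G0 Y) (fun_map G X Y h) = conj X Y h"
    if "X \<in> Obj \<D>" "Y \<in> Obj \<D>" "h \<in> Hom \<D> X Y" for X Y h
    using lift[OF _ _ conj] that G0 by (auto simp: G_def)
  have Go: "fun_obj G X = G0 X" for X by (simp add: G_def)
  have G: "is_functor \<D> \<C> G"
  proof
    fix X assume X: "X \<in> Obj \<D>"
    then show "fun_obj G X \<in> Obj \<C>" by (simp add: Go G0)
    have "conj X X (Ide \<D> X) = Ide \<D> (?F (G0 X))"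
      by (rule conj_unique[symmetric])
        (use X G0 eH in \<open>simp_all add: D.Ide_in_Hom D.Comp_Ide_left D.Comp_Ide_right\<close>)
    then have "fun_map F (G0 X) (G0 X) (fun_map G X X (Ide \<D> X)) = fun_map F (G0 X) (G0 X) (Ide \<C> (G0 X))"
      using X G0 by (simp add: FGm D.Ide_in_Hom F.fun_map_Ide)
    then show "fun_map G X X (Ide \<D> X) = Ide \<C> (fun_obj G X)"
      unfolding Go using X G0 Gm D.Ide_in_Hom C.Ide_in_Hom faithful by metis
  next
    fix X Y h assume "X \<in> Obj \<D>" "Y \<in> Obj \<D>" "h \<in> Hom \<D> X Y"
    then show "fun_map G X Y h \<in> Hom \<C> (fun_obj G X) (fun_obj G Y)"
      using Gm Go by simp
  next
    fix X Y Z g h assume *: "X \<in> Obj \<D>" "Y \<in> Obj \<D>" "Z \<in> Obj \<D>" "g \<in> Hom \<D> X Y" "h \<in> Hom \<D> Y Z"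
    have a: "conj X Z (?o X Y Z h g) = ?o (?F (G0 X)) (?F (G0 Y)) (?F (G0 Z)) (conj Y Z h) (conj X Y g)"
    proof (rule conj_unique[symmetric])
      show "?o (?F (G0 X)) (?F (G0 Y)) (?F (G0 Z)) (conj Y Z h) (conj X Y g) \<in> Hom \<D> (?F (G0 X)) (?F (G0 Z))"
        using * G0 conj by (meson D.Comp_in_Hom Fo)
      have "?o (?F (G0 X)) (?F (G0 Z)) Z (e Z) (?o (?F (G0 X)) (?F (G0 Y)) (?F (G0 Z)) (conj Y Z h) (conj X Y g))
        = ?o (?F (G0 X)) (?F (G0 Y)) Z (?o (?F (G0 Y)) (?F (G0 Z)) Z (e Z) (conj Y Z h)) (conj X Y g)"
        using * G0 conj eH by (simp add: D.Comp_assoc)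
      also have "\<dots> = ?o (?F (G0 X)) (?F (G0 Y)) Z (?o (?F (G0 Y)) Y Z h (e Y)) (conj X Y g)"
        using * by (simp add: e_conj)
      also have "\<dots> = ?o (?F (G0 X)) Y Z h (?o (?F (G0 X)) (?F (G0 Y)) Y (e Y) (conj X Y g))"
        using * G0 conj eH by (simp add: D.Comp_assoc)
      also have "\<dots> = ?o (?F (G0 X)) X Z (?o X Y Z h g) (e X)"
        using * G0 eH by (simp add: e_conj D.Comp_assoc)
      finally show "?o (?F (G0 X)) (?F (G0 Z)) Z (e Z) (?o (?F (G0 X)) (?F (G0 Y)) (?F (G0 Z)) (conj Y Z h) (conj X Y g))
        = ?o (?F (G0 X)) X Z (?o X Y Z h g) (e X)" .
    qed (use * in auto)
    have hg: "?o X Y Z h g \<in> Hom \<D> X Z" using * D.Comp_in_Hom by blast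
    have "fun_map F (G0 X) (G0 Z) (fun_map G X Z (?o X Y Z h g))
      = fun_map F (G0 X) (G0 Z) (Comp \<C> (G0 X) (G0 Y) (G0 Z) (fun_map G Y Z h) (fun_map G X Y g))"
      using * hg G0 by (simp add: FGm F.fun_map_Comp Gm a)
    moreover have "Comp \<C> (G0 X) (G0 Y) (G0 Z) (fun_map G Y Z h) (fun_map G X Y g) \<in> Hom \<C> (G0 X) (G0 Z)"
      using * G0 Gm by (meson C.Comp_in_Hom)
    ultimately show "fun_map G X Z (?o X Y Z h g)
      = Comp \<C> (fun_obj G X) (fun_obj G Y) (fun_obj G Z) (fun_map G Y Z h) (fun_map G X Y g)"
      unfolding Go using * hg G0 Gm faithful by meson
  qed
  have "natural_iso \<D> \<D> (comp_functor F G) id_functor e"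
    unfolding natural_iso_def comp_functor_def id_functor_def
    by (auto simp: Go e FGm e_conj)
  moreover
  define \<eta> where "\<eta> A = lift A (G0 (?F A)) (d (?F A))" for A
  have \<eta>: "\<eta> A \<in> Hom \<C> A (G0 (?F A))" "fun_map F A (G0 (?F A)) (\<eta> A) = d (?F A)" if "A \<in> Obj \<C>" for A
    using lift[of A "G0 (?F A)" "d (?F A)"] that G0 d by (auto simp: \<eta>_def)
  have "iso_in \<C> A (G0 (?F A)) (\<eta> A)" if A: "A \<in> Obj \<C>" for A
  proof -
    let ?B = "G0 (?F A)"
    \<comment> \<open>The lift of \<open>e\<close> is inverse to \<open>\<eta> A\<close>: both
      composites become identities under the faithful \<open>F\<close>.\<close>
    define \<theta> where "\<theta> = lift ?B A (e (?F A))"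
    have B: "?B \<in> Obj \<C>" using A G0 by simp
    have \<theta>: "\<theta> \<in> Hom \<C> ?B A" "fun_map F ?B A \<theta> = e (?F A)"
      using lift[of ?B A "e (?F A)"] A B eH by (auto simp: \<theta>_def)
    have "fun_map F A A (Comp \<C> A ?B A \<theta> (\<eta> A)) = fun_map F A A (Ide \<C> A)"
      using A B \<theta> \<eta> by (simp add: F.fun_map_Comp F.fun_map_Ide ed)
    then have 1: "Comp \<C> A ?B A \<theta> (\<eta> A) = Ide \<C> A"
      using A B \<theta> \<eta> by (meson C.Comp_in_Hom C.Ide_in_Hom faithful)
    have "fun_map F ?B ?B (Comp \<C> ?B A ?B (\<eta> A) \<theta>) = fun_map F ?B ?B (Ide \<C> ?B)"
      using A B \<theta> \<eta> by (simp add: F.fun_map_Comp F.fun_map_Ide de)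
    then have 2: "Comp \<C> ?B A ?B (\<eta> A) \<theta> = Ide \<C> ?B"
      using A B \<theta> \<eta> by (meson C.Comp_in_Hom C.Ide_in_Hom faithful)
    show ?thesis unfolding iso_in_def using 1 2 \<theta> \<eta> A by blast
  qed
  moreover have "Comp \<C> A B (G0 (?F B)) (\<eta> B) f =
    Comp \<C> A (G0 (?F A)) (G0 (?F B)) (fun_map G (?F A) (?F B) (fun_map F A B f)) (\<eta> A)"
    if AB: "A \<in> Obj \<C>" "B \<in> Obj \<C>" and f: "f \<in> Hom \<C> A B" for A B f
  proof (rule faithful[of A "G0 (?F B)"])
    let ?GA = "G0 (?F A)" and ?GB = "G0 (?F B)" and ?f = "fun_map F A B f"
    have G0': "?GA \<in> Obj \<C>" "?GB \<in> Obj \<C>" using AB G0 by auto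
    have Ff: "?f \<in> Hom \<D> (?F A) (?F B)" using AB f F.fun_map by blast
    have Gf: "fun_map G (?F A) (?F B) ?f \<in> Hom \<C> ?GA ?GB" using AB Ff Gm by simp
    show "Comp \<C> A B ?GB (\<eta> B) f \<in> Hom \<C> A ?GB"
      "Comp \<C> A ?GA ?GB (fun_map G (?F A) (?F B) ?f) (\<eta> A) \<in> Hom \<C> A ?GB"
      using AB f G0' \<eta> Gf by (meson C.Comp_in_Hom)+
    have df: "?o (?F A) (?F B) (?F ?GB) (d (?F B)) ?f \<in> Hom \<D> (?F A) (?F ?GB)"
      using AB Ff G0' d by (meson D.Comp_in_Hom Fo)
    have "?o (?F A) (?F ?GA) (?F ?GB) (conj (?F A) (?F B) ?f) (d (?F A))
      = ?o (?F A) (?F ?GA) (?F ?GB) (?o (?F ?GA) (?F A) (?F ?GB) (?o (?F A) (?F B) (?F ?GB) (d (?F B)) ?f) (e (?F A))) (d (?F A))"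
      unfolding conj_def using AB G0' Ff d eH by (simp add: D.Comp_assoc)
    also have "\<dots> = ?o (?F A) (?F A) (?F ?GB) (?o (?F A) (?F B) (?F ?GB) (d (?F B)) ?f)
         (?o (?F A) (?F ?GA) (?F A) (e (?F A)) (d (?F A)))"
      by (rule D.Comp_assoc[symmetric]) (use AB G0' df d eH in auto)
    also have "\<dots> = ?o (?F A) (?F B) (?F ?GB) (d (?F B)) ?f"
      using AB G0' df by (simp add: ed D.Comp_Ide_right)
    finally show "fun_map F A ?GB (Comp \<C> A B ?GB (\<eta> B) f)
      = fun_map F A ?GB (Comp \<C> A ?GA ?GB (fun_map G (?F A) (?F B) ?f) (\<eta> A))"
      using AB f G0' \<eta> Gf Ff by (simp add: F.fun_map_Comp FGm)
  qed (use that G0 in auto)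
  ultimately have "natural_iso \<D> \<D> (comp_functor F G) id_functor e"
    "natural_iso \<C> \<C> id_functor (comp_functor G F) \<eta>"
    by (auto simp: natural_iso_def comp_functor_def id_functor_def Go)
  then show ?thesis unfolding equivalent_categories_def using C D F G by blast
qed

section \<open>Precategories and their morphisms\<close>

lemma prestrict_apply [simp]: "k \<le> n \<Longrightarrow> u \<in> cells C k \<Longrightarrow> prestrict n C f k u = f k u"
  by (simp add: prestrict_def)

lemma prestrict_eqI:
  "(\<And>k u. k \<le> n \<Longrightarrow> u \<in> cells C k \<Longrightarrow> f k u = g k u) \<Longrightarrow> prestrict n C f = prestrict n C g"
  unfolding prestrict_def by (intro ext) auto

lemma prestrict_eqD:
  "prestrict n C f = prestrict n C g \<Longrightarrow> k \<le> n \<Longrightarrow> u \<in> cells C k \<Longrightarrow> f k u = g k u"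
  by (metis prestrict_apply)

lemma prestrict_idem [simp]: "prestrict n C (prestrict n C f) = prestrict n C f"
  by (rule prestrict_eqI) simp

lemma pcomp_apply [simp]: "k \<le> n \<Longrightarrow> u \<in> cells C k \<Longrightarrow> pcomp n C g f k u = g k (f k u)"
  by (simp add: pcomp_def)

lemma pcomp_eqI:
  "(\<And>k u. k \<le> n \<Longrightarrow> u \<in> cells C k \<Longrightarrow> g k (f k u) = g' k (f' k u)) \<Longrightarrow> pcomp n C g f = pcomp n C g' f'"
  unfolding pcomp_def by (rule prestrict_eqI) simp

lemma pcomp_eqD:
  "pcomp n C g f = pcomp n C g' f' \<Longrightarrow> k \<le> n \<Longrightarrow> u \<in> cells C k \<Longrightarrow> g k (f k u) = g' k (f' k u)"
  by (metis pcomp_apply)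

lemma pid_apply [simp]: "k \<le> n \<Longrightarrow> u \<in> cells C k \<Longrightarrow> pid n C k u = u"
  by (simp add: pid_def)

text \<open>A prefunctor without the normalisation outside the cells.\<close>

locale premor =
  fixes n :: nat and C D :: "'a precat" and f :: "nat \<Rightarrow> 'a \<Rightarrow> 'a"
  assumes map_cells: "\<lbrakk>k \<le> n; u \<in> cells C k\<rbrakk> \<Longrightarrow> f k u \<in> cells D k"
    and map_bd: "\<lbrakk>i < n; u \<in> cells C (Suc i)\<rbrakk> \<Longrightarrow> f i (bd C e i u) = bd D e i (f (Suc i) u)"
    and map_idn: "\<lbrakk>k < n; u \<in> cells C k\<rbrakk> \<Longrightarrow> f (Suc k) (idn C k u) = idn D k (f k u)"
    and map_cmp:
      "comp_defined n C i k l u v \<Longrightarrow> f (max k l) (cmp C k l u v) = cmp D k l (f k u) (f l v)"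

lemma prefunctor_iff_premor: "prefunctor n C D f \<longleftrightarrow> premor n C D f \<and> prestrict n C f = f"
  by (auto simp: prefunctor_def premor_def)

lemma prefunctor_premor: "prefunctor n C D f \<Longrightarrow> premor n C D f"
  by (simp add: prefunctor_iff_premor)

lemma prefunctor_eqI:
  assumes "prefunctor n C D f" "prefunctor n C D' g"
    and "\<And>k u. k \<le> n \<Longrightarrow> u \<in> cells C k \<Longrightarrow> f k u = g k u"
  shows "f = g"
  using assms by (metis prefunctor_iff_premor prestrict_eqI)

section \<open>Iterated boundaries of cells and composites\<close>

lemma bdto_ge: "k \<le> i \<Longrightarrow> bdto C e i k u = u"
  by (cases k) auto

lemma bdto_Suc: "i \<le> k \<Longrightarrow> bdto C e i (Suc k) u = bdto C e i k (bd C e k u)"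
  by simp

declare bdto.simps(2) [simp del]

context precategory begin

lemma bdto_cells: "k \<le> n \<Longrightarrow> u \<in> cells C k \<Longrightarrow> i \<le> k \<Longrightarrow> bdto C e i k u \<in> cells C i"
proof (induction k arbitrary: u)
  case (Suc k)
  then show ?case by (cases "i = Suc k") (auto simp: bdto_Suc bdto_ge bd_cells)
qed simp

text \<open>Since \<open>i < k\<close>, at least one more boundary is taken below dimension
  \<open>k\<close>, and globularity makes the first sign irrelevant there.\<close>

lemma bdto_bd:
  "i < k \<Longrightarrow> k < n \<Longrightarrow> u \<in> cells C (Suc k) \<Longrightarrow> bdto C e i k (bd C e' k u) = bdto C e i (Suc k) u"
  using globular[of "k - 1" u e]
  by (cases k; cases e; cases e') (auto simp: bdto_Suc)

lemma bdto_idn: "i \<le> k \<Longrightarrow> k < n \<Longrightarrow> u \<in> cells C k \<Longrightarrow> bdto C e i (Suc k) (idn C k u) = bdto C e i k u"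
  by (simp add: bdto_Suc bd_idn)

lemma bdto_bdto:
  "i < j \<Longrightarrow> j \<le> k \<Longrightarrow> k \<le> n \<Longrightarrow> u \<in> cells C k \<Longrightarrow> bdto C e i j (bdto C e' j k u) = bdto C e i k u"
proof (induction k arbitrary: u)
  case (Suc k)
  then show ?case by (cases "j = Suc k") (auto simp: bdto_Suc[of j] bdto_ge bdto_bd bd_cells)
qed simp

lemma comp_definedD:
  assumes "comp_defined n C i k l u v"
  shows "0 < k" "k \<le> n" "0 < l" "l \<le> n" "i < k" "i < l" "i = min k l - 1"
    "u \<in> cells C k" "v \<in> cells C l" "bdto C Tgt i k u = bdto C Src i l v"
  using assms by (auto simp: comp_defined_def i_composable_def)

text \<open>A one-step boundary lowers the larger of the two dimensions and keeps
  \<open>min k l\<close>, hence \<open>i\<close>. The descent ends at equal dimensions, where the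
  axioms for \<open>k = l\<close> apply. The result decides to which hom-precategory a composite
  belongs.\<close>

lemma bdto_cmp:
  assumes "comp_defined n C i k l u v"
  shows "bdto C Src 0 (max k l) (cmp C k l u v) = bdto C Src 0 k u"
    "bdto C Tgt 0 (max k l) (cmp C k l u v) = bdto C Tgt 0 l v"
proof -
  have "bdto C Src 0 (max k l) (cmp C k l u v) = bdto C Src 0 k u
     \<and> bdto C Tgt 0 (max k l) (cmp C k l u v) = bdto C Tgt 0 l v"
    using assms
  proof (induction "k + l" arbitrary: k l u v rule: less_induct)
    case less
    note D = comp_definedD[OF less.prems]
    consider "k = l" | "k < l" | "l < k" by linarith
    then show ?case
    proof cases
      case 1
      then obtain m where "k = Suc m" "l = Suc m" using D by (cases k) auto
      then show ?thesis
        using src_cmp_eq[of i k u v] tgt_cmp_eq[of i k u v] less.prems by (simp add: bdto_Suc)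
    next
      case 2
      then obtain m where l: "l = Suc m" by (cases l) auto
      have ne: "comp_defined n C i k m u (bd C e m v)" for e
        using D 2 l by (auto simp: comp_defined_def i_composable_def bd_cells bdto_bd)
      show ?thesis
        using less.hyps[OF _ ne, of Src] less.hyps[OF _ ne, of Tgt] bd_cmp_less[OF less.prems 2] 2 l
        by (simp add: bdto_Suc max_def split: if_splits)
    next
      case 3
      then obtain m where k: "k = Suc m" by (cases k) auto
      have ne: "comp_defined n C i m l (bd C e m u) v" for e
        using D 3 k by (auto simp: comp_defined_def i_composable_def bd_cells bdto_bd)
      show ?thesis
        using less.hyps[OF _ ne, of Src] less.hyps[OF _ ne, of Tgt] bd_cmp_greater[OF less.prems 3] 3 k
        by (simp add: bdto_Suc max_absorb1)
    qed
  qed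
  then show "bdto C Src 0 (max k l) (cmp C k l u v) = bdto C Src 0 k u"
    "bdto C Tgt 0 (max k l) (cmp C k l u v) = bdto C Tgt 0 l v" by auto
qed

text \<open>Cells composable in dimension \<open>j\<close> share a \<open>j\<close>-boundary, so by
  globularity they share every boundary below \<open>j\<close>, whatever the sign. In particular all
  cells of a composite above dimension 0 lie in one hom.\<close>

lemma bdto_cmp_lower:
  assumes "comp_defined n C j k l v v'" and ij: "i < j"
  shows "bdto C e i k v = bdto C e i l v'"
    "bdto C e i (max k l) (cmp C k l v v') = bdto C e i k v"
proof -
  have "bdto C e i k v = bdto C e i l v' \<and>
      bdto C e i (max k l) (cmp C k l v v') = bdto C e i k v"
    using assms(1)
  proof (induction "k + l" arbitrary: k l v v' rule: less_induct)
    case less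
    note D = comp_definedD[OF less.prems]
    have eq: "bdto C e i k v = bdto C e i l v'"
      using bdto_bdto[of i j k v e Tgt] bdto_bdto[of i j l v' e Src] D ij by simp
    consider "k = l" | "k < l" | "l < k" by linarith
    then show ?case
    proof cases
      case 1
      then obtain m where "k = Suc m" "l = Suc m" using D by (cases k) auto
      then show ?thesis
        using src_cmp_eq[of j k v v'] tgt_cmp_eq[of j k v v'] less.prems D ij eq 1
        by (cases e) (auto simp: bdto_Suc)
    next
      case 2
      then obtain m where l: "l = Suc m" by (cases l) auto
      have ne: "comp_defined n C j k m v (bd C e m v')"
        using D 2 l by (auto simp: comp_defined_def i_composable_def bd_cells bdto_bd)
      show ?thesis
        using less.hyps[OF _ ne] bd_cmp_less[OF less.prems 2] 2 l eq ij D
        by (simp add: bdto_Suc max_def split: if_splits)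
    next
      case 3
      then obtain m where k: "k = Suc m" by (cases k) auto
      have ne: "comp_defined n C j m l (bd C e m v) v'"
        using D 3 k by (auto simp: comp_defined_def i_composable_def bd_cells bdto_bd)
      show ?thesis
        using less.hyps[OF _ ne] bd_cmp_greater[OF less.prems 3] 3 k eq ij D
        by (simp add: bdto_Suc max_absorb1)
    qed
  qed
  then show "bdto C e i k v = bdto C e i l v'"
    "bdto C e i (max k l) (cmp C k l v v') = bdto C e i k v" by auto
qed

lemma bdto_whisker_left:
  assumes "comp_defined n C i (Suc i) k u v" "i < j" "j \<le> k"
  shows "bdto C e j k (cmp C (Suc i) k u v) = cmp C (Suc i) j u (bdto C e j k v)"
  using assms
proof (induction k arbitrary: v)
  case (Suc k)
  note D = comp_definedD[OF Suc.prems(1)]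
  show ?case
  proof (cases "j = Suc k")
    case False
    then have "j \<le> k" "i < k" using Suc.prems by auto
    then have "comp_defined n C i (Suc i) k u (bd C e k v)"
      using D by (auto simp: comp_defined_def i_composable_def bd_cells bdto_bd)
    then show ?thesis using Suc.IH[of "bd C e k v"] bd_cmp_less[OF Suc.prems(1), of e] \<open>j \<le> k\<close> \<open>i < k\<close> Suc.prems
      by (simp add: bdto_Suc)
  qed (simp add: bdto_ge)
qed simp

lemma bdto_whisker_right:
  assumes "comp_defined n C i k (Suc i) v u" "i < j" "j \<le> k"
  shows "bdto C e j k (cmp C k (Suc i) v u) = cmp C j (Suc i) (bdto C e j k v) u"
  using assms
proof (induction k arbitrary: v)
  case (Suc k)
  note D = comp_definedD[OF Suc.prems(1)]
  show ?case
  proof (cases "j = Suc k")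
    case False
    then have "j \<le> k" "i < k" using Suc.prems by auto
    then have "comp_defined n C i k (Suc i) (bd C e k v) u"
      using D by (auto simp: comp_defined_def i_composable_def bd_cells bdto_bd)
    then show ?thesis using Suc.IH[of "bd C e k v"] bd_cmp_greater[OF Suc.prems(1), of e] \<open>j \<le> k\<close> \<open>i < k\<close> Suc.prems
      by (simp add: bdto_Suc)
  qed (simp add: bdto_ge)
qed simp

text \<open>The distributivity axiom presupposes only that \<open>u\<close> and \<open>v\<close> are
  composable. The other composites exist because \<open>v\<close>, \<open>v'\<close> and their
  composite share all boundaries below \<open>j\<close>, and because whiskering commutes with the
  \<open>j\<close>-boundary.\<close>

lemma distrib_left_defined:
  assumes "i < j" "u \<in> cells C (Suc i)" "comp_defined n C j k l v v'" "i_composable C i (Suc i) k u v"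
  shows "comp_defined n C i (Suc i) k u v" "comp_defined n C i (Suc i) l u v'"
    "comp_defined n C i (Suc i) (max k l) u (cmp C k l v v')"
    "comp_defined n C j k l (cmp C (Suc i) k u v) (cmp C (Suc i) l u v')"
proof -
  note D = comp_definedD[OF assms(3)]
  note lower = bdto_cmp_lower[OF assms(3,1)]
  show 1: "comp_defined n C i (Suc i) k u v" "comp_defined n C i (Suc i) l u v'"
    using assms D lower by (auto simp: comp_defined_def i_composable_def)
  show "comp_defined n C i (Suc i) (max k l) u (cmp C k l v v')"
    using assms D lower cmp_cells[OF assms(3)] by (auto simp: comp_defined_def i_composable_def)
  show "comp_defined n C j k l (cmp C (Suc i) k u v) (cmp C (Suc i) l u v')"
    using cmp_cells[OF 1(1)] cmp_cells[OF 1(2)] bdto_whisker_left[OF 1(1) assms(1)]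
      bdto_whisker_left[OF 1(2) assms(1)] D assms(1)
    by (auto simp: comp_defined_def i_composable_def max_absorb2)
qed

lemma distrib_right_defined:
  assumes "i < j" "u \<in> cells C (Suc i)" "comp_defined n C j k l v v'" "i_composable C i k (Suc i) v u"
  shows "comp_defined n C i k (Suc i) v u" "comp_defined n C i l (Suc i) v' u"
    "comp_defined n C i (max k l) (Suc i) (cmp C k l v v') u"
    "comp_defined n C j k l (cmp C k (Suc i) v u) (cmp C l (Suc i) v' u)"
proof -
  note D = comp_definedD[OF assms(3)]
  note lower = bdto_cmp_lower[OF assms(3,1)]
  show 1: "comp_defined n C i k (Suc i) v u" "comp_defined n C i l (Suc i) v' u"
    using assms D lower by (auto simp: comp_defined_def i_composable_def)
  show "comp_defined n C i (max k l) (Suc i) (cmp C k l v v') u"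
    using assms D lower cmp_cells[OF assms(3)] by (auto simp: comp_defined_def i_composable_def)
  show "comp_defined n C j k l (cmp C k (Suc i) v u) (cmp C l (Suc i) v' u)"
    using cmp_cells[OF 1(1)] cmp_cells[OF 1(2)] bdto_whisker_right[OF 1(1) assms(1)]
      bdto_whisker_right[OF 1(2) assms(1)] D assms(1)
    by (auto simp: comp_defined_def i_composable_def max_absorb1)
qed

lemma idn_iter_cells: "x \<in> cells C 0 \<Longrightarrow> k \<le> n \<Longrightarrow> idn_iter C k x \<in> cells C k"
  by (induction k) (auto simp: idn_cells)

end

section \<open>Morphisms, and the category of precategories\<close>

lemmas comp_definedD = precategory.comp_definedD

text \<open>Stated for bare data, because it is applied to structures not yet known to be
  precategories and to maps not yet known to be morphisms.\<close>

lemma bdto_map: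
  assumes "\<And>i u. \<lbrakk>i < n; u \<in> cells C (Suc i)\<rbrakk> \<Longrightarrow> bd C e i u \<in> cells C i"
    and "\<And>i u. \<lbrakk>i < n; u \<in> cells C (Suc i)\<rbrakk> \<Longrightarrow> f i (bd C e i u) = bd D e i (f (Suc i) u)"
  shows "k \<le> n \<Longrightarrow> u \<in> cells C k \<Longrightarrow> i \<le> k \<Longrightarrow> f i (bdto C e i k u) = bdto D e i k (f k u)"
proof (induction k arbitrary: u)
  case (Suc k)
  then show ?case using assms by (cases "i = Suc k") (auto simp: bdto_Suc bdto_ge)
qed simp

lemma (in premor) premor_bdto:
  assumes "precategory n C"
  shows "k \<le> n \<Longrightarrow> u \<in> cells C k \<Longrightarrow> i \<le> k \<Longrightarrow> f i (bdto C e i k u) = bdto D e i k (f k u)"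
  by (rule bdto_map[OF precategory.bd_cells[OF assms] map_bd])

lemma (in premor) premor_i_composable:
  assumes C: "precategory n C" and "i_composable C i k l u v" "k \<le> n" "l \<le> n"
  shows "i_composable D i k l (f k u) (f l v)"
  using assms premor_bdto[OF C, of k u i Tgt] premor_bdto[OF C, of l v i Src]
  by (auto simp: i_composable_def map_cells)

lemma (in premor) premor_comp_defined:
  assumes C: "precategory n C" and "comp_defined n C i k l u v"
  shows "comp_defined n D i k l (f k u) (f l v)"
  using assms premor_i_composable[OF C] by (auto simp: comp_defined_def)

lemma (in premor) premor_idn_iter:
  assumes C: "precategory n C"
  shows "k \<le> n \<Longrightarrow> x \<in> cells C 0 \<Longrightarrow> f k (idn_iter C k x) = idn_iter D k (f 0 x)"
  by (induction k) (auto simp: map_idn precategory.idn_iter_cells[OF C])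

lemma premor_comp:
  assumes C: "precategory n C" and f: "premor n C D f" and g: "premor n D E g"
  shows "premor n C E (\<lambda>k u. g k (f k u))"
proof -
  interpret f: premor n C D f by (rule f)
  interpret g: premor n D E g by (rule g)
  show ?thesis
  proof
    fix i k l u v assume a: "comp_defined n C i k l u v"
    show "g (max k l) (f (max k l) (cmp C k l u v)) = cmp E k l (g k (f k u)) (g l (f l v))"
      using g.map_cmp[OF f.premor_comp_defined[OF C a]] f.map_cmp[OF a] by simp
  qed (auto simp: f.map_cells g.map_cells f.map_bd g.map_bd f.map_idn g.map_idn)
qed

lemma premor_cong:
  assumes C: "precategory n C" and eq: "\<And>k u. k \<le> n \<Longrightarrow> u \<in> cells C k \<Longrightarrow> f k u = g k u"
    and f: "premor n C D f"
  shows "premor n C D g"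
proof -
  interpret C: precategory n C by (rule C)
  interpret f: premor n C D f by (rule f)
  show ?thesis
  proof
    fix i k l u v assume a: "comp_defined n C i k l u v"
    show "g (max k l) (cmp C k l u v) = cmp D k l (g k u) (g l v)"
      using f.map_cmp[OF a] eq[of "max k l" "cmp C k l u v"] eq[of k u] eq[of l v] C.cmp_cells[OF a] C.comp_definedD[OF a]
      by simp
  next
    fix k u assume "k \<le> n" "u \<in> cells C k" then show "g k u \<in> cells D k"
      using f.map_cells[of k u] eq[of k u] by simp
  next
    fix i u e assume "i < n" "u \<in> cells C (Suc i)" then show "g i (bd C e i u) = bd D e i (g (Suc i) u)"
      using f.map_bd[of i u e] eq[of i "bd C e i u"] eq[of "Suc i" u] C.bd_cells[of i u e] by simp
  next
    fix k u assume "k < n" "u \<in> cells C k" then show "g (Suc k) (idn C k u) = idn D k (g k u)"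
      using f.map_idn[of k u] eq[of "Suc k" "idn C k u"] eq[of k u] C.idn_cells[of k u] by simp
  qed
qed

lemma prefunctor_prestrict:
  assumes "precategory n C" "premor n C D f"
  shows "prefunctor n C D (prestrict n C f)"
  using premor_cong[OF assms(1) _ assms(2)] by (simp add: prefunctor_iff_premor)

lemma premor_id: "premor n C C (\<lambda>k u. u)"
  by unfold_locales auto

lemma prefunctor_pid: "precategory n C \<Longrightarrow> prefunctor n C C (pid n C)"
  unfolding pid_def by (rule prefunctor_prestrict[OF _ premor_id])

lemma prefunctor_pcomp:
  "precategory n C \<Longrightarrow> prefunctor n C D f \<Longrightarrow> prefunctor n D E g \<Longrightarrow> prefunctor n C E (pcomp n C g f)"
  unfolding pcomp_def
  by (rule prefunctor_prestrict[OF _ premor_comp[OF _ prefunctor_premor prefunctor_premor]])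

lemma category_PCat: "category (PCat n)"
proof
  fix A B D E f g h
  assume *: "A \<in> Obj (PCat n)" "B \<in> Obj (PCat n)" "D \<in> Obj (PCat n)" "E \<in> Obj (PCat n)"
    "f \<in> Hom (PCat n) A B" "g \<in> Hom (PCat n) B D" "h \<in> Hom (PCat n) D E"
  then show "Comp (PCat n) A D E h (Comp (PCat n) A B D g f) = Comp (PCat n) A B E (Comp (PCat n) B D E h g) f"
    by (auto simp: PCat_def premor.map_cells[OF prefunctor_premor] intro!: pcomp_eqI)
next
  fix A B f assume *: "A \<in> Obj (PCat n)" "B \<in> Obj (PCat n)" "f \<in> Hom (PCat n) A B"
  then show "Comp (PCat n) A B B (Ide (PCat n) B) f = f" "Comp (PCat n) A A B f (Ide (PCat n) A) = f"
    using prefunctor_eqI[OF prefunctor_pcomp[of n A B f B "pid n B"], of B f]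
      prefunctor_eqI[OF prefunctor_pcomp[of n A A "pid n A" B f], of B f]
    by (auto simp: PCat_def premor.map_cells[OF prefunctor_premor] prefunctor_pid)
qed (auto simp: PCat_def prefunctor_pid prefunctor_pcomp)

text \<open>The axioms are equational, so they may be checked after a jointly injective family of morphisms.\<close>

lemma precategory_if_jointly_injective:
  assumes Z: "\<And>M. M \<in> I \<Longrightarrow> precategory n (Z M)"
    and bdc: "\<And>i u e. \<lbrakk>i < n; u \<in> cells P (Suc i)\<rbrakk> \<Longrightarrow> bd P e i u \<in> cells P i"
    and idc: "\<And>k u. \<lbrakk>k < n; u \<in> cells P k\<rbrakk> \<Longrightarrow> idn P k u \<in> cells P (Suc k)"
    and cmc: "\<And>i k l u v. comp_defined n P i k l u v \<Longrightarrow> cmp P k l u v \<in> cells P (max k l)"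
    and mor: "\<And>M. M \<in> I \<Longrightarrow> premor n P (Z M) (\<pi> M)"
    and inj: "\<And>k u v. \<lbrakk>k \<le> n; u \<in> cells P k; v \<in> cells P k; \<And>M. M \<in> I \<Longrightarrow> \<pi> M k u = \<pi> M k v\<rbrakk> \<Longrightarrow> u = v"
  shows "precategory n P"
proof -
  have bdto_c: "bdto P e i k u \<in> cells P i" if "k \<le> n" "u \<in> cells P k" "i \<le> k" for e i k u
    using that
  proof (induction k arbitrary: u)
    case (Suc k)
    then show ?case by (cases "i = Suc k") (auto simp: bdto_Suc bdto_ge bdc)
  qed simp
  have bdto_m: "\<pi> M i (bdto P e i k u) = bdto (Z M) e i k (\<pi> M k u)"
    if "M \<in> I" "k \<le> n" "u \<in> cells P k" "i \<le> k" for M e i k u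
    using bdto_map[OF bdc premor.map_bd[OF mor[OF that(1)]] that(2-4)] .
  have ic: "i_composable (Z M) i k l (\<pi> M k u) (\<pi> M l v)"
    if "M \<in> I" "i_composable P i k l u v" "k \<le> n" "l \<le> n" for M i k l u v
    using that bdto_m[of M k u i Tgt] bdto_m[of M l v i Src] premor.map_cells[OF mor]
    by (auto simp: i_composable_def)
  have cd: "comp_defined n (Z M) i k l (\<pi> M k u) (\<pi> M l v)"
    if "M \<in> I" "comp_defined n P i k l u v" for M i k l u v
    using that ic[of M i k l u v] by (auto simp: comp_defined_def)
  have cdD: "0 < k" "k \<le> n" "0 < l" "l \<le> n" "i < k" "i < l" "i = min k l - 1"
    "u \<in> cells P k" "v \<in> cells P l" "bdto P Tgt i k u = bdto P Src i l v"
    if "comp_defined n P i k l u v" for i k l u v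
    using that by (auto simp: comp_defined_def i_composable_def)
  \<comment> \<open>Composability is itself an equation, between two \<open>i\<close>-boundaries, so
    joint injectivity reflects it from the components. The distributivity axioms need this for the
    composites that they do not assume to exist.\<close>
  have cdI: "comp_defined n P i k l u v"
    if "0 < k" "k \<le> n" "0 < l" "l \<le> n" "i = min k l - 1" "u \<in> cells P k" "v \<in> cells P l"
      and "\<And>M. M \<in> I \<Longrightarrow> comp_defined n (Z M) i k l (\<pi> M k u) (\<pi> M l v)" for i k l u v
  proof -
    have lt: "i < k" "i < l" using that(1-5) by auto
    have "bdto P Tgt i k u = bdto P Src i l v"
    proof (rule inj[of i])
      fix M assume M: "M \<in> I"
      show "\<pi> M i (bdto P Tgt i k u) = \<pi> M i (bdto P Src i l v)"
        using comp_definedD(10)[OF Z[OF M] that(8)[OF M]] M that lt by (simp add: bdto_m)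
    qed (use that lt in \<open>auto intro!: bdto_c\<close>)
    then show ?thesis using that lt by (simp add: comp_defined_def i_composable_def)
  qed
  \<comment> \<open>As \<open>P\<close> is not yet known to be globular, this consequence of
    globularity is also imported from the components.\<close>
  have bdto_bdP: "bdto P e i m (bd P e' m v) = bdto P e i (Suc m) v"
    if "i < m" "m < n" "v \<in> cells P (Suc m)" for e e' i m v
  proof (rule inj[of i])
    fix M assume M: "M \<in> I"
    show "\<pi> M i (bdto P e i m (bd P e' m v)) = \<pi> M i (bdto P e i (Suc m) v)"
      using that M
      by (simp add: bdto_m bdc premor.map_bd[OF mor] precategory.bdto_bd[OF Z] premor.map_cells[OF mor])
  qed (use that in \<open>auto intro!: bdto_c bdc\<close>)
  have cmpm: "\<pi> M (max k l) (cmp P k l u v) = cmp (Z M) k l (\<pi> M k u) (\<pi> M l v)"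
    if "M \<in> I" "comp_defined n P i k l u v" for M i k l u v
    using premor.map_cmp[OF mor] that by blast
  note bdm = premor.map_bd[OF mor] and idm = premor.map_idn[OF mor] and cm = premor.map_cells[OF mor]
  show ?thesis
  proof
    fix i u e assume "Suc i < n" "u \<in> cells P (Suc (Suc i))"
    then show "bd P e i (bd P Src (Suc i) u) = bd P e i (bd P Tgt (Suc i) u)"
      by - (rule inj[of i], simp_all add: bdc bdm precategory.globular[OF Z] cm)
  next
    fix k u e assume "k < n" "u \<in> cells P k"
    then show "bd P e k (idn P k u) = u"
      by - (rule inj[of k], simp_all add: bdc idc bdm idm precategory.bd_idn[OF Z] cm)
  next
    fix i k l u v e assume a: "comp_defined n P i k l u v" and kl: "k < l"
    note D = cdD[OF a]
    obtain m where l: "l = Suc m" using kl by (cases l) auto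
    have a': "comp_defined n P i k m u (bd P e m v)"
      using D kl l by (auto simp: comp_defined_def i_composable_def bdc bdto_bdP)
    show "bd P e (l - 1) (cmp P k l u v) = cmp P k (l - 1) u (bd P e (l - 1) v)"
    proof (rule inj[of m])
      fix M assume M: "M \<in> I"
      show "\<pi> M m (bd P e (l - 1) (cmp P k l u v)) = \<pi> M m (cmp P k (l - 1) u (bd P e (l - 1) v))"
        using M D kl l cmc[OF a] cmpm[OF M a] cmpm[OF M a'] precategory.bd_cmp_less[OF Z[OF M] cd[OF M a] kl]
        by (simp add: bdm max_def split: if_splits)
    qed (use D l kl cmc[OF a] cmc[OF a'] in \<open>auto simp: max_def bdc split: if_splits\<close>)
  next
    fix i k l u v e assume a: "comp_defined n P i k l u v" and kl: "l < k"
    note D = cdD[OF a]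
    obtain m where l: "k = Suc m" using kl by (cases k) auto
    have a': "comp_defined n P i m l (bd P e m u) v"
      using D kl l by (auto simp: comp_defined_def i_composable_def bdc bdto_bdP)
    show "bd P e (k - 1) (cmp P k l u v) = cmp P (k - 1) l (bd P e (k - 1) u) v"
    proof (rule inj[of m])
      fix M assume M: "M \<in> I"
      show "\<pi> M m (bd P e (k - 1) (cmp P k l u v)) = \<pi> M m (cmp P (k - 1) l (bd P e (k - 1) u) v)"
        using M D kl l cmc[OF a] cmpm[OF M a] cmpm[OF M a'] precategory.bd_cmp_greater[OF Z[OF M] cd[OF M a] kl]
        by (simp add: bdm max_absorb1)
    qed (use D l kl cmc[OF a] cmc[OF a'] in \<open>auto simp: max_absorb1 bdc\<close>)
  next
    fix i k u v assume a: "comp_defined n P i k k u v"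
    note D = cdD[OF a]
    obtain m where l: "k = Suc m" using D by (cases k) auto
    show "bd P Src (k - 1) (cmp P k k u v) = bd P Src (k - 1) u"
      "bd P Tgt (k - 1) (cmp P k k u v) = bd P Tgt (k - 1) v"
      using D(1-9) l cmc[OF a] cmpm[OF _ a] precategory.src_cmp_eq[OF Z cd[OF _ a]] precategory.tgt_cmp_eq[OF Z cd[OF _ a]]
      by - (rule inj[of m], auto simp: bdc bdm)+
  next
    fix i k l u v assume u: "u \<in> cells P k" and a: "comp_defined n P i (Suc k) l (idn P k u) v" and kl: "Suc k \<le> l"
    note D = cdD[OF a]
    show "cmp P (Suc k) l (idn P k u) v = v"
    proof (rule inj[of l])
      fix M assume M: "M \<in> I"
      show "\<pi> M l (cmp P (Suc k) l (idn P k u) v) = \<pi> M l v"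
        using cmpm[OF M a] cd[OF M a] precategory.idn_cmp_le[OF Z[OF M], of "\<pi> M k u" k i l "\<pi> M l v"] D u kl M
        by (simp add: idm cm max_absorb2)
    qed (use D cmc[OF a] kl in \<open>auto simp: max_absorb2\<close>)
  next
    fix i k l u v assume u: "u \<in> cells P k" and a: "comp_defined n P i l (Suc k) v (idn P k u)" and kl: "Suc k \<le> l"
    note D = cdD[OF a]
    show "cmp P l (Suc k) v (idn P k u) = v"
    proof (rule inj[of l])
      fix M assume M: "M \<in> I"
      show "\<pi> M l (cmp P l (Suc k) v (idn P k u)) = \<pi> M l v"
        using cmpm[OF M a] cd[OF M a] precategory.cmp_idn_le[OF Z[OF M], of "\<pi> M k u" k i l "\<pi> M l v"] D u kl M
        by (simp add: idm cm max_absorb1)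
    qed (use D cmc[OF a] kl in \<open>auto simp: max_absorb1\<close>)
  next
    fix i k l u v assume u: "u \<in> cells P k" and a: "comp_defined n P i (Suc k) l (idn P k u) v" and kl: "l < Suc k"
    note D = cdD[OF a]
    have bi: "bd P e k (idn P k u) = u" for e
      using u D by - (rule inj[of k], simp_all add: bdc idc bdm idm precategory.bd_idn[OF Z] cm)
    have a': "comp_defined n P i k l u v"
      using D u kl bi by (auto simp: comp_defined_def i_composable_def bdto_Suc)
    show "cmp P (Suc k) l (idn P k u) v = idn P k (cmp P k l u v)"
    proof (rule inj[of "Suc k"])
      fix M assume M: "M \<in> I"
      show "\<pi> M (Suc k) (cmp P (Suc k) l (idn P k u) v) = \<pi> M (Suc k) (idn P k (cmp P k l u v))"
        using cmpm[OF M a] cd[OF M a] cmpm[OF M a'] cmc[OF a']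
          precategory.idn_cmp_greater[OF Z[OF M], of "\<pi> M k u" k i l "\<pi> M l v"] D u kl M
        by (simp add: idm cm max_absorb1)
    qed (use D cmc[OF a] cmc[OF a'] kl idc in \<open>auto simp: max_absorb1\<close>)
  next
    fix i k l u v assume u: "u \<in> cells P k" and a: "comp_defined n P i l (Suc k) v (idn P k u)" and kl: "l < Suc k"
    note D = cdD[OF a]
    have bi: "bd P e k (idn P k u) = u" for e
      using u D by - (rule inj[of k], simp_all add: bdc idc bdm idm precategory.bd_idn[OF Z] cm)
    have a': "comp_defined n P i l k v u"
      using D u kl bi by (auto simp: comp_defined_def i_composable_def bdto_Suc)
    show "cmp P l (Suc k) v (idn P k u) = idn P k (cmp P l k v u)"
    proof (rule inj[of "Suc k"])
      fix M assume M: "M \<in> I"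
      show "\<pi> M (Suc k) (cmp P l (Suc k) v (idn P k u)) = \<pi> M (Suc k) (idn P k (cmp P l k v u))"
        using cmpm[OF M a] cd[OF M a] cmpm[OF M a'] cmc[OF a']
          precategory.cmp_idn_greater[OF Z[OF M], of "\<pi> M k u" k i l "\<pi> M l v"] D u kl M
        by (simp add: idm cm max_absorb2)
    qed (use D cmc[OF a] cmc[OF a'] kl idc in \<open>auto simp: max_absorb2\<close>)
  next
    fix i k l m u v w
    assume a: "comp_defined n P i k l u v" "comp_defined n P i (max k l) m (cmp P k l u v) w"
      "comp_defined n P i l m v w" "comp_defined n P i k (max l m) u (cmp P l m v w)"
    show "cmp P (max k l) m (cmp P k l u v) w = cmp P k (max l m) u (cmp P l m v w)"
    proof (rule inj[of "max (max k l) m"])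
      fix M assume M: "M \<in> I"
      show "\<pi> M (max (max k l) m) (cmp P (max k l) m (cmp P k l u v) w)
        = \<pi> M (max (max k l) m) (cmp P k (max l m) u (cmp P l m v w))"
        using precategory.cmp_assoc[OF Z[OF M] cd[OF M a(1)] cd[OF M a(2), unfolded cmpm[OF M a(1)]]
            cd[OF M a(3)] cd[OF M a(4), unfolded cmpm[OF M a(3)]]]
        unfolding cmpm[OF M a(2), unfolded max.assoc] cmpm[OF M a(1)] max.assoc cmpm[OF M a(4)] cmpm[OF M a(3)] .
    qed (use cmc[OF a(2)] cmc[OF a(4)] cdD(2,4)[OF a(2)] in \<open>auto simp: max.assoc\<close>)
  next
    fix i j k l u v v'
    assume a: "i < j" "u \<in> cells P (Suc i)" "comp_defined n P j k l v v'"
      and b: "i_composable P i (Suc i) k u v"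
    note D = cdD[OF a(3)]
    have le: "Suc i \<le> n" "Suc i \<le> k" "Suc i \<le> l" using D(2,5,6) a(1) by auto
    have lt: "i < k" "i < l" "i < max k l" using le by auto
    have mn: "i = min (Suc i) k - 1" "i = min (Suc i) l - 1" "i = min (Suc i) (max k l) - 1"
      "i = min k (Suc i) - 1" "i = min l (Suc i) - 1" "i = min (max k l) (Suc i) - 1" using le by auto
    have mx: "max (Suc i) k = k" "max (Suc i) l = l" "max (Suc i) (max k l) = max k l"
      "max k (Suc i) = k" "max l (Suc i) = l" "max (max k l) (Suc i) = max k l" "max k l \<le> n" "0 < max k l" using le D(2,4) by auto
    have Zd: "comp_defined n (Z M) i (Suc i) k (\<pi> M (Suc i) u) (\<pi> M k v)"
      "comp_defined n (Z M) i (Suc i) l (\<pi> M (Suc i) u) (\<pi> M l v')"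
      "comp_defined n (Z M) i (Suc i) (max k l) (\<pi> M (Suc i) u) (cmp (Z M) k l (\<pi> M k v) (\<pi> M l v'))"
      "comp_defined n (Z M) j k l (cmp (Z M) (Suc i) k (\<pi> M (Suc i) u) (\<pi> M k v)) (cmp (Z M) (Suc i) l (\<pi> M (Suc i) u) (\<pi> M l v'))" if M: "M \<in> I" for M
      using precategory.distrib_left_defined[OF Z[OF M] a(1) cm[OF M le(1) a(2)] cd[OF M a(3)] ic[OF M b]] D le
      by blast+
    have 1: "comp_defined n P i (Suc i) k u v" "comp_defined n P i (Suc i) l u v'"
      by (rule cdI[OF zero_less_Suc le(1) D(1,2) mn(1) a(2) D(8) Zd(1)], assumption,
          rule cdI[OF zero_less_Suc le(1) D(3,4) mn(2) a(2) D(9) Zd(2)], assumption)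
    have 2: "comp_defined n P i (Suc i) (max k l) u (cmp P k l v v')"
      by (rule cdI[OF zero_less_Suc le(1) mx(8) mx(7) mn(3) a(2) cmc[OF a(3)]]) (simp add: Zd(3) cmpm[OF _ a(3)])
    have 3: "comp_defined n P j k l (cmp P (Suc i) k u v) (cmp P (Suc i) l u v')"
      by (rule cdI[OF D(1-4,7) cmc[OF 1(1), unfolded mx] cmc[OF 1(2), unfolded mx]])
        (simp add: Zd(4) cmpm[OF _ 1(1), unfolded mx] cmpm[OF _ 1(2), unfolded mx])
    show "cmp P (Suc i) (max k l) u (cmp P k l v v')
         = cmp P k l (cmp P (Suc i) k u v) (cmp P (Suc i) l u v')"
    proof (rule inj[of "max k l"])
      fix M assume M: "M \<in> I"
      show "\<pi> M (max k l) (cmp P (Suc i) (max k l) u (cmp P k l v v'))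
        = \<pi> M (max k l) (cmp P k l (cmp P (Suc i) k u v) (cmp P (Suc i) l u v'))"
        using precategory.cmp_distrib_left[OF Z[OF M] a(1) cm[OF M le(1) a(2)] cd[OF M a(3)] ic[OF M b le(1) D(2)]]
        unfolding cmpm[OF M 2, unfolded mx] cmpm[OF M 3] cmpm[OF M a(3)]
          cmpm[OF M 1(1), unfolded mx] cmpm[OF M 1(2), unfolded mx] .
    qed (use cmc[OF 2] cmc[OF 3] mx in simp_all)
  next
    fix i j k l u v v'
    assume a: "i < j" "u \<in> cells P (Suc i)" "comp_defined n P j k l v v'"
      and b: "i_composable P i k (Suc i) v u"
    note D = cdD[OF a(3)]
    have le: "Suc i \<le> n" "Suc i \<le> k" "Suc i \<le> l" using D(2,5,6) a(1) by auto
    have lt: "i < k" "i < l" "i < max k l" using le by auto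
    have mn: "i = min (Suc i) k - 1" "i = min (Suc i) l - 1" "i = min (Suc i) (max k l) - 1"
      "i = min k (Suc i) - 1" "i = min l (Suc i) - 1" "i = min (max k l) (Suc i) - 1" using le by auto
    have mx: "max (Suc i) k = k" "max (Suc i) l = l" "max (Suc i) (max k l) = max k l"
      "max k (Suc i) = k" "max l (Suc i) = l" "max (max k l) (Suc i) = max k l" "max k l \<le> n" "0 < max k l" using le D(2,4) by auto
    have Zd: "comp_defined n (Z M) i k (Suc i) (\<pi> M k v) (\<pi> M (Suc i) u)"
      "comp_defined n (Z M) i l (Suc i) (\<pi> M l v') (\<pi> M (Suc i) u)"
      "comp_defined n (Z M) i (max k l) (Suc i) (cmp (Z M) k l (\<pi> M k v) (\<pi> M l v')) (\<pi> M (Suc i) u)"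
      "comp_defined n (Z M) j k l (cmp (Z M) k (Suc i) (\<pi> M k v) (\<pi> M (Suc i) u)) (cmp (Z M) l (Suc i) (\<pi> M l v') (\<pi> M (Suc i) u))" if M: "M \<in> I" for M
      using precategory.distrib_right_defined[OF Z[OF M] a(1) cm[OF M le(1) a(2)] cd[OF M a(3)] ic[OF M b]] D le
      by blast+
    have 1: "comp_defined n P i k (Suc i) v u" "comp_defined n P i l (Suc i) v' u"
      by (rule cdI[OF D(1,2) zero_less_Suc le(1) mn(4) D(8) a(2) Zd(1)], assumption,
          rule cdI[OF D(3,4) zero_less_Suc le(1) mn(5) D(9) a(2) Zd(2)], assumption)
    have 2: "comp_defined n P i (max k l) (Suc i) (cmp P k l v v') u"
      by (rule cdI[OF mx(8) mx(7) zero_less_Suc le(1) mn(6) cmc[OF a(3)] a(2)]) (simp add: Zd(3) cmpm[OF _ a(3)])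
    have 3: "comp_defined n P j k l (cmp P k (Suc i) v u) (cmp P l (Suc i) v' u)"
      by (rule cdI[OF D(1-4,7) cmc[OF 1(1), unfolded mx] cmc[OF 1(2), unfolded mx]])
        (simp add: Zd(4) cmpm[OF _ 1(1), unfolded mx] cmpm[OF _ 1(2), unfolded mx])
    show "cmp P (max k l) (Suc i) (cmp P k l v v') u
         = cmp P k l (cmp P k (Suc i) v u) (cmp P l (Suc i) v' u)"
    proof (rule inj[of "max k l"])
      fix M assume M: "M \<in> I"
      show "\<pi> M (max k l) (cmp P (max k l) (Suc i) (cmp P k l v v') u)
        = \<pi> M (max k l) (cmp P k l (cmp P k (Suc i) v u) (cmp P l (Suc i) v' u))"
        using precategory.cmp_distrib_right[OF Z[OF M] a(1) cm[OF M le(1) a(2)] cd[OF M a(3)] ic[OF M b D(2) le(1)]]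
        unfolding cmpm[OF M 2, unfolded mx] cmpm[OF M 3] cmpm[OF M a(3)]
          cmpm[OF M 1(1), unfolded mx] cmpm[OF M 1(2), unfolded mx] .
    qed (use cmc[OF 2] cmc[OF 3] mx in simp_all)
  qed (use bdc idc cmc in auto)
qed

text \<open>The equations of a morphism are tested in the components, like the axioms. This serves
  to map into a generated precategory and, with a one-element family, to restrict the codomain of a
  morphism to a subprecategory.\<close>

lemma premor_if_jointly_injective:
  assumes C: "precategory n C" and P: "precategory n P"
    and cells: "\<And>k u. \<lbrakk>k \<le> n; u \<in> cells C k\<rbrakk> \<Longrightarrow> f k u \<in> cells P k"
    and mor: "\<And>M. M \<in> I \<Longrightarrow> premor n P (Z M) (\<pi> M)"
    and inj: "\<And>k u v. \<lbrakk>k \<le> n; u \<in> cells P k; v \<in> cells P k; \<And>M. M \<in> I \<Longrightarrow> \<pi> M k u = \<pi> M k v\<rbrakk> \<Longrightarrow> u = v"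
    and f: "\<And>M. M \<in> I \<Longrightarrow> premor n C (Z M) (\<lambda>k u. \<pi> M k (f k u))"
  shows "premor n C P f"
proof -
  interpret C: precategory n C by (rule C)
  interpret P: precategory n P by (rule P)
  \<comment> \<open>Boundaries come first: they make the images of composable cells composable,
    which is required before anything can be said about their composite in \<open>P\<close>.\<close>
  have fbd: "f i (bd C e i u) = bd P e i (f (Suc i) u)" if "i < n" "u \<in> cells C (Suc i)" for e i u
  proof (rule inj[of i])
    fix M assume M: "M \<in> I"
    show "\<pi> M i (f i (bd C e i u)) = \<pi> M i (bd P e i (f (Suc i) u))"
      using premor.map_bd[OF f[OF M] that] premor.map_bd[OF mor[OF M]] that cells by simp
  qed (use that in \<open>auto intro!: cells C.bd_cells P.bd_cells\<close>)
  show ?thesis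
  proof
    fix k u assume "k < n" "u \<in> cells C k"
    show "f (Suc k) (idn C k u) = idn P k (f k u)"
    proof (rule inj[of "Suc k"])
      fix M assume M: "M \<in> I"
      show "\<pi> M (Suc k) (f (Suc k) (idn C k u)) = \<pi> M (Suc k) (idn P k (f k u))"
        using premor.map_idn[OF f[OF M] \<open>k < n\<close> \<open>u \<in> cells C k\<close>] premor.map_idn[OF mor[OF M]] \<open>k < n\<close> \<open>u \<in> cells C k\<close> cells by simp
    qed (use \<open>k < n\<close> \<open>u \<in> cells C k\<close> in \<open>auto intro!: cells C.idn_cells P.idn_cells\<close>)
  next
    fix i k l u v assume a: "comp_defined n C i k l u v"
    note D = C.comp_definedD[OF a]
    have fb: "f i (bdto C e i k u) = bdto P e i k (f k u)" if "k \<le> n" "u \<in> cells C k" "i \<le> k" for e i k u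
      using that by (intro bdto_map C.bd_cells fbd)
    have b: "comp_defined n P i k l (f k u) (f l v)"
      using D fb[of k u i Tgt] fb[of l v i Src] cells by (auto simp: comp_defined_def i_composable_def)
    show "f (max k l) (cmp C k l u v) = cmp P k l (f k u) (f l v)"
    proof (rule inj[of "max k l"])
      fix M assume M: "M \<in> I"
      show "\<pi> M (max k l) (f (max k l) (cmp C k l u v)) = \<pi> M (max k l) (cmp P k l (f k u) (f l v))"
        using premor.map_cmp[OF f[OF M] a] premor.map_cmp[OF mor[OF M] b] by simp
    qed (use D cells C.cmp_cells[OF a] P.cmp_cells[OF b] in auto)
  qed (use fbd cells in auto)
qed

section \<open>Pairs, products and skeleta\<close>

locale coding =
  fixes T :: "'a itself"
  assumes infinite_UNIV: "infinite (UNIV :: 'a set)"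
begin

text \<open>An infinite set is equipollent to its square, so the choice in \<open>pcode\<close> does
  pick an injection.\<close>

lemma inj_pcode: "inj (pcode :: 'a \<times> 'a \<Rightarrow> 'a)"
proof -
  include cardinal_syntax
  have "|(UNIV :: 'a set) \<times> (UNIV :: 'a set)| =o |UNIV :: 'a set|"
    using card_of_Times_same_infinite infinite_UNIV by blast
  then have "|(UNIV :: 'a set) \<times> (UNIV :: 'a set)| \<le>o |UNIV :: 'a set|"
    by (rule ordIso_imp_ordLeq)
  then have "\<exists>c :: 'a \<times> 'a \<Rightarrow> 'a. inj c"
    using card_of_ordLeq[of "(UNIV :: 'a set) \<times> (UNIV :: 'a set)" "UNIV :: 'a set"] by auto
  then show ?thesis unfolding pcode_def by (rule someI_ex)
qed

lemma pcode_eq_iff [simp]: "pcode p = pcode q \<longleftrightarrow> p = q" for p q :: "'a \<times> 'a"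
  using inj_pcode by (simp add: inj_eq)

lemma pfst_pcode [simp]: "pfst (pcode (x, y)) = x" for x y :: 'a
  by (simp add: pfst_def inj_pcode)

lemma psnd_pcode [simp]: "psnd (pcode (x, y)) = y" for x y :: 'a
  by (simp add: psnd_def inj_pcode)

lemma cells_pprod: "cells (pprod C D) k = {pcode (u, v) | u v. u \<in> cells C k \<and> v \<in> cells D k}" for C D :: "'a precat"
  by (auto simp: pprod_def)

lemma mem_cells_pprod [simp]: "pcode (u, v) \<in> cells (pprod C D) k \<longleftrightarrow> u \<in> cells C k \<and> v \<in> cells D k" for C D :: "'a precat"
  by (auto simp: cells_pprod)

lemma pprod_ops [simp]:
  fixes C D :: "'a precat"
  shows "bd (pprod C D) e i (pcode (u, v)) = pcode (bd C e i u, bd D e i v)"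
    "idn (pprod C D) k (pcode (u, v)) = pcode (idn C k u, idn D k v)"
    "cmp (pprod C D) k l (pcode (u, v)) (pcode (u', v')) = pcode (cmp C k l u u', cmp D k l v v')"
  by (simp_all add: pprod_def)

lemma bdto_pprod [simp]: "bdto (pprod C D) e i k (pcode (u, v)) = pcode (bdto C e i k u, bdto D e i k v)" for C D :: "'a precat"
  by (induction k arbitrary: u v) (auto simp: bdto.simps(2))

lemma comp_defined_pprod:
  "comp_defined n (pprod C D) i k l (pcode (u, v)) (pcode (u', v'))
   \<longleftrightarrow> comp_defined n C i k l u u' \<and> comp_defined n D i k l v v'" for C D :: "'a precat"
  by (auto simp: comp_defined_def i_composable_def)

lemma comp_defined_pprodE:
  fixes C D :: "'a precat"
  assumes "comp_defined n (pprod C D) i k l p q"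
  obtains u v u' v' where "p = pcode (u, v)" "q = pcode (u', v')"
    "comp_defined n C i k l u u'" "comp_defined n D i k l v v'"
proof -
  from assms obtain u v u' v' where "p = pcode (u, v)" "q = pcode (u', v')"
    by (auto simp: comp_defined_def i_composable_def cells_pprod)
  with assms show thesis using that by (auto simp: comp_defined_pprod)
qed

lemma premor_pfst: "premor n (pprod C D) C (\<lambda>k. pfst)" for C D :: "'a precat"
  by unfold_locales (auto simp: cells_pprod elim!: comp_defined_pprodE)

lemma premor_psnd: "premor n (pprod C D) D (\<lambda>k. psnd)" for C D :: "'a precat"
  by unfold_locales (auto simp: cells_pprod elim!: comp_defined_pprodE)

lemma precategory_pprod:
  fixes C D :: "'a precat"
  assumes C: "precategory n C" and D: "precategory n D"
  shows "precategory n (pprod C D)"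
proof (rule precategory_if_jointly_injective[where I = UNIV and Z = "\<lambda>b. if b then C else D"
        and \<pi> = "\<lambda>b k. if b then pfst else psnd"])
  fix b show "premor n (pprod C D) (if b then C else D) (\<lambda>k. if b then pfst else psnd)"
    by (cases b) (simp_all add: premor_pfst premor_psnd)
next
  fix k u v assume "u \<in> cells (pprod C D) k" "v \<in> cells (pprod C D) k"
    and eq: "\<And>b. b \<in> UNIV \<Longrightarrow> (if b then pfst else psnd) u = (if b then pfst else psnd) v"
  then show "u = v" using eq[of True] eq[of False] by (auto simp: cells_pprod)
next
  fix i k l u v assume "comp_defined n (pprod C D) i k l u v"
  then show "cmp (pprod C D) k l u v \<in> cells (pprod C D) (max k l)"
    using precategory.cmp_cells[OF C] precategory.cmp_cells[OF D] by (auto elim!: comp_defined_pprodE)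
qed (use assms in \<open>auto simp: cells_pprod precategory.bd_cells precategory.idn_cells\<close>)

end

section \<open>The 0-skeleton, the terminal precategory and subprecategories\<close>

lemma pskel_simps [simp]: "cells (pskel C) k = cells C 0" "bd (pskel C) e i x = x"
  "idn (pskel C) k x = x" "cmp (pskel C) k l x y = x"
  by (auto simp: pskel_def)

lemma bdto_pskel [simp]: "bdto (pskel C) e i k x = x"
  by (induction k) (auto simp: bdto.simps(2))

lemma comp_defined_pskel: "comp_defined n (pskel C) i k l x y \<longleftrightarrow>
  0 < k \<and> k \<le> n \<and> 0 < l \<and> l \<le> n \<and> i = min k l - 1 \<and> x \<in> cells C 0 \<and> y = x"
  by (auto simp: comp_defined_def i_composable_def)

lemma precategory_pskel: "precategory n (pskel C)"
  by unfold_locales (auto simp: comp_defined_pskel i_composable_def)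

lemma precategory_pterminal: "precategory n pterminal"
  by unfold_locales (auto simp: pterminal_def comp_defined_def i_composable_def)

text \<open>In a composite of iterated identities of one 0-cell, the factor of smaller dimension is
  itself an identity of positive dimension, so a unit law cancels it.\<close>

lemma premor_pskel_incl:
  assumes "precategory n C" shows "premor n (pskel C) C (idn_iter C)"
proof -
  interpret C: precategory n C by (rule assms)
  show ?thesis
  proof
    fix i k l u v assume "comp_defined n (pskel C) i k l u v"
    then have *: "0 < k" "k \<le> n" "0 < l" "l \<le> n" "u \<in> cells C 0" "v = u" and i: "i = min k l - 1"
      by (auto simp: comp_defined_pskel)
    have bd: "bdto C e i k (idn_iter C k u) = idn_iter C i u" if "k \<le> n" "i \<le> k" for e i k
      using that
    proof (induction k)
      case (Suc k)
      then show ?case using * by (cases "i = Suc k") (auto simp: bdto_ge C.bdto_idn C.idn_iter_cells)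
    qed simp
    have cd: "comp_defined n C (min k l - 1) k l (idn_iter C k u) (idn_iter C l u)"
      if "0 < k" "k \<le> n" "0 < l" "l \<le> n" for k l
      using that * by (auto simp: comp_defined_def i_composable_def bd C.idn_iter_cells min_def)
    obtain k' l' where kl: "k = Suc k'" "l = Suc l'" using * by (metis not0_implies_Suc less_numeral_extra(3))
    have "cmp C k l (idn_iter C k u) (idn_iter C l u) = idn_iter C (max k l) u"
    proof (cases "k \<le> l")
      case True
      then show ?thesis using C.idn_cmp_le[of "idn_iter C k' u" k' _ l "idn_iter C l u"] cd[of k l] * kl
        by (simp add: C.idn_iter_cells max_absorb2)
    next
      case False
      then show ?thesis using C.cmp_idn_le[of "idn_iter C l' u" l' _ k "idn_iter C k u"] cd[of k l] * kl
        by (simp add: C.idn_iter_cells max_absorb1)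
    qed
    then show "idn_iter C (max k l) (cmp (pskel C) k l u v) = cmp C k l (idn_iter C k u) (idn_iter C l v)"
      using * by simp
  qed (auto simp: C.idn_iter_cells C.bd_idn)
qed

text \<open>Closure under the operations suffices, since the inclusion alone is a jointly injective
  family. In this way an invariant of cells becomes a precategory, to which a universal property can
  be applied.\<close>

lemma precategory_subprecategory:
  assumes C: "precategory n C"
    and sub: "\<And>k u. k \<le> n \<Longrightarrow> u \<in> S k \<Longrightarrow> u \<in> cells C k"
    and bdc: "\<And>i u e. \<lbrakk>i < n; u \<in> S (Suc i)\<rbrakk> \<Longrightarrow> bd C e i u \<in> S i"
    and idc: "\<And>k u. \<lbrakk>k < n; u \<in> S k\<rbrakk> \<Longrightarrow> idn C k u \<in> S (Suc k)"
    and cmc: "\<And>i k l u v. \<lbrakk>comp_defined n C i k l u v; u \<in> S k; v \<in> S l\<rbrakk> \<Longrightarrow> cmp C k l u v \<in> S (max k l)"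
  shows "precategory n (C\<lparr>cells := S\<rparr>)" "premor n (C\<lparr>cells := S\<rparr>) C (\<lambda>k u. u)"
proof -
  have bdto: "bdto (C\<lparr>cells := S\<rparr>) e i k u = bdto C e i k u" for e i k u
    by (induction k arbitrary: u) (auto simp: bdto.simps(2))
  have cd: "comp_defined n C i k l u v" "u \<in> S k" "v \<in> S l"
    if "comp_defined n (C\<lparr>cells := S\<rparr>) i k l u v" for i k l u v
    using that sub by (auto simp: comp_defined_def i_composable_def bdto)
  show m: "premor n (C\<lparr>cells := S\<rparr>) C (\<lambda>k u. u)"
    by unfold_locales (auto simp: sub)
  show "precategory n (C\<lparr>cells := S\<rparr>)"
  proof (rule precategory_if_jointly_injective[where I = "{()}" and Z = "\<lambda>_. C" and \<pi> = "\<lambda>_ k u. u"])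
    fix i k l u v assume "comp_defined n (C\<lparr>cells := S\<rparr>) i k l u v"
    then show "cmp (C\<lparr>cells := S\<rparr>) k l u v \<in> cells (C\<lparr>cells := S\<rparr>) (max k l)"
      using cmc[OF cd] by simp
  qed (use C m bdc idc in auto)
qed

section \<open>Generated precategories\<close>

text \<open>Formal expressions in the operations of a precategory, over two sorts of generators told
  apart by the Boolean (the two legs of a pushout). No typing is imposed: terms only bound the
  number of generated cells.\<close>

datatype 'a tm = Gen bool nat 'a | Bd sign nat "'a tm" | Idn nat "'a tm" | Cmp nat nat "'a tm" "'a tm"

primrec tm_code :: "(nat \<Rightarrow> 'a) \<Rightarrow> 'a tm \<Rightarrow> 'a" where
  "tm_code \<nu> (Gen b k x) = pcode (\<nu> 0, pcode (\<nu> (of_bool b), pcode (\<nu> k, x)))"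
| "tm_code \<nu> (Bd e i t) = pcode (\<nu> 1, pcode (\<nu> (of_bool (e = Src)), pcode (\<nu> i, tm_code \<nu> t)))"
| "tm_code \<nu> (Idn k t) = pcode (\<nu> 2, pcode (\<nu> k, tm_code \<nu> t))"
| "tm_code \<nu> (Cmp k l s t) = pcode (\<nu> 3, pcode (\<nu> k, pcode (\<nu> l, pcode (tm_code \<nu> s, tm_code \<nu> t))))"

text \<open>An infinite type contains the natural numbers and codes for its pairs, so tagged nested
  pairs embed its own term algebra. The smallness of the pushout rests on this.\<close>

lemma (in coding) ex_inj_tm: "\<exists>c :: 'a tm \<Rightarrow> 'a. inj c"
proof -
  obtain \<nu> :: "nat \<Rightarrow> 'a" where \<nu>: "inj \<nu>"
    using infinite_countable_subset[OF infinite_UNIV] by blast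
  have "s = t" if "tm_code \<nu> s = tm_code \<nu> t" for s t
    using that
  proof (induction s arbitrary: t)
    case (Gen b k x)
    then show ?case using \<nu> by (cases t; cases b) (auto simp: inj_eq split: if_splits simp del: One_nat_def)
  next
    case (Bd e i s)
    then show ?case using \<nu> by (cases t; cases e) (auto simp: inj_eq of_bool_def split: if_splits, metis sign.exhaust)
  next
    case (Idn k s)
    then show ?case using \<nu> by (cases t) (auto simp: inj_eq)
  next
    case (Cmp k l s1 s2)
    then show ?case using \<nu> by (cases t) (auto simp: inj_eq)
  qed
  then show ?thesis by (meson injI)
qed

text \<open>
  The precategory generated, inside the product of a (possibly large) family of precategories, by
  the generators \<open>g b k x\<close>. Its cells are families indexed by \<open>I\<close>; there are at most as many of
  them as terms, hence they can be coded as elements of \<open>'a\<close>.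
\<close>

locale generated = coding T for T :: "'a itself" +
  fixes n :: nat and I :: "'i set" and Z :: "'i \<Rightarrow> 'a precat"
    and A :: "bool \<Rightarrow> nat \<Rightarrow> 'a set" and g :: "bool \<Rightarrow> nat \<Rightarrow> 'a \<Rightarrow> 'i \<Rightarrow> 'a"
  assumes Z: "M \<in> I \<Longrightarrow> precategory n (Z M)"
    and g: "\<lbrakk>M \<in> I; k \<le> n; x \<in> A b k\<rbrakk> \<Longrightarrow> g b k x M \<in> cells (Z M) k"
begin

text \<open>Values outside \<open>I\<close> are fixed, so that two families of cells are equal as
  soon as they agree in every component.\<close>

definition ext :: "('i \<Rightarrow> 'a) \<Rightarrow> 'i \<Rightarrow> 'a" where
  "ext \<phi> = (\<lambda>M. if M \<in> I then \<phi> M else undefined)"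

text \<open>Closure of the generators under the componentwise operations. A composite is formed only
  if it is defined in all components at once.\<close>

inductive gen :: "nat \<Rightarrow> ('i \<Rightarrow> 'a) \<Rightarrow> bool" where
  gen_Gen: "k \<le> n \<Longrightarrow> x \<in> A b k \<Longrightarrow> gen k (ext (g b k x))"
| gen_Bd: "i < n \<Longrightarrow> gen (Suc i) \<phi> \<Longrightarrow> gen i (ext (\<lambda>M. bd (Z M) e i (\<phi> M)))"
| gen_Idn: "k < n \<Longrightarrow> gen k \<phi> \<Longrightarrow> gen (Suc k) (ext (\<lambda>M. idn (Z M) k (\<phi> M)))"
| gen_Cmp: "\<lbrakk>gen k \<phi>; gen l \<psi>; 0 < k; k \<le> n; 0 < l; l \<le> n;
    \<And>M. M \<in> I \<Longrightarrow> comp_defined n (Z M) (min k l - 1) k l (\<phi> M) (\<psi> M)\<rbrakk>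
   \<Longrightarrow> gen (max k l) (ext (\<lambda>M. cmp (Z M) k l (\<phi> M) (\<psi> M)))"

primrec ev :: "'a tm \<Rightarrow> 'i \<Rightarrow> 'a" where
  "ev (Gen b k x) = ext (g b k x)"
| "ev (Bd e i t) = ext (\<lambda>M. bd (Z M) e i (ev t M))"
| "ev (Idn k t) = ext (\<lambda>M. idn (Z M) k (ev t M))"
| "ev (Cmp k l s t) = ext (\<lambda>M. cmp (Z M) k l (ev s M) (ev t M))"

lemma ext_eq_iff: "ext \<phi> = ext \<psi> \<longleftrightarrow> (\<forall>M \<in> I. \<phi> M = \<psi> M)"
  by (auto simp: ext_def fun_eq_iff)

lemma ext_apply [simp]: "M \<in> I \<Longrightarrow> ext \<phi> M = \<phi> M"
  by (simp add: ext_def)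

lemma gen_ext: "gen k \<phi> \<Longrightarrow> ext \<phi> = \<phi>"
  by (induction rule: gen.induct) (auto simp: ext_def fun_eq_iff)

lemma gen_cells: "gen k \<phi> \<Longrightarrow> M \<in> I \<Longrightarrow> \<phi> M \<in> cells (Z M) k"
proof (induction rule: gen.induct)
  case (gen_Cmp k \<phi> l \<psi>)
  then show ?case using precategory.cmp_cells[OF Z gen_Cmp.hyps(7)] by simp
qed (auto simp: g precategory.bd_cells[OF Z] precategory.idn_cells[OF Z])

lemma gen_ev: "gen k \<phi> \<Longrightarrow> \<phi> \<in> range ev"
proof (induction rule: gen.induct)
  case (gen_Gen k x b)
  show ?case by (rule range_eqI[of _ _ "Gen b k x"]) simp
next
  case (gen_Bd i \<phi> e)
  then obtain t where "\<phi> = ev t" by auto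
  then show ?case by (intro range_eqI[of _ _ "Bd e i t"]) simp
next
  case (gen_Idn k \<phi>)
  then obtain t where "\<phi> = ev t" by auto
  then show ?case by (intro range_eqI[of _ _ "Idn k t"]) simp
next
  case (gen_Cmp k \<phi> l \<psi>)
  then obtain s t where "\<phi> = ev s" "\<psi> = ev t" by auto
  then show ?case by (intro range_eqI[of _ _ "Cmp k l s t"]) simp
qed

definition code :: "('i \<Rightarrow> 'a) \<Rightarrow> 'a" where
  "code = (SOME c. inj_on c (range ev))"

text \<open>Families indexed by \<open>I\<close> may outnumber the elements of \<open>'a\<close>;
  only those denoted by terms are coded, by choosing a term for each and coding the term.\<close>

lemma inj_code: "inj_on code (range ev)"
proof -
  obtain c :: "'a tm \<Rightarrow> 'a" where "inj c" using ex_inj_tm by blast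
  then have "inj_on (c \<circ> inv ev) (range ev)"
    by (meson comp_inj_on inj_on_inv_into inj_on_subset subset_UNIV subset_refl)
  then show ?thesis unfolding code_def by (rule someI[of "\<lambda>c. inj_on c (range ev)"])
qed

definition decode :: "'a \<Rightarrow> 'i \<Rightarrow> 'a" where
  "decode = inv_into (range ev) code"

lemma decode_code [simp]: "gen k \<phi> \<Longrightarrow> decode (code \<phi>) = \<phi>"
  unfolding decode_def using gen_ev inj_code by (simp add: inv_into_f_f)

definition genprecat :: "'a precat" where
  "genprecat = \<lparr>cells = (\<lambda>k. code ` {\<phi>. gen k \<phi>}),
     bd = (\<lambda>e i c. code (ext (\<lambda>M. bd (Z M) e i (decode c M)))),
     idn = (\<lambda>k c. code (ext (\<lambda>M. idn (Z M) k (decode c M)))),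
     cmp = (\<lambda>k l c d. code (ext (\<lambda>M. cmp (Z M) k l (decode c M) (decode d M))))\<rparr>"

lemma genprecat_cells: "cells genprecat k = {code \<phi> | \<phi>. gen k \<phi>}"
  by (auto simp: genprecat_def)

lemma genprecat_cellsI [simp]: "gen k \<phi> \<Longrightarrow> code \<phi> \<in> cells genprecat k"
  by (auto simp: genprecat_cells)

lemma genprecat_ops:
  "gen k \<phi> \<Longrightarrow> bd genprecat e i (code \<phi>) = code (ext (\<lambda>M. bd (Z M) e i (\<phi> M)))"
  "gen k \<phi> \<Longrightarrow> idn genprecat m (code \<phi>) = code (ext (\<lambda>M. idn (Z M) m (\<phi> M)))"
  "gen k \<phi> \<Longrightarrow> gen l \<psi> \<Longrightarrow> cmp genprecat m m' (code \<phi>) (code \<psi>) = code (ext (\<lambda>M. cmp (Z M) m m' (\<phi> M) (\<psi> M)))"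
  by (auto simp: genprecat_def)

lemma genprecat_bd: "\<lbrakk>i < n; u \<in> cells genprecat (Suc i)\<rbrakk> \<Longrightarrow> bd genprecat e i u \<in> cells genprecat i"
  by (auto simp: genprecat_cells genprecat_ops intro: gen_Bd)

lemma decode_bd: "\<lbrakk>M \<in> I; i < n; u \<in> cells genprecat (Suc i)\<rbrakk> \<Longrightarrow> decode (bd genprecat e i u) M = bd (Z M) e i (decode u M)"
  by (auto simp: genprecat_cells genprecat_ops decode_code[OF gen_Bd])

lemma genprecat_comp_defined:
  assumes a: "comp_defined n genprecat i k l (code \<phi>) (code \<psi>)" and "gen k \<phi>" "gen l \<psi>" and M: "M \<in> I"
  shows "comp_defined n (Z M) i k l (\<phi> M) (\<psi> M)"
proof -
  have *: "decode (bdto genprecat e i k u) M = bdto (Z M) e i k (decode u M)"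
    if "k \<le> n" "u \<in> cells genprecat k" "i \<le> k" for e i k u
    using that bdto_map[of n genprecat e "\<lambda>_ c. decode c M" "Z M" k u i] genprecat_bd decode_bd M by simp
  show ?thesis
    using assms *[of k "code \<phi>" i Tgt] *[of l "code \<psi>" i Src] gen_cells
    by (auto simp: comp_defined_def i_composable_def)
qed

lemma comp_defined_cases:
  assumes a: "comp_defined n genprecat i k l u v"
  obtains \<phi> \<psi> where "u = code \<phi>" "v = code \<psi>" "gen k \<phi>" "gen l \<psi>"
    "gen (max k l) (ext (\<lambda>M. cmp (Z M) k l (\<phi> M) (\<psi> M)))"
proof -
  obtain \<phi> \<psi> where "u = code \<phi>" "v = code \<psi>" "gen k \<phi>" "gen l \<psi>"
    using a by (auto simp: comp_defined_def i_composable_def genprecat_cells)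
  moreover have "i = min k l - 1" "0 < k" "0 < l" "k \<le> n" "l \<le> n" using a by (auto simp: comp_defined_def)
  ultimately show thesis using that genprecat_comp_defined[of i k l \<phi> \<psi>] a gen_Cmp[of k \<phi> l \<psi>] by blast
qed

lemma premor_decode:
  assumes M: "M \<in> I" shows "premor n genprecat (Z M) (\<lambda>k c. decode c M)"
proof
  fix i k l u v assume "comp_defined n genprecat i k l u v"
  then show "decode (cmp genprecat k l u v) M = cmp (Z M) k l (decode u M) (decode v M)"
    using M by (auto elim!: comp_defined_cases simp: genprecat_ops)
qed (use M in \<open>auto simp: decode_bd genprecat_cells gen_cells genprecat_ops decode_code[OF gen_Idn]\<close>)

lemma decode_inj:
  assumes "u \<in> cells genprecat k" "v \<in> cells genprecat l" "\<And>M. M \<in> I \<Longrightarrow> decode u M = decode v M"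
  shows "u = v"
proof -
  from assms obtain \<phi> \<psi> where *: "u = code \<phi>" "v = code \<psi>" "gen k \<phi>" "gen l \<psi>" by (auto simp: genprecat_cells)
  with assms(3) have "ext \<phi> = ext \<psi>" by (simp add: ext_eq_iff)
  then show ?thesis using * gen_ext by metis
qed

lemma precategory_genprecat: "precategory n genprecat"
proof (rule precategory_if_jointly_injective[where I = I and Z = Z and \<pi> = "\<lambda>M k c. decode c M"])
  fix i k l u v assume "comp_defined n genprecat i k l u v"
  then show "cmp genprecat k l u v \<in> cells genprecat (max k l)"
    by (auto elim!: comp_defined_cases simp: genprecat_ops)
next
  fix k u v assume "u \<in> cells genprecat k" "v \<in> cells genprecat k" "\<And>M. M \<in> I \<Longrightarrow> decode u M = decode v M"
  then show "u = v" by (rule decode_inj)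
next
  fix k u assume "k < n" "u \<in> cells genprecat k"
  then show "idn genprecat k u \<in> cells genprecat (Suc k)"
    using gen_Idn by (auto simp: genprecat_cells genprecat_ops)
qed (simp_all add: Z genprecat_bd premor_decode)

lemma genprecat_induct:
  assumes u: "u \<in> cells genprecat k"
    and Gen: "\<And>k x b. k \<le> n \<Longrightarrow> x \<in> A b k \<Longrightarrow> Q k (code (ext (g b k x)))"
    and Bd: "\<And>i u e. \<lbrakk>i < n; u \<in> cells genprecat (Suc i); Q (Suc i) u\<rbrakk> \<Longrightarrow> Q i (bd genprecat e i u)"
    and Idn: "\<And>k u. \<lbrakk>k < n; u \<in> cells genprecat k; Q k u\<rbrakk> \<Longrightarrow> Q (Suc k) (idn genprecat k u)"
    and Cmp: "\<And>i k l u v. \<lbrakk>comp_defined n genprecat i k l u v; Q k u; Q l v\<rbrakk> \<Longrightarrow> Q (max k l) (cmp genprecat k l u v)"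
  shows "Q k u"
proof -
  obtain \<phi> where "gen k \<phi>" "u = code \<phi>" using u by (auto simp: genprecat_cells)
  have "Q k (code \<phi>)" using \<open>gen k \<phi>\<close>
  proof (induction rule: gen.induct)
    case (gen_Gen k x b)
    then show ?case using Gen by simp
  next
    case (gen_Bd i \<phi> e)
    then show ?case using Bd[of i "code \<phi>" e] by (simp add: genprecat_ops)
  next
    case (gen_Idn k \<phi>)
    then show ?case using Idn[of k "code \<phi>"] by (simp add: genprecat_ops)
  next
    case (gen_Cmp k \<phi> l \<psi>)
    \<comment> \<open>Composability in all components means that the two boundaries agree in all
      components, which \<open>decode_inj\<close> turns into equality in the generated
      precategory.\<close>
    have "bdto genprecat Tgt (min k l - 1) k (code \<phi>) = bdto genprecat Src (min k l - 1) l (code \<psi>)"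
    proof (rule decode_inj)
      have b: "\<And>M. M \<in> I \<Longrightarrow> decode (bdto genprecat e i k u) M = bdto (Z M) e i k (decode u M)"
        if "k \<le> n" "u \<in> cells genprecat k" "i \<le> k" for e i k u
        using that by (simp add: premor.premor_bdto[OF premor_decode precategory_genprecat])
      fix M assume "M \<in> I"
      then show "decode (bdto genprecat Tgt (min k l - 1) k (code \<phi>)) M
        = decode (bdto genprecat Src (min k l - 1) l (code \<psi>)) M"
        using gen_Cmp comp_definedD(10)[OF Z gen_Cmp.hyps(7)] by (simp add: b min_le_iff_disj)
    qed (use gen_Cmp in \<open>auto intro!: precategory.bdto_cells[OF precategory_genprecat] simp: min_le_iff_disj\<close>)
    then have "comp_defined n genprecat (min k l - 1) k l (code \<phi>) (code \<psi>)"
      using gen_Cmp by (auto simp: comp_defined_def i_composable_def)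
    then show ?case using Cmp[of _ k l "code \<phi>" "code \<psi>"] gen_Cmp by (simp add: genprecat_ops)
  qed
  then show ?thesis using \<open>u = code \<phi>\<close> by simp
qed

end

section \<open>The funny tensor product by elements\<close>

lemma prestrict_eq_iff: "prestrict n C f = prestrict n C g \<longleftrightarrow> (\<forall>k\<le>n. \<forall>u \<in> cells C k. f k u = g k u)"
  using prestrict_eqI[of n C f g] prestrict_eqD[of n C f g] by blast

locale funny_tensor = coding T for T :: "'a itself" +
  fixes n :: nat
begin

text \<open>
  A morphism out of \<open>C \<boxtimes> D\<close> amounts to two families of whiskerings that agree on pairs of
  \<open>0\<close>-cells.
\<close>

definition bimor :: "'a precat \<Rightarrow> 'a precat \<Rightarrow> 'a precat \<Rightarrow>
    (nat \<Rightarrow> 'a \<Rightarrow> 'a \<Rightarrow> 'a) \<Rightarrow> (nat \<Rightarrow> 'a \<Rightarrow> 'a \<Rightarrow> 'a) \<Rightarrow> bool" where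
  "bimor C D Z l r \<longleftrightarrow>
     (\<forall>d \<in> cells D 0. premor n C Z (\<lambda>k u. l k u d)) \<and>
     (\<forall>c \<in> cells C 0. premor n D Z (\<lambda>k v. r k c v)) \<and>
     (\<forall>c \<in> cells C 0. \<forall>d \<in> cells D 0. l 0 c d = r 0 c d)"

lemma bimorD:
  assumes "bimor C D Z l r"
  shows "d \<in> cells D 0 \<Longrightarrow> premor n C Z (\<lambda>k u. l k u d)"
    "c \<in> cells C 0 \<Longrightarrow> premor n D Z (\<lambda>k v. r k c v)"
    "c \<in> cells C 0 \<Longrightarrow> d \<in> cells D 0 \<Longrightarrow> l 0 c d = r 0 c d"
  using assms by (auto simp: bimor_def)

text \<open>All operations keep the coordinate in the skeleton, so the product of \<open>C\<close>
  with the skeleton of \<open>D\<close> is a disjoint union of copies of \<open>C\<close>, one for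
  each 0-cell of \<open>D\<close>.\<close>

lemma premor_pprod_pskel:
  fixes C D Z :: "'a precat"
  shows "premor n (pprod C (pskel D)) Z f \<longleftrightarrow> (\<forall>d \<in> cells D 0. premor n C Z (\<lambda>k u. f k (pcode (u, d))))"
proof (intro iffI ballI)
  fix d assume f: "premor n (pprod C (pskel D)) Z f" and d: "d \<in> cells D 0"
  interpret f: premor n "pprod C (pskel D)" Z f by (rule f)
  show "premor n C Z (\<lambda>k u. f k (pcode (u, d)))"
  proof
    fix i k l u v assume a: "comp_defined n C i k l u v"
    then have "comp_defined n (pprod C (pskel D)) i k l (pcode (u, d)) (pcode (v, d))"
      using d by (auto simp: comp_defined_pprod comp_defined_pskel comp_defined_def[of n C])
    from f.map_cmp[OF this] show "f (max k l) (pcode (cmp C k l u v, d)) = cmp Z k l (f k (pcode (u, d))) (f l (pcode (v, d)))"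
      by simp
  next
    fix i u e assume "i < n" "u \<in> cells C (Suc i)"
    with d f.map_bd[of i "pcode (u, d)" e]
    show "f i (pcode (bd C e i u, d)) = bd Z e i (f (Suc i) (pcode (u, d)))" by simp
  next
    fix k u assume "k < n" "u \<in> cells C k"
    with d f.map_idn[of k "pcode (u, d)"]
    show "f (Suc k) (pcode (idn C k u, d)) = idn Z k (f k (pcode (u, d)))" by simp
  qed (use d f.map_cells in simp)
next
  assume *: "\<forall>d \<in> cells D 0. premor n C Z (\<lambda>k u. f k (pcode (u, d)))"
  show "premor n (pprod C (pskel D)) Z f"
  proof
    fix i k l u v assume "comp_defined n (pprod C (pskel D)) i k l u v"
    then show "f (max k l) (cmp (pprod C (pskel D)) k l u v) = cmp Z k l (f k u) (f l v)"
      using * premor.map_cmp[of n C Z "\<lambda>k u. f k (pcode (u, _))"]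
      by (fastforce elim!: comp_defined_pprodE simp: comp_defined_pskel)
  qed (use * in \<open>auto simp: cells_pprod premor.map_cells[of n C Z "\<lambda>k u. f k (pcode (u, _))"]
      premor.map_bd[of n C Z "\<lambda>k u. f k (pcode (u, _))"] premor.map_idn[of n C Z "\<lambda>k u. f k (pcode (u, _))"]\<close>)
qed

lemma premor_pskel_pprod:
  fixes C D Z :: "'a precat"
  shows "premor n (pprod (pskel C) D) Z f \<longleftrightarrow> (\<forall>c \<in> cells C 0. premor n D Z (\<lambda>k u. f k (pcode (c, u))))"
proof (intro iffI ballI)
  fix d assume f: "premor n (pprod (pskel C) D) Z f" and d: "d \<in> cells C 0"
  interpret f: premor n "pprod (pskel C) D" Z f by (rule f)
  show "premor n D Z (\<lambda>k u. f k (pcode (d, u)))"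
  proof
    fix i k l u v assume a: "comp_defined n D i k l u v"
    then have "comp_defined n (pprod (pskel C) D) i k l (pcode (d, u)) (pcode (d, v))"
      using d by (auto simp: comp_defined_pprod comp_defined_pskel comp_defined_def[of n D])
    from f.map_cmp[OF this] show "f (max k l) (pcode (d, cmp D k l u v)) = cmp Z k l (f k (pcode (d, u))) (f l (pcode (d, v)))"
      by simp
  next
    fix i u e assume "i < n" "u \<in> cells D (Suc i)"
    with d f.map_bd[of i "pcode (d, u)" e]
    show "f i (pcode (d, bd D e i u)) = bd Z e i (f (Suc i) (pcode (d, u)))" by simp
  next
    fix k u assume "k < n" "u \<in> cells D k"
    with d f.map_idn[of k "pcode (d, u)"]
    show "f (Suc k) (pcode (d, idn D k u)) = idn Z k (f k (pcode (d, u)))" by simp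
  qed (use d f.map_cells in simp)
next
  assume *: "\<forall>c \<in> cells C 0. premor n D Z (\<lambda>k u. f k (pcode (c, u)))"
  show "premor n (pprod (pskel C) D) Z f"
  proof
    fix i k l u v assume "comp_defined n (pprod (pskel C) D) i k l u v"
    then show "f (max k l) (cmp (pprod (pskel C) D) k l u v) = cmp Z k l (f k u) (f l v)"
      using * premor.map_cmp[of n D Z "\<lambda>k u. f k (pcode (_, u))"]
      by (fastforce elim!: comp_defined_pprodE simp: comp_defined_pskel)
  qed (use * in \<open>auto simp: cells_pprod premor.map_cells[of n D Z "\<lambda>k u. f k (pcode (_, u))"]
      premor.map_bd[of n D Z "\<lambda>k u. f k (pcode (_, u))"] premor.map_idn[of n D Z "\<lambda>k u. f k (pcode (_, u))"]\<close>)
qed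

lemma pprod_map_apply [simp]:
  fixes C D :: "'a precat"
  shows "k \<le> n \<Longrightarrow> u \<in> cells C k \<Longrightarrow> v \<in> cells D k \<Longrightarrow> pprod_map n C D f g k (pcode (u, v)) = pcode (f k u, g k v)"
  by (simp add: pprod_map_def)

lemma pskel_incl_apply [simp]: "k \<le> n \<Longrightarrow> x \<in> cells C 0 \<Longrightarrow> pskel_incl n C k x = idn_iter C k x"
  by (simp add: pskel_incl_def)

lemma pskel_map_apply [simp]: "k \<le> n \<Longrightarrow> x \<in> cells C 0 \<Longrightarrow> pskel_map n C f k x = f 0 x"
  by (simp add: pskel_map_def)

abbreviation square :: "'a precat \<Rightarrow> 'a precat \<Rightarrow> 'a pmap \<Rightarrow> 'a pmap \<Rightarrow> bool" where
  "square C D p q \<equiv>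
     pcomp n (pprod (pskel C) (pskel D)) p (pprod_map n (pskel C) (pskel D) (pskel_incl n C) (pid n (pskel D)))
   = pcomp n (pprod (pskel C) (pskel D)) q (pprod_map n (pskel C) (pskel D) (pid n (pskel C)) (pskel_incl n D))"

text \<open>At a pair of 0-cells placed in dimension \<open>k\<close>, either path yields the
  \<open>k\<close>-fold identity of its value in dimension 0. The square therefore commutes once it
  commutes on 0-cells.\<close>

lemma square_iff_bimor:
  fixes C D Z :: "'a precat"
  assumes C: "precategory n C" and D: "precategory n D"
    and p: "premor n (pprod C (pskel D)) Z p" and q: "premor n (pprod (pskel C) D) Z q"
  shows "square C D p q
    \<longleftrightarrow> bimor C D Z (\<lambda>k u d. p k (pcode (u, d))) (\<lambda>k c v. q k (pcode (c, v)))" (is "?L = ?R \<longleftrightarrow> ?B")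
proof
  have p': "premor n C Z (\<lambda>k u. p k (pcode (u, d)))" if "d \<in> cells D 0" for d
    using p that by (simp add: premor_pprod_pskel)
  have q': "premor n D Z (\<lambda>k v. q k (pcode (c, v)))" if "c \<in> cells C 0" for c
    using q that by (simp add: premor_pskel_pprod)
  { assume eq: "?L = ?R"
    have "p 0 (pcode (c, d)) = q 0 (pcode (c, d))" if "c \<in> cells C 0" "d \<in> cells D 0" for c d
      using pcomp_eqD[OF eq, of 0 "pcode (c, d)"] that by simp
    then show ?B using p' q' by (simp add: bimor_def) }
  { assume B: ?B
    show "?L = ?R"
    proof (rule pcomp_eqI)
      fix k u assume k: "k \<le> n" and "u \<in> cells (pprod (pskel C) (pskel D)) k"
      then obtain c d where u: "u = pcode (c, d)" "c \<in> cells C 0" "d \<in> cells D 0" by (auto simp: cells_pprod)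
      then show "p k (pprod_map n (pskel C) (pskel D) (pskel_incl n C) (pid n (pskel D)) k u)
        = q k (pprod_map n (pskel C) (pskel D) (pid n (pskel C)) (pskel_incl n D) k u)"
        using k bimorD(3)[OF B u(2,3)] premor.premor_idn_iter[OF p'[OF u(3)] C k u(2)]
          premor.premor_idn_iter[OF q'[OF u(2)] D k u(3)] by simp
    qed }
qed

section \<open>Existence of the pushout\<close>

lemma premor_pprod_map:
  fixes C D :: "'a precat"
  assumes C: "precategory n C" "precategory n D" "precategory n C'" "precategory n D'"
    and f: "premor n C C' f" and g: "premor n D D' g"
  shows "premor n (pprod C D) (pprod C' D') (\<lambda>k p. pcode (f k (pfst p), g k (psnd p)))"
  by unfold_locales
    (auto simp: cells_pprod premor.map_cells[OF f] premor.map_cells[OF g] premor.map_bd[OF f] premor.map_bd[OF g]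
      premor.map_idn[OF f] premor.map_idn[OF g] premor.map_cmp[OF f] premor.map_cmp[OF g] elim!: comp_defined_pprodE)

lemma prefunctor_pprod_map:
  fixes C D :: "'a precat"
  assumes "precategory n C" "precategory n D" "precategory n C'" "precategory n D'"
    and "prefunctor n C C' f" and "prefunctor n D D' g"
  shows "prefunctor n (pprod C D) (pprod C' D') (pprod_map n C D f g)"
  unfolding pprod_map_def using assms
  by (intro prefunctor_prestrict premor_pprod_map precategory_pprod) (auto simp: prefunctor_premor)

lemma prefunctor_pskel_incl: "precategory n C \<Longrightarrow> prefunctor n (pskel C) C (pskel_incl n C)"
  unfolding pskel_incl_def by (intro prefunctor_prestrict premor_pskel_incl precategory_pskel)

text \<open>
  The pushout is generated by the two products inside the product of all cocones, so that its
  equations hold because they hold in every cocone.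
\<close>

lemma ex_funny_pushout:
  fixes C D :: "'a precat"
  assumes C: "precategory n C" and D: "precategory n D"
  shows "\<exists>P l r. funny_pushout n C D P l r"
proof -
  let ?X = "pprod C (pskel D)" and ?Y = "pprod (pskel C) D"
  \<comment> \<open>The index set consists of all cocones with vertex in \<open>'a\<close>; each
    contributes one component of the ambient product.\<close>
  define I where "I = {(Z, p, q) | Z p q. precategory n Z \<and> prefunctor n ?X Z p \<and> prefunctor n ?Y Z q \<and> square C D p q}"
  define A where "A b k = cells (if b then ?X else ?Y) k" for b k
  \<comment> \<open>A cell of either product becomes the family of its images in all cocones, under
    the leg \<open>p\<close> for \<open>True\<close> and \<open>q\<close> for
    \<open>False\<close>.\<close>
  define g where "g b k x M = (if b then fst (snd M) else snd (snd M)) k x"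
    for b and k :: nat and x and M :: "'a precat \<times> 'a pmap \<times> 'a pmap"
  have X: "precategory n ?X" and Y: "precategory n ?Y"
    using C D by (auto intro: precategory_pprod precategory_pskel)
  interpret generated T n I fst A g
  proof (intro generated.intro coding_axioms generated_axioms.intro)
    fix M :: "'a precat \<times> 'a pmap \<times> 'a pmap" and k x b assume "M \<in> I" "k \<le> n" "x \<in> A b k"
    then show "g b k x M \<in> cells (fst M) k"
      by (cases b) (auto simp: I_def A_def g_def premor.map_cells[OF prefunctor_premor])
  qed (auto simp: I_def)
  let ?P = genprecat
  define \<gamma> where "\<gamma> b k x = code (ext (g b k x))" for b k x
  have \<gamma>_cells: "\<gamma> b k x \<in> cells ?P k" if "k \<le> n" "x \<in> A b k" for b k x
    using that by (simp add: \<gamma>_def gen_Gen)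
  have decode_\<gamma>: "decode (\<gamma> b k x) M = g b k x M" if "k \<le> n" "x \<in> A b k" "M \<in> I" for b k x M
    unfolding \<gamma>_def using decode_code[OF gen_Gen[OF that(1,2)]] that by simp
  have mor: "premor n (if b then ?X else ?Y) ?P (\<gamma> b)" for b
  proof (rule premor_if_jointly_injective[where I = I and Z = fst and \<pi> = "\<lambda>M k c. decode c M"])
    fix M :: "'a precat \<times> 'a pmap \<times> 'a pmap" assume M: "M \<in> I"
    have "premor n (if b then ?X else ?Y) (fst M) (\<lambda>k u. g b k u M)"
      using M by (cases b) (auto simp: I_def g_def prefunctor_premor)
    then show "premor n (if b then ?X else ?Y) (fst M) (\<lambda>k u. decode (\<gamma> b k u) M)"
      by (rule premor_cong[rotated 2]) (use X Y decode_\<gamma> M in \<open>auto simp: A_def\<close>)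
  next
    fix k u v assume "u \<in> cells ?P k" "v \<in> cells ?P k" "\<And>M. M \<in> I \<Longrightarrow> decode u M = decode v M"
    then show "u = v" by (rule decode_inj)
  next
    fix k u assume "k \<le> n" "u \<in> cells (if b then ?X else ?Y) k"
    then show "\<gamma> b k u \<in> cells ?P k" by (intro \<gamma>_cells) (simp_all add: A_def)
  qed (use X Y premor_decode precategory_genprecat in auto)
  note P = precategory_genprecat
  define l where "l = prestrict n ?X (\<gamma> True)"
  define r where "r = prestrict n ?Y (\<gamma> False)"
  have l: "prefunctor n ?X ?P l" and r: "prefunctor n ?Y ?P r"
    unfolding l_def r_def using mor[of True] mor[of False] X Y by (auto intro: prefunctor_prestrict)
  have l_apply: "decode (l k x) M = fst (snd M) k x" if "k \<le> n" "x \<in> cells ?X k" "M \<in> I" for k x M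
    using that decode_\<gamma>[of k x True M] by (simp add: l_def A_def g_def)
  have r_apply: "decode (r k x) M = snd (snd M) k x" if "k \<le> n" "x \<in> cells ?Y k" "M \<in> I" for k x M
    using that decode_\<gamma>[of k x False M] by (simp add: r_def A_def g_def)
  have square: "square C D l r"
    unfolding square_iff_bimor[OF C D prefunctor_premor[OF l] prefunctor_premor[OF r]] bimor_def
  proof (intro conjI ballI)
    fix c d assume cd: "c \<in> cells C 0" "d \<in> cells D 0"
    show "l 0 (pcode (c, d)) = r 0 (pcode (c, d))"
    proof (rule decode_inj[of _ 0 _ 0])
      fix M assume M: "M \<in> I"
      then obtain Z p q where Zpq: "M = (Z, p, q)" "prefunctor n ?X Z p" "prefunctor n ?Y Z q" "square C D p q"
        by (auto simp: I_def)
      then have "bimor C D Z (\<lambda>k u d. p k (pcode (u, d))) (\<lambda>k c v. q k (pcode (c, v)))"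
        using square_iff_bimor[OF C D prefunctor_premor[OF Zpq(2)] prefunctor_premor[OF Zpq(3)]] by simp
      then have "p 0 (pcode (c, d)) = q 0 (pcode (c, d))" using cd bimorD(3) by blast
      then show "decode (l 0 (pcode (c, d))) M = decode (r 0 (pcode (c, d))) M"
        using cd M Zpq by (simp add: l_apply r_apply)
    qed (use cd premor.map_cells[OF prefunctor_premor[OF l]] premor.map_cells[OF prefunctor_premor[OF r]] in auto)
  qed (use prefunctor_premor[OF l] prefunctor_premor[OF r] in \<open>simp_all add: premor_pprod_pskel premor_pskel_pprod\<close>)
  have univ: "\<exists>!h. prefunctor n ?P Z h \<and> pcomp n ?X h l = p \<and> pcomp n ?Y h r = q"
    if Zpq: "precategory n Z" "prefunctor n ?X Z p" "prefunctor n ?Y Z q" "square C D p q" for Z p q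
  proof (rule ex_ex1I)
    let ?M = "(Z, p, q)"
    have M: "?M \<in> I" using Zpq by (simp add: I_def)
    \<comment> \<open>The given cocone is one of the indices, and the projection to its component is
      the mediating morphism.\<close>
    define h where "h = prestrict n ?P (\<lambda>k c. decode c ?M)"
    have "prefunctor n ?P Z h"
      unfolding h_def using premor_decode[OF M] by (intro prefunctor_prestrict P) simp
    moreover have "pcomp n ?X h l = p"
      using prefunctor_eqI[OF prefunctor_pcomp[OF X l \<open>prefunctor n ?P Z h\<close>] Zpq(2)] M
        premor.map_cells[OF prefunctor_premor[OF l]] by (simp add: h_def l_apply)
    moreover have "pcomp n ?Y h r = q"
      using prefunctor_eqI[OF prefunctor_pcomp[OF Y r \<open>prefunctor n ?P Z h\<close>] Zpq(3)] M
        premor.map_cells[OF prefunctor_premor[OF r]] by (simp add: h_def r_apply)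
    ultimately show "\<exists>h. prefunctor n ?P Z h \<and> pcomp n ?X h l = p \<and> pcomp n ?Y h r = q" by blast
  next
    fix h h' assume h: "prefunctor n ?P Z h \<and> pcomp n ?X h l = p \<and> pcomp n ?Y h r = q"
      and h': "prefunctor n ?P Z h' \<and> pcomp n ?X h' l = p \<and> pcomp n ?Y h' r = q"
    then interpret h: premor n ?P Z h by (simp add: prefunctor_premor)
    interpret h': premor n ?P Z h' using h' by (simp add: prefunctor_premor)
    \<comment> \<open>Uniqueness is the place where generation matters: mediating morphisms agree on
      the generators, hence on all cells obtained from them. The full product would not have this
      property in general.\<close>
    have "h k u = h' k u" if "u \<in> cells ?P k" for k u
      using that
    proof (induction rule: genprecat_induct[consumes 1, case_names Gen Bd Idn Cmp])
      case (Gen k x b)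
      have eqs: "pcomp n ?X h l = pcomp n ?X h' l" "pcomp n ?Y h r = pcomp n ?Y h' r" using h h' by auto
      show ?case
        using pcomp_eqD[OF eqs(1), of k x] pcomp_eqD[OF eqs(2), of k x] Gen
        by (cases b) (simp_all add: A_def l_def r_def \<gamma>_def)
    qed (simp_all add: h.map_bd h'.map_bd h.map_idn h'.map_idn h.map_cmp h'.map_cmp)
    then show "h = h'" using h h' prefunctor_eqI by blast
  qed
  have "funny_pushout n C D ?P l r"
    unfolding funny_pushout_def is_pushout_def using C D l r X Y P square univ
    by (simp add: PCat_def precategory_pprod precategory_pskel prefunctor_pprod_map prefunctor_pskel_incl prefunctor_pid)
  then show ?thesis by blast
qed

section \<open>The chosen tensor product: universal property, induction and 0-cells\<close>

abbreviation fl :: "'a precat \<Rightarrow> 'a precat \<Rightarrow> nat \<Rightarrow> 'a \<Rightarrow> 'a \<Rightarrow> 'a" where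
  "fl C D k u d \<equiv> finl n C D k (pcode (u, d))"

abbreviation fr :: "'a precat \<Rightarrow> 'a precat \<Rightarrow> nat \<Rightarrow> 'a \<Rightarrow> 'a \<Rightarrow> 'a" where
  "fr C D k c v \<equiv> finr n C D k (pcode (c, v))"

definition agrees :: "'a precat \<Rightarrow> 'a precat \<Rightarrow> 'a pmap \<Rightarrow>
    (nat \<Rightarrow> 'a \<Rightarrow> 'a \<Rightarrow> 'a) \<Rightarrow> (nat \<Rightarrow> 'a \<Rightarrow> 'a \<Rightarrow> 'a) \<Rightarrow> bool" where
  "agrees C D h l r \<longleftrightarrow>
     (\<forall>k u d. k \<le> n \<longrightarrow> u \<in> cells C k \<longrightarrow> d \<in> cells D 0 \<longrightarrow> h k (fl C D k u d) = l k u d) \<and>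
     (\<forall>k c v. k \<le> n \<longrightarrow> c \<in> cells C 0 \<longrightarrow> v \<in> cells D k \<longrightarrow> h k (fr C D k c v) = r k c v)"

lemma agreesD:
  assumes "agrees C D h l r"
  shows "k \<le> n \<Longrightarrow> u \<in> cells C k \<Longrightarrow> d \<in> cells D 0 \<Longrightarrow> h k (fl C D k u d) = l k u d"
    "k \<le> n \<Longrightarrow> c \<in> cells C 0 \<Longrightarrow> v \<in> cells D k \<Longrightarrow> h k (fr C D k c v) = r k c v"
  using assms by (auto simp: agrees_def)

context
  fixes C D :: "'a precat"
  assumes C: "precategory n C" and D: "precategory n D"
begin

lemma funny_pushout_ftens: "funny_pushout n C D (ftens n C D) (finl n C D) (finr n C D)"
proof -
  obtain P l r where *: "funny_pushout n C D P l r" using ex_funny_pushout[OF C D] by blast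
  have "case funny n C D of (P, l, r) \<Rightarrow> funny_pushout n C D P l r"
    unfolding funny_def by (rule someI[of _ "(P, l, r)"]) (simp add: *)
  then show ?thesis by (simp add: ftens_def finl_def finr_def split: prod.splits)
qed

lemma precategory_ftens: "precategory n (ftens n C D)"
  and prefunctor_finl: "prefunctor n (pprod C (pskel D)) (ftens n C D) (finl n C D)"
  and prefunctor_finr: "prefunctor n (pprod (pskel C) D) (ftens n C D) (finr n C D)"
  using funny_pushout_ftens by (auto simp: funny_pushout_def is_pushout_def PCat_def)

lemma bimor_ftens: "bimor C D (ftens n C D) (fl C D) (fr C D)"
  using funny_pushout_ftens
    square_iff_bimor[OF C D prefunctor_premor[OF prefunctor_finl] prefunctor_premor[OF prefunctor_finr]]
  by (auto simp: funny_pushout_def is_pushout_def PCat_def)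

text \<open>The pushout property with pairs unfolded: \<open>l\<close> and \<open>r\<close>, read as
  functions of a coded pair, are the legs of a cocone, and \<open>agrees\<close> expresses the two
  triangles.\<close>

lemma ftens_universal:
  assumes Z: "precategory n Z" and lr: "bimor C D Z l r"
  shows "\<exists>!h. prefunctor n (ftens n C D) Z h \<and> agrees C D h l r"
proof -
  let ?X = "pprod C (pskel D)" and ?Y = "pprod (pskel C) D"
  define p where "p = prestrict n ?X (\<lambda>k x. l k (pfst x) (psnd x))"
  define q where "q = prestrict n ?Y (\<lambda>k x. r k (pfst x) (psnd x))"
  have X: "precategory n ?X" and Y: "precategory n ?Y"
    using C D by (auto intro: precategory_pprod precategory_pskel)
  have p: "prefunctor n ?X Z p" and q: "prefunctor n ?Y Z q"
    unfolding p_def q_def using lr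
    by (auto intro!: prefunctor_prestrict X Y simp: premor_pprod_pskel premor_pskel_pprod bimor_def)
  have "bimor C D Z (\<lambda>k u d. p k (pcode (u, d))) (\<lambda>k c v. q k (pcode (c, v)))"
    using prefunctor_premor[OF p] prefunctor_premor[OF q] lr
    by (auto simp: bimor_def premor_pprod_pskel premor_pskel_pprod p_def q_def)
  then have sq: "square C D p q"
    using square_iff_bimor[OF C D prefunctor_premor[OF p] prefunctor_premor[OF q]] by simp
  have univ: "\<exists>!h. prefunctor n (ftens n C D) Z h \<and> pcomp n ?X h (finl n C D) = p \<and> pcomp n ?Y h (finr n C D) = q"
    using funny_pushout_ftens Z p q sq unfolding funny_pushout_def is_pushout_def PCat_def by simp
  have "pcomp n ?X h (finl n C D) = p \<and> pcomp n ?Y h (finr n C D) = q \<longleftrightarrow> agrees C D h l r" for h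
    unfolding agrees_def p_def q_def pcomp_def prestrict_eq_iff by (force simp: cells_pprod)
  then show ?thesis using univ by simp
qed

text \<open>Restricting \<open>h\<close> along the coprojections gives a \<open>bimor\<close> for
  which both \<open>h\<close> and \<open>h'\<close> are the mediating morphism.\<close>

lemma ftens_ext:
  assumes Z: "precategory n Z" and h: "prefunctor n (ftens n C D) Z h" and h': "prefunctor n (ftens n C D) Z h'"
    and l: "\<And>k u d. \<lbrakk>k \<le> n; u \<in> cells C k; d \<in> cells D 0\<rbrakk> \<Longrightarrow> h k (fl C D k u d) = h' k (fl C D k u d)"
    and r: "\<And>k c v. \<lbrakk>k \<le> n; c \<in> cells C 0; v \<in> cells D k\<rbrakk> \<Longrightarrow> h k (fr C D k c v) = h' k (fr C D k c v)"
  shows "h = h'"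
proof -
  note b = bimor_ftens
  have "bimor C D Z (\<lambda>k u d. h k (fl C D k u d)) (\<lambda>k c v. h k (fr C D k c v))"
    unfolding bimor_def
    using premor_comp[OF C bimorD(1)[OF b] prefunctor_premor[OF h]]
      premor_comp[OF D bimorD(2)[OF b] prefunctor_premor[OF h]] bimorD(3)[OF b] by auto
  moreover have "agrees C D h (\<lambda>k u d. h k (fl C D k u d)) (\<lambda>k c v. h k (fr C D k c v))"
    "agrees C D h' (\<lambda>k u d. h k (fl C D k u d)) (\<lambda>k c v. h k (fr C D k c v))"
    using l r by (auto simp: agrees_def)
  ultimately show ?thesis using ftens_universal[OF Z] h h' by blast
qed

lemma fl_cells: "k \<le> n \<Longrightarrow> u \<in> cells C k \<Longrightarrow> d \<in> cells D 0 \<Longrightarrow> fl C D k u d \<in> cells (ftens n C D) k"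
  using premor.map_cells[OF bimorD(1)[OF bimor_ftens]] by blast

lemma fr_cells: "k \<le> n \<Longrightarrow> c \<in> cells C 0 \<Longrightarrow> v \<in> cells D k \<Longrightarrow> fr C D k c v \<in> cells (ftens n C D) k"
  using premor.map_cells[OF bimorD(2)[OF bimor_ftens]] by blast

lemma fl_fr: "c \<in> cells C 0 \<Longrightarrow> d \<in> cells D 0 \<Longrightarrow> fl C D 0 c d = fr C D 0 c d"
  using bimorD(3)[OF bimor_ftens] by blast

text \<open>The subprecategory on the cells with property \<open>Q\<close> satisfies the universal property as well.\<close>

lemma ftens_induct:
  assumes p: "k \<le> n" "p \<in> cells (ftens n C D) k"
    and l: "\<And>k u d. \<lbrakk>k \<le> n; u \<in> cells C k; d \<in> cells D 0\<rbrakk> \<Longrightarrow> Q k (fl C D k u d)"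
    and r: "\<And>k c v. \<lbrakk>k \<le> n; c \<in> cells C 0; v \<in> cells D k\<rbrakk> \<Longrightarrow> Q k (fr C D k c v)"
    and Bd: "\<And>i u e. \<lbrakk>i < n; u \<in> cells (ftens n C D) (Suc i); Q (Suc i) u\<rbrakk> \<Longrightarrow> Q i (bd (ftens n C D) e i u)"
    and Idn: "\<And>k u. \<lbrakk>k < n; u \<in> cells (ftens n C D) k; Q k u\<rbrakk> \<Longrightarrow> Q (Suc k) (idn (ftens n C D) k u)"
    and Cmp: "\<And>i k l u v. \<lbrakk>comp_defined n (ftens n C D) i k l u v; Q k u; Q l v\<rbrakk> \<Longrightarrow> Q (max k l) (cmp (ftens n C D) k l u v)"
  shows "Q k p"
proof -
  let ?P = "ftens n C D"
  interpret P: precategory n ?P by (rule precategory_ftens)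
  let ?S = "\<lambda>k. {p \<in> cells ?P k. Q k p}"
  let ?P' = "?P\<lparr>cells := ?S\<rparr>"
  have P': "precategory n ?P'" and incl: "premor n ?P' ?P (\<lambda>k u. u)"
    using P.precategory_axioms Bd Idn Cmp
    by (auto intro!: precategory_subprecategory P.bd_cells P.idn_cells P.cmp_cells)
  have fl': "premor n C ?P' (\<lambda>k u. fl C D k u d)" if "d \<in> cells D 0" for d
    by (rule premor_if_jointly_injective[where I = "{()}" and Z = "\<lambda>_. ?P" and \<pi> = "\<lambda>_ k u. u"])
      (use C P' incl l fl_cells bimorD(1)[OF bimor_ftens that] that in auto)
  have fr': "premor n D ?P' (\<lambda>k v. fr C D k c v)" if "c \<in> cells C 0" for c
    by (rule premor_if_jointly_injective[where I = "{()}" and Z = "\<lambda>_. ?P" and \<pi> = "\<lambda>_ k u. u"])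
      (use D P' incl r fr_cells bimorD(2)[OF bimor_ftens that] that in auto)
  have "bimor C D ?P' (fl C D) (fr C D)"
    using fl' fr' fl_fr by (auto simp: bimor_def)
  \<comment> \<open>The mediating morphism into the subprecategory fixes both coprojections.
    Followed by the inclusion it is the identity of \<open>?P\<close>, so every cell of
    \<open>?P\<close> already lies in \<open>?P'\<close>.\<close>
  then obtain h where h: "prefunctor n ?P ?P' h" and ag: "agrees C D h (fl C D) (fr C D)"
    using ftens_universal[OF P'] by blast
  have h': "premor n ?P ?P h"
    using premor_comp[OF P.precategory_axioms prefunctor_premor[OF h] incl] .
  have hP: "prefunctor n ?P ?P h" using h h' by (simp add: prefunctor_iff_premor)
  have "h = pid n ?P"
    by (rule ftens_ext[OF P.precategory_axioms hP prefunctor_pid[OF P.precategory_axioms]])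
      (use ag in \<open>auto simp: agrees_def fl_cells fr_cells\<close>)
  then have "h k p = p" using p by simp
  moreover have "h k p \<in> cells ?P' k" using premor.map_cells[OF prefunctor_premor[OF h]] p by blast
  ultimately show ?thesis by simp
qed

lemma ftens_cells_0:
  assumes "p \<in> cells (ftens n C D) 0"
  obtains c d where "c \<in> cells C 0" "d \<in> cells D 0" "p = fl C D 0 c d"
proof -
  let ?P = "ftens n C D"
  interpret P: precategory n ?P by (rule precategory_ftens)
  \<comment> \<open>The invariant concerns the 0-boundaries of cells of every dimension, because a
    0-cell may also arise as a boundary of a higher cell. For \<open>k = 0\<close> it is the
    claim.\<close>
  let ?Q = "\<lambda>k p. \<forall>e. bdto ?P e 0 k p \<in> {fl C D 0 c d | c d. c \<in> cells C 0 \<and> d \<in> cells D 0}"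
  have "?Q 0 p"
  proof (rule ftens_induct[where Q = ?Q])
    fix k u d assume *: "k \<le> n" "u \<in> cells C k" "d \<in> cells D 0"
    have "bdto ?P e 0 k (fl C D k u d) = fl C D 0 (bdto C e 0 k u) d" for e
      using premor.premor_bdto[OF bimorD(1)[OF bimor_ftens *(3)] C *(1,2), of 0 e] by simp
    then show "?Q k (fl C D k u d)" using * precategory.bdto_cells[OF C] by blast
  next
    fix k c v assume *: "k \<le> n" "c \<in> cells C 0" "v \<in> cells D k"
    have b: "bdto ?P e 0 k (fr C D k c v) = fr C D 0 c (bdto D e 0 k v)" for e
      using premor.premor_bdto[OF bimorD(2)[OF bimor_ftens *(2)] D *(1,3), of 0 e] by simp
    have "bdto D e 0 k v \<in> cells D 0" for e using * precategory.bdto_cells[OF D] by blast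
    then show "?Q k (fr C D k c v)" unfolding b using * fl_fr by (metis (mono_tags, lifting) mem_Collect_eq)
  next
    fix i u e assume "i < n" "u \<in> cells ?P (Suc i)" "?Q (Suc i) u"
    then show "?Q i (bd ?P e i u)"
    proof (cases i)
      case 0
      then show ?thesis using \<open>?Q (Suc i) u\<close> by (simp add: bdto_Suc)
    next
      case (Suc j)
      then show ?thesis using \<open>?Q (Suc i) u\<close> \<open>i < n\<close> \<open>u \<in> cells ?P (Suc i)\<close> by (simp add: P.bdto_bd)
    qed
  next
    fix i k l u v assume cd: "comp_defined n ?P i k l u v" and Q: "?Q k u" "?Q l v"
    show "?Q (max k l) (cmp ?P k l u v)"
    proof
      fix e show "bdto ?P e 0 (max k l) (cmp ?P k l u v) \<in> {fl C D 0 c d | c d. c \<in> cells C 0 \<and> d \<in> cells D 0}"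
        using Q P.bdto_cmp[OF cd] by (cases e) simp_all
    qed
  next
    fix k u assume "k < n" "u \<in> cells ?P k" "?Q k u"
    then show "?Q (Suc k) (idn ?P k u)" by (simp add: P.bdto_idn)
  qed (use assms in auto)
  then show thesis using that by auto
qed

text \<open>The comparison with the cartesian product separates the \<open>0\<close>-cells of \<open>C \<boxtimes> D\<close>.\<close>

lemma fl_inj_0:
  assumes "c \<in> cells C 0" "d \<in> cells D 0" "c' \<in> cells C 0" "d' \<in> cells D 0" and eq: "fl C D 0 c d = fl C D 0 c' d'"
  shows "c = c' \<and> d = d'"
proof -
  have l: "premor n (pprod C (pskel D)) (pprod C D) (\<lambda>k p. pcode (pfst p, idn_iter D k (psnd p)))"
    using premor_pprod_map[OF C precategory_pskel C D premor_id premor_pskel_incl[OF D]] .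
  have r: "premor n (pprod (pskel C) D) (pprod C D) (\<lambda>k p. pcode (idn_iter C k (pfst p), psnd p))"
    using premor_pprod_map[OF precategory_pskel D C D premor_pskel_incl[OF C] premor_id] .
  \<comment> \<open>The comparison morphism replaces the argument given as a 0-cell by its iterated
    identity in dimension \<open>k\<close>.\<close>
  let ?l = "\<lambda>k u d. pcode (u, idn_iter D k d)" and ?r = "\<lambda>k c v. pcode (idn_iter C k c, v)"
  have "bimor C D (pprod C D) ?l ?r"
    unfolding bimor_def using l[unfolded premor_pprod_pskel] r[unfolded premor_pskel_pprod] by simp
  from ftens_universal[OF precategory_pprod[OF C D] this]
  obtain h where "agrees C D h ?l ?r" by (elim ex1E conjE)
  from agreesD(1)[OF this, of 0]
  have "h 0 (fl C D 0 c d) = pcode (c, d)" "h 0 (fl C D 0 c' d') = pcode (c', d')"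
    using assms(1-4) by simp_all
  then have "pcode (c, d) = pcode (c', d')" unfolding eq by (rule trans[OF sym])
  then show ?thesis by (simp only: pcode_eq_iff prod.inject)
qed

end

end

section \<open>The structure maps of the tensor product on generators\<close>

lemma cells_pterminal [simp]: "cells pterminal k = {undefined}"
  by (simp add: pterminal_def)

text \<open>This is the morphism named by the 0-cell \<open>x\<close>, factored as a constant map to
  the 0-skeleton followed by its inclusion into \<open>C\<close>.\<close>

lemma premor_pterminal:
  assumes C: "precategory n C" and x: "x \<in> cells C 0"
  shows "premor n pterminal C (\<lambda>k u. idn_iter C k x)"
proof -
  have "premor n pterminal (pskel C) (\<lambda>k u. x)"
    by unfold_locales (auto simp: x)
  from premor_comp[OF precategory_pterminal this premor_pskel_incl[OF C]] show ?thesis .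
qed

context funny_tensor begin

lemma ball_cells_pprod:
  "(\<forall>x \<in> cells (pprod C D) k. Q x) \<longleftrightarrow> (\<forall>u \<in> cells C k. \<forall>v \<in> cells D k. Q (pcode (u, v)))" for C D :: "'a precat"
  by (auto simp: cells_pprod)

text \<open>Composites with a coprojection in one variable are not normalised outside the cells, so
  they can only be compared cell by cell.\<close>

lemma ftens_ext_premor:
  assumes C: "precategory n C" and D: "precategory n D" and Z: "precategory n Z"
    and h: "premor n (ftens n C D) Z h" and h': "premor n (ftens n C D) Z h'"
    and l: "\<And>k u d. \<lbrakk>k \<le> n; u \<in> cells C k; d \<in> cells D 0\<rbrakk> \<Longrightarrow> h k (fl C D k u d) = h' k (fl C D k u d)"
    and r: "\<And>k c v. \<lbrakk>k \<le> n; c \<in> cells C 0; v \<in> cells D k\<rbrakk> \<Longrightarrow> h k (fr C D k c v) = h' k (fr C D k c v)"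
    and p: "k \<le> n" "p \<in> cells (ftens n C D) k"
  shows "h k p = h' k p"
proof -
  note P = precategory_ftens[OF C D]
  have "prestrict n (ftens n C D) h = prestrict n (ftens n C D) h'"
    by (rule ftens_ext[OF C D Z prefunctor_prestrict[OF P h] prefunctor_prestrict[OF P h']])
      (simp_all add: l r fl_cells[OF C D] fr_cells[OF C D])
  from prestrict_eqD[OF this p] show ?thesis .
qed

lemma premor_fl: "precategory n C \<Longrightarrow> precategory n D \<Longrightarrow> d \<in> cells D 0 \<Longrightarrow> premor n C (ftens n C D) (\<lambda>k u. fl C D k u d)"
  using bimorD(1)[OF bimor_ftens] .

lemma premor_fr: "precategory n C \<Longrightarrow> precategory n D \<Longrightarrow> c \<in> cells C 0 \<Longrightarrow> premor n D (ftens n C D) (\<lambda>k v. fr C D k c v)"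
  using bimorD(2)[OF bimor_ftens] .

text \<open>This is \<open>ftens_ext\<close> applied twice. On the left coprojection it is used
  again for C \<boxtimes> D; the right coprojection involves only 0-cells of C \<boxtimes> D, and
  these all come from pairs of 0-cells.\<close>

lemma ftens3_ext:
  assumes C: "precategory n C" and D: "precategory n D" and E: "precategory n E" and Z: "precategory n Z"
    and h: "prefunctor n (ftens n (ftens n C D) E) Z h" and h': "prefunctor n (ftens n (ftens n C D) E) Z h'"
    and 1: "\<And>k u d e. \<lbrakk>k \<le> n; u \<in> cells C k; d \<in> cells D 0; e \<in> cells E 0\<rbrakk> \<Longrightarrow>
      h k (fl (ftens n C D) E k (fl C D k u d) e) = h' k (fl (ftens n C D) E k (fl C D k u d) e)"
    and 2: "\<And>k c v e. \<lbrakk>k \<le> n; c \<in> cells C 0; v \<in> cells D k; e \<in> cells E 0\<rbrakk> \<Longrightarrow>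
      h k (fl (ftens n C D) E k (fr C D k c v) e) = h' k (fl (ftens n C D) E k (fr C D k c v) e)"
    and 3: "\<And>k c d w. \<lbrakk>k \<le> n; c \<in> cells C 0; d \<in> cells D 0; w \<in> cells E k\<rbrakk> \<Longrightarrow>
      h k (fr (ftens n C D) E k (fl C D 0 c d) w) = h' k (fr (ftens n C D) E k (fl C D 0 c d) w)"
  shows "h = h'"
proof (rule ftens_ext[OF precategory_ftens[OF C D] E Z h h'])
  let ?P = "ftens n C D"
  have P: "precategory n ?P" by (rule precategory_ftens[OF C D])
  fix k p e assume k: "k \<le> n" and p: "p \<in> cells ?P k" and e: "e \<in> cells E 0"
  show "h k (fl ?P E k p e) = h' k (fl ?P E k p e)"
    by (rule ftens_ext_premor[OF C D Z _ _ _ _ k p,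
          OF premor_comp[OF P premor_fl[OF P E e] prefunctor_premor[OF h]]
             premor_comp[OF P premor_fl[OF P E e] prefunctor_premor[OF h']]])
      (use 1 2 e in auto)
next
  fix k p w assume k: "k \<le> n" and p: "p \<in> cells (ftens n C D) 0" and w: "w \<in> cells E k"
  show "h k (fr (ftens n C D) E k p w) = h' k (fr (ftens n C D) E k p w)"
    by (rule ftens_cells_0[OF C D p]) (simp add: 3 k w)
qed

text \<open>As for the unitors below, the triangles in the definition are rewritten as
  \<open>agrees\<close>, and \<open>ftens_universal\<close> guarantees that \<open>THE\<close>
  denotes the solution.\<close>

lemma ftens_map_props:
  assumes C: "precategory n C" and D: "precategory n D" and C': "precategory n C'" and D': "precategory n D'"
    and f: "prefunctor n C C' f" and g: "prefunctor n D D' g"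
  shows "prefunctor n (ftens n C D) (ftens n C' D') (ftens_map n C C' D D' f g)"
    "agrees C D (ftens_map n C C' D D' f g) (\<lambda>k u d. fl C' D' k (f k u) (g 0 d)) (\<lambda>k c v. fr C' D' k (f 0 c) (g k v))"
proof -
  let ?l = "\<lambda>k u d. fl C' D' k (f k u) (g 0 d)" and ?r = "\<lambda>k c v. fr C' D' k (f 0 c) (g k v)"
  interpret f: premor n C C' f using f by (rule prefunctor_premor)
  interpret g: premor n D D' g using g by (rule prefunctor_premor)
  have "bimor C D (ftens n C' D') ?l ?r"
    unfolding bimor_def
    using premor_comp[OF C f.premor_axioms premor_fl[OF C' D']]
      premor_comp[OF D g.premor_axioms premor_fr[OF C' D']] fl_fr[OF C' D'] f.map_cells[of 0] g.map_cells[of 0]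
    by auto
  from ftens_universal[OF C D precategory_ftens[OF C' D'] this]
  have ex: "\<exists>!h. prefunctor n (ftens n C D) (ftens n C' D') h \<and> agrees C D h ?l ?r" .
  have 1: "pcomp n (pprod C (pskel D)) h (finl n C D) = pcomp n (pprod C (pskel D)) (finl n C' D')
        (pprod_map n C (pskel D) f (pskel_map n D g)) \<and>
      pcomp n (pprod (pskel C) D) h (finr n C D) = pcomp n (pprod (pskel C) D) (finr n C' D')
        (pprod_map n (pskel C) D (pskel_map n C f) g) \<longleftrightarrow> agrees C D h ?l ?r" for h
    unfolding agrees_def pcomp_def prestrict_eq_iff by (force simp: cells_pprod)
  show "prefunctor n (ftens n C D) (ftens n C' D') (ftens_map n C C' D D' f g)"
    "agrees C D (ftens_map n C C' D D' f g) ?l ?r"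
    using theI'[OF ex] unfolding ftens_map_def 1 by auto
qed

lemma flunit_props:
  assumes C: "precategory n C"
  shows "prefunctor n (ftens n pterminal C) C (flunit n C)"
    "agrees pterminal C (flunit n C) (\<lambda>k u d. idn_iter C k d) (\<lambda>k c v. v)"
proof -
  let ?l = "\<lambda>k u d. idn_iter C k d" and ?r = "\<lambda>k c v. v"
  have "bimor pterminal C C ?l ?r"
    unfolding bimor_def using premor_pterminal[OF C] premor_id by auto
  from ftens_universal[OF precategory_pterminal C C this]
  have ex: "\<exists>!h. prefunctor n (ftens n pterminal C) C h \<and> agrees pterminal C h ?l ?r" .
  have 1: "pcomp n (pprod (pskel pterminal) C) h (finr n pterminal C) = pproj2 n (pskel pterminal) C \<and>
      pcomp n (pprod pterminal (pskel C)) h (finl n pterminal C)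
          = pcomp n (pprod pterminal (pskel C)) (pskel_incl n C) (pproj2 n pterminal (pskel C))
    \<longleftrightarrow> agrees pterminal C h ?l ?r" for h
    unfolding agrees_def pcomp_def pproj2_def prestrict_eq_iff by (force simp: cells_pprod)
  show "prefunctor n (ftens n pterminal C) C (flunit n C)" "agrees pterminal C (flunit n C) ?l ?r"
    using theI'[OF ex] unfolding flunit_def 1 by auto
qed

lemma frunit_props:
  assumes C: "precategory n C"
  shows "prefunctor n (ftens n C pterminal) C (frunit n C)"
    "agrees C pterminal (frunit n C) (\<lambda>k u d. u) (\<lambda>k c v. idn_iter C k c)"
proof -
  let ?l = "\<lambda>k u d. u" and ?r = "\<lambda>k c v. idn_iter C k c"
  have "bimor C pterminal C ?l ?r"
    unfolding bimor_def using premor_pterminal[OF C] premor_id by auto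
  from ftens_universal[OF C precategory_pterminal C this]
  have ex: "\<exists>!h. prefunctor n (ftens n C pterminal) C h \<and> agrees C pterminal h ?l ?r" .
  have 1: "pcomp n (pprod C (pskel pterminal)) h (finl n C pterminal) = pproj1 n C (pskel pterminal) \<and>
      pcomp n (pprod (pskel C) pterminal) h (finr n C pterminal)
          = pcomp n (pprod (pskel C) pterminal) (pskel_incl n C) (pproj1 n (pskel C) pterminal)
    \<longleftrightarrow> agrees C pterminal h ?l ?r" for h
    unfolding agrees_def pcomp_def pproj1_def prestrict_eq_iff by (force simp: cells_pprod)
  show "prefunctor n (ftens n C pterminal) C (frunit n C)" "agrees C pterminal (frunit n C) ?l ?r"
    using theI'[OF ex] unfolding frunit_def 1 by auto
qed

lemma fassoc_props:
  assumes C: "precategory n C" and D: "precategory n D" and E: "precategory n E"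
  shows "prefunctor n (ftens n (ftens n C D) E) (ftens n C (ftens n D E)) (fassoc n C D E)"
    "\<And>k u d e. \<lbrakk>k \<le> n; u \<in> cells C k; d \<in> cells D 0; e \<in> cells E 0\<rbrakk> \<Longrightarrow>
      fassoc n C D E k (fl (ftens n C D) E k (fl C D k u d) e) = fl C (ftens n D E) k u (fl D E 0 d e)"
    "\<And>k c v e. \<lbrakk>k \<le> n; c \<in> cells C 0; v \<in> cells D k; e \<in> cells E 0\<rbrakk> \<Longrightarrow>
      fassoc n C D E k (fl (ftens n C D) E k (fr C D k c v) e) = fr C (ftens n D E) k c (fl D E k v e)"
    "\<And>k c d w. \<lbrakk>k \<le> n; c \<in> cells C 0; d \<in> cells D 0; w \<in> cells E k\<rbrakk> \<Longrightarrow>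
      fassoc n C D E k (fr (ftens n C D) E k (fl C D 0 c d) w) = fr C (ftens n D E) k c (fr D E k d w)"
proof -
  let ?P = "ftens n C D" and ?Q = "ftens n D E"
  let ?L = "ftens n ?P E" and ?R = "ftens n C ?Q"
  have P: "precategory n ?P" and Q: "precategory n ?Q" using C D E by (auto intro: precategory_ftens)
  have R: "precategory n ?R" using C Q by (rule precategory_ftens)
  let ?spec = "\<lambda>h. (\<forall>k\<le>n. \<forall>u \<in> cells C k. \<forall>d \<in> cells D 0. \<forall>e \<in> cells E 0.
      h k (fl ?P E k (fl C D k u d) e) = fl C ?Q k u (fl D E 0 d e)) \<and>
    (\<forall>k\<le>n. \<forall>c \<in> cells C 0. \<forall>v \<in> cells D k. \<forall>e \<in> cells E 0.
      h k (fl ?P E k (fr C D k c v) e) = fr C ?Q k c (fl D E k v e)) \<and>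
    (\<forall>k\<le>n. \<forall>c \<in> cells C 0. \<forall>d \<in> cells D 0. \<forall>w \<in> cells E k.
      h k (fr ?P E k (fl C D 0 c d) w) = fr C ?Q k c (fr D E k d w))"
  note QC = fl_cells[OF D E] fr_cells[OF D E]
  \<comment> \<open>With the 0-cell \<open>e\<close> held fixed, the first two families of
    generators form a \<open>bimor\<close> on \<open>C\<close> and \<open>D\<close>, giving the left
    whiskering part of the associator.\<close>
  have exH: "\<exists>h. prefunctor n ?P ?R h \<and>
      agrees C D h (\<lambda>k u d. fl C ?Q k u (fl D E 0 d e)) (\<lambda>k c v. fr C ?Q k c (fl D E k v e))"
    if e: "e \<in> cells E 0" for e
  proof -
    have "bimor C D ?R (\<lambda>k u d. fl C ?Q k u (fl D E 0 d e)) (\<lambda>k c v. fr C ?Q k c (fl D E k v e))"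
      unfolding bimor_def
      using premor_fl[OF C Q] premor_comp[OF D premor_fl[OF D E e] premor_fr[OF C Q]] fl_fr[OF C Q] QC(1)[of 0] e
      by auto
    from ex1_implies_ex[OF ftens_universal[OF C D R this]] show ?thesis .
  qed
  define H where "H e = (SOME h. prefunctor n ?P ?R h \<and>
      agrees C D h (\<lambda>k u d. fl C ?Q k u (fl D E 0 d e)) (\<lambda>k c v. fr C ?Q k c (fl D E k v e)))" for e
  have H: "prefunctor n ?P ?R (H e)"
    and aH: "agrees C D (H e) (\<lambda>k u d. fl C ?Q k u (fl D E 0 d e)) (\<lambda>k c v. fr C ?Q k c (fl D E k v e))"
    if "e \<in> cells E 0" for e
    using someI_ex[OF exH[OF that]] unfolding H_def by blast+
  have "\<exists>c d. c \<in> cells C 0 \<and> d \<in> cells D 0 \<and> p = fl C D 0 c d" if "p \<in> cells ?P 0" for p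
    using ftens_cells_0[OF C D that] by blast
  \<comment> \<open>The right part starts from a 0-cell of C \<boxtimes> D, on which the associator
    can be prescribed only after splitting it into coordinates \<open>\<gamma>\<close> and
    \<open>\<delta>\<close>.\<close>
  then obtain \<gamma> \<delta> where \<gamma>: "\<And>p. p \<in> cells ?P 0 \<Longrightarrow> \<gamma> p \<in> cells C 0"
    and \<delta>: "\<And>p. p \<in> cells ?P 0 \<Longrightarrow> \<delta> p \<in> cells D 0"
    and \<gamma>\<delta>: "\<And>p. p \<in> cells ?P 0 \<Longrightarrow> fl C D 0 (\<gamma> p) (\<delta> p) = p"
    by metis
  have b: "bimor ?P E ?R (\<lambda>k p e. H e k p) (\<lambda>k p w. fr C ?Q k (\<gamma> p) (fr D E k (\<delta> p) w))"
    unfolding bimor_def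
  proof (intro conjI ballI)
    fix e assume "e \<in> cells E 0" then show "premor n ?P ?R (H e)" using H prefunctor_premor by blast
  next
    fix p assume "p \<in> cells ?P 0"
    then show "premor n E ?R (\<lambda>k w. fr C ?Q k (\<gamma> p) (fr D E k (\<delta> p) w))"
      using premor_comp[OF E premor_fr[OF D E \<delta>] premor_fr[OF C Q \<gamma>]] by blast
  next
    fix p e assume p: "p \<in> cells ?P 0" and e: "e \<in> cells E 0"
    have "H e 0 (fl C D 0 (\<gamma> p) (\<delta> p)) = fl C ?Q 0 (\<gamma> p) (fl D E 0 (\<delta> p) e)"
      using agreesD(1)[OF aH[OF e] _ \<gamma>[OF p] \<delta>[OF p]] by simp
    also have "\<dots> = fr C ?Q 0 (\<gamma> p) (fr D E 0 (\<delta> p) e)"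
      using fl_fr[OF C Q \<gamma>[OF p] QC(1)[of 0 "\<delta> p" e]] fl_fr[OF D E \<delta>[OF p] e] \<delta>[OF p] e by simp
    finally show "H e 0 p = fr C ?Q 0 (\<gamma> p) (fr D E 0 (\<delta> p) e)" using \<gamma>\<delta>[OF p] by simp
  qed
  obtain h where h: "prefunctor n ?L ?R h" and
    a: "agrees ?P E h (\<lambda>k p e. H e k p) (\<lambda>k p w. fr C ?Q k (\<gamma> p) (fr D E k (\<delta> p) w))"
    using ex1_implies_ex[OF ftens_universal[OF P E R b]] by blast
  have spec_h: "?spec h"
  proof (intro conjI allI impI ballI)
    fix k u d e assume *: "k \<le> n" "u \<in> cells C k" "d \<in> cells D 0" "e \<in> cells E 0"
    show "h k (fl ?P E k (fl C D k u d) e) = fl C ?Q k u (fl D E 0 d e)"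
      using agreesD(1)[OF a *(1) fl_cells[OF C D *(1-3)] *(4)] agreesD(1)[OF aH[OF *(4)] *(1-3)] by (rule trans)
  next
    fix k c v e assume *: "k \<le> n" "c \<in> cells C 0" "v \<in> cells D k" "e \<in> cells E 0"
    show "h k (fl ?P E k (fr C D k c v) e) = fr C ?Q k c (fl D E k v e)"
      using agreesD(1)[OF a *(1) fr_cells[OF C D *(1-3)] *(4)] agreesD(2)[OF aH[OF *(4)] *(1-3)] by (rule trans)
  next
    fix k c d w assume *: "k \<le> n" "c \<in> cells C 0" "d \<in> cells D 0" "w \<in> cells E k"
    have p: "fl C D 0 c d \<in> cells ?P 0" using fl_cells[OF C D] * by simp
    \<comment> \<open>The splitting was an arbitrary choice; injectivity of \<open>fl\<close> on
      0-cells shows that it returns the original coordinates.\<close>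
    have "\<gamma> (fl C D 0 c d) = c \<and> \<delta> (fl C D 0 c d) = d"
      using fl_inj_0[OF C D \<gamma>[OF p] \<delta>[OF p] *(2,3) \<gamma>\<delta>[OF p]] .
    then show "h k (fr ?P E k (fl C D 0 c d) w) = fr C ?Q k c (fr D E k d w)"
      using agreesD(2)[OF a *(1) p *(4)] by simp
  qed
  have ex: "\<exists>!h. prefunctor n ?L ?R h \<and> ?spec h"
  proof (rule ex1I[of _ h])
    show "prefunctor n ?L ?R h \<and> ?spec h" by (rule conjI[OF h spec_h])
    fix h' assume h': "prefunctor n ?L ?R h' \<and> ?spec h'"
    show "h' = h"
      by (rule ftens3_ext[OF C D E R _ h]) (use h' spec_h in \<open>simp_all only:\<close>)
  qed
  \<comment> \<open>Evaluated on coded triples, the three equations defining \<open>fassoc\<close>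
    are the three clauses of \<open>?spec\<close>.\<close>
  have 0: "pcomp n (pprod (pprod C (pskel D)) (pskel E)) h (finL1 n C D E)
          = pcomp n (pprod (pprod C (pskel D)) (pskel E)) (finR1 n C D E) (pprod_assoc n C (pskel D) (pskel E)) \<longleftrightarrow>
     (\<forall>k\<le>n. \<forall>u \<in> cells C k. \<forall>d \<in> cells D 0. \<forall>e \<in> cells E 0.
      h k (fl ?P E k (fl C D k u d) e) = fl C ?Q k u (fl D E 0 d e))" for h
    unfolding pcomp_def finL1_def finR1_def pprod_assoc_def prestrict_eq_iff by (simp add: ball_cells_pprod cong: ball_cong)
  have 1: "pcomp n (pprod (pprod (pskel C) D) (pskel E)) h (finL2 n C D E)
          = pcomp n (pprod (pprod (pskel C) D) (pskel E)) (finR2 n C D E) (pprod_assoc n (pskel C) D (pskel E)) \<longleftrightarrow>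
    (\<forall>k\<le>n. \<forall>c \<in> cells C 0. \<forall>v \<in> cells D k. \<forall>e \<in> cells E 0.
      h k (fl ?P E k (fr C D k c v) e) = fr C ?Q k c (fl D E k v e))" for h
    unfolding pcomp_def finL2_def finR2_def pprod_assoc_def prestrict_eq_iff by (simp add: ball_cells_pprod cong: ball_cong)
  have 2: "pcomp n (pprod (pprod (pskel C) (pskel D)) E) h (finL3 n C D E)
          = pcomp n (pprod (pprod (pskel C) (pskel D)) E) (finR3 n C D E) (pprod_assoc n (pskel C) (pskel D) E) \<longleftrightarrow>
    (\<forall>k\<le>n. \<forall>c \<in> cells C 0. \<forall>d \<in> cells D 0. \<forall>w \<in> cells E k.
      h k (fr ?P E k (fl C D 0 c d) w) = fr C ?Q k c (fr D E k d w))" for h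
    unfolding pcomp_def finL3_def finR3_def pprod_assoc_def prestrict_eq_iff by (simp add: ball_cells_pprod cong: ball_cong)
  have *: "prefunctor n ?L ?R (fassoc n C D E) \<and> ?spec (fassoc n C D E)"
    unfolding fassoc_def 0 1 2 by (rule theI'[OF ex])
  then show "prefunctor n ?L ?R (fassoc n C D E)" by blast
  from * show "fassoc n C D E k (fl ?P E k (fl C D k u d) e) = fl C ?Q k u (fl D E 0 d e)"
    if "k \<le> n" "u \<in> cells C k" "d \<in> cells D 0" "e \<in> cells E 0" for k u d e using that by blast
  from * show "fassoc n C D E k (fl ?P E k (fr C D k c v) e) = fr C ?Q k c (fl D E k v e)"
    if "k \<le> n" "c \<in> cells C 0" "v \<in> cells D k" "e \<in> cells E 0" for k c v e using that by blast
  from * show "fassoc n C D E k (fr ?P E k (fl C D 0 c d) w) = fr C ?Q k c (fr D E k d w)"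
    if "k \<le> n" "c \<in> cells C 0" "d \<in> cells D 0" "w \<in> cells E k" for k c d w using that by blast
qed

end

section \<open>Enriched categories by elements\<close>

text \<open>
  A category enriched in \<open>n\<close>-precategories: \<open>wl x y z k u v\<close> whiskers \<open>u \<in> H(x,y)\<^sub>k\<close> with the
  \<open>0\<close>-cell \<open>v\<close> of \<open>H(y,z)\<close>, and \<open>wr x y z k u v\<close> whiskers \<open>v \<in> H(y,z)\<^sub>k\<close> with the
  \<open>0\<close>-cell \<open>u\<close> of \<open>H(x,y)\<close>.
\<close>

locale whiskered =
  fixes n :: nat and X :: "'a set" and H :: "'a \<Rightarrow> 'a \<Rightarrow> 'a precat" and \<epsilon> :: "'a \<Rightarrow> 'a"
    and wl wr :: "'a \<Rightarrow> 'a \<Rightarrow> 'a \<Rightarrow> nat \<Rightarrow> 'a \<Rightarrow> 'a \<Rightarrow> 'a"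
  assumes hom: "\<lbrakk>x \<in> X; y \<in> X\<rbrakk> \<Longrightarrow> precategory n (H x y)"
    and unit_cells: "x \<in> X \<Longrightarrow> \<epsilon> x \<in> cells (H x x) 0"
    and wl: "\<lbrakk>x \<in> X; y \<in> X; z \<in> X; v \<in> cells (H y z) 0\<rbrakk> \<Longrightarrow> premor n (H x y) (H x z) (\<lambda>k u. wl x y z k u v)"
    and wr: "\<lbrakk>x \<in> X; y \<in> X; z \<in> X; u \<in> cells (H x y) 0\<rbrakk> \<Longrightarrow> premor n (H y z) (H x z) (\<lambda>k v. wr x y z k u v)"
    and wl_wr: "\<lbrakk>x \<in> X; y \<in> X; z \<in> X; u \<in> cells (H x y) 0; v \<in> cells (H y z) 0\<rbrakk> \<Longrightarrow> wl x y z 0 u v = wr x y z 0 u v"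
    and wl_wl: "\<lbrakk>x \<in> X; y \<in> X; z \<in> X; w \<in> X; k \<le> n; u \<in> cells (H x y) k; v \<in> cells (H y z) 0; t \<in> cells (H z w) 0\<rbrakk>
      \<Longrightarrow> wl x z w k (wl x y z k u v) t = wl x y w k u (wl y z w 0 v t)"
    and wl_wr_assoc: "\<lbrakk>x \<in> X; y \<in> X; z \<in> X; w \<in> X; k \<le> n; u \<in> cells (H x y) 0; v \<in> cells (H y z) k; t \<in> cells (H z w) 0\<rbrakk>
      \<Longrightarrow> wl x z w k (wr x y z k u v) t = wr x y w k u (wl y z w k v t)"
    and wr_wr: "\<lbrakk>x \<in> X; y \<in> X; z \<in> X; w \<in> X; k \<le> n; u \<in> cells (H x y) 0; v \<in> cells (H y z) 0; t \<in> cells (H z w) k\<rbrakk>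
      \<Longrightarrow> wr x z w k (wl x y z 0 u v) t = wr x y w k u (wr y z w k v t)"
    and unit_left: "\<lbrakk>x \<in> X; y \<in> X; k \<le> n; u \<in> cells (H x y) k\<rbrakk> \<Longrightarrow> wr x x y k (\<epsilon> x) u = u"
    and unit_right: "\<lbrakk>x \<in> X; y \<in> X; k \<le> n; u \<in> cells (H x y) k\<rbrakk> \<Longrightarrow> wl x y y k u (\<epsilon> y) = u"

section \<open>Enriched categories as whiskerings\<close>

lemma FunnyPCat_simps [simp]:
  "C \<in> Obj (FunnyPCat n) \<longleftrightarrow> precategory n C" "f \<in> Hom (FunnyPCat n) C D \<longleftrightarrow> prefunctor n C D f"
  "Ide (FunnyPCat n) = pid n" "Comp (FunnyPCat n) A B D g f = pcomp n A g f"
  "tens (FunnyPCat n) = ftens n" "tens_map (FunnyPCat n) = ftens_map n" "munit (FunnyPCat n) = pterminal"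
  "assoc (FunnyPCat n) = fassoc n" "lunit (FunnyPCat n) = flunit n" "runit (FunnyPCat n) = frunit n"
  by (auto simp: FunnyPCat_def PCat_def)

text \<open>The terminal precategory has the single cell \<open>undefined\<close> in each dimension,
  so a unit morphism is determined by its value in dimension 0; higher values are iterated
  identities.\<close>

definition eunit :: "('x, 'a precat, 'a pmap) ecat \<Rightarrow> 'x \<Rightarrow> 'a" where
  "eunit E x = eid E x 0 undefined"

definition ewl :: "nat \<Rightarrow> ('x, 'a precat, 'a pmap) ecat \<Rightarrow> 'x \<Rightarrow> 'x \<Rightarrow> 'x \<Rightarrow> nat \<Rightarrow> 'a \<Rightarrow> 'a \<Rightarrow> 'a" where
  "ewl n E x y z k u v = ecomp E x y z k (finl n (ehom E x y) (ehom E y z) k (pcode (u, v)))"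

definition ewr :: "nat \<Rightarrow> ('x, 'a precat, 'a pmap) ecat \<Rightarrow> 'x \<Rightarrow> 'x \<Rightarrow> 'x \<Rightarrow> nat \<Rightarrow> 'a \<Rightarrow> 'a \<Rightarrow> 'a" where
  "ewr n E x y z k u v = ecomp E x y z k (finr n (ehom E x y) (ehom E y z) k (pcode (u, v)))"

text \<open>Only the typing conditions of an enriched category: under them each of its equations can
  be translated into whiskerings separately.\<close>

locale pre_enriched = funny_tensor T n for T :: "'a itself" and n +
  fixes E :: "('a, 'a precat, 'a pmap) ecat"
  assumes hom: "\<lbrakk>x \<in> eobj E; y \<in> eobj E\<rbrakk> \<Longrightarrow> precategory n (ehom E x y)"
    and eid: "x \<in> eobj E \<Longrightarrow> prefunctor n pterminal (ehom E x x) (eid E x)"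
    and ecomp: "\<lbrakk>x \<in> eobj E; y \<in> eobj E; z \<in> eobj E\<rbrakk>
      \<Longrightarrow> prefunctor n (ftens n (ehom E x y) (ehom E y z)) (ehom E x z) (ecomp E x y z)"
begin

lemma premor_ewl:
  "\<lbrakk>x \<in> eobj E; y \<in> eobj E; z \<in> eobj E; v \<in> cells (ehom E y z) 0\<rbrakk>
   \<Longrightarrow> premor n (ehom E x y) (ehom E x z) (\<lambda>k u. ewl n E x y z k u v)"
  unfolding ewl_def by (rule premor_comp[OF hom premor_fl[OF hom hom] prefunctor_premor[OF ecomp]])

lemma premor_ewr:
  "\<lbrakk>x \<in> eobj E; y \<in> eobj E; z \<in> eobj E; u \<in> cells (ehom E x y) 0\<rbrakk>
   \<Longrightarrow> premor n (ehom E y z) (ehom E x z) (\<lambda>k v. ewr n E x y z k u v)"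
  unfolding ewr_def by (rule premor_comp[OF hom premor_fr[OF hom hom] prefunctor_premor[OF ecomp]])

lemma ewl_ewr:
  "\<lbrakk>x \<in> eobj E; y \<in> eobj E; z \<in> eobj E; u \<in> cells (ehom E x y) 0; v \<in> cells (ehom E y z) 0\<rbrakk>
   \<Longrightarrow> ewl n E x y z 0 u v = ewr n E x y z 0 u v"
  by (simp add: ewl_def ewr_def fl_fr[OF hom hom])

lemma eunit_cells: "x \<in> eobj E \<Longrightarrow> eunit E x \<in> cells (ehom E x x) 0"
  unfolding eunit_def using premor.map_cells[OF prefunctor_premor[OF eid]] by simp

lemma eid_eq: "x \<in> eobj E \<Longrightarrow> k \<le> n \<Longrightarrow> eid E x k undefined = idn_iter (ehom E x x) k (eunit E x)"
  using premor.premor_idn_iter[OF prefunctor_premor[OF eid] precategory_pterminal, of x k undefined]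
  by (cases k) (simp_all add: eunit_def pterminal_def)

text \<open>Two morphisms out of a triple tensor product are compared by \<open>ftens3_ext\<close>.
  The facts \<open>a1\<close> to \<open>b3\<close> evaluate both sides on the three families of
  generators.\<close>

lemma ecomp_assoc_iff:
  assumes x: "x \<in> eobj E" and y: "y \<in> eobj E" and z: "z \<in> eobj E" and w: "w \<in> eobj E"
  defines "C \<equiv> ehom E x y" and "D \<equiv> ehom E y z" and "B \<equiv> ehom E z w"
  shows "pcomp n (ftens n (ftens n C D) B) (ecomp E x z w)
         (ftens_map n (ftens n C D) (ehom E x z) B B (ecomp E x y z) (pid n B))
       = pcomp n (ftens n (ftens n C D) B)
           (pcomp n (ftens n C (ftens n D B)) (ecomp E x y w)
              (ftens_map n C C (ftens n D B) (ehom E y w) (pid n C) (ecomp E y z w)))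
           (fassoc n C D B)
     \<longleftrightarrow> (\<forall>k\<le>n. (\<forall>u \<in> cells C k. \<forall>v \<in> cells D 0. \<forall>t \<in> cells B 0.
            ewl n E x z w k (ewl n E x y z k u v) t = ewl n E x y w k u (ewl n E y z w 0 v t)) \<and>
          (\<forall>u \<in> cells C 0. \<forall>v \<in> cells D k. \<forall>t \<in> cells B 0.
            ewl n E x z w k (ewr n E x y z k u v) t = ewr n E x y w k u (ewl n E y z w k v t)) \<and>
          (\<forall>u \<in> cells C 0. \<forall>v \<in> cells D 0. \<forall>t \<in> cells B k.
            ewr n E x z w k (ewl n E x y z 0 u v) t = ewr n E x y w k u (ewr n E y z w k v t)))"
    (is "?a = ?b \<longleftrightarrow> _")
proof -
  let ?P = "ftens n C D" and ?Q = "ftens n D B"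
  let ?L = "ftens n ?P B"
  have C: "precategory n C" and D: "precategory n D" and B: "precategory n B" and xz: "precategory n (ehom E x z)"
    and yw: "precategory n (ehom E y w)" and xw: "precategory n (ehom E x w)"
    using x y z w hom by (auto simp: C_def D_def B_def)
  have P: "precategory n ?P" and Q: "precategory n ?Q" using C D B by (auto intro: precategory_ftens)
  have L: "precategory n ?L" and R: "precategory n (ftens n C ?Q)" using C P Q B by (auto intro: precategory_ftens)
  have exyz: "prefunctor n ?P (ehom E x z) (ecomp E x y z)"
    and eyzw: "prefunctor n ?Q (ehom E y w) (ecomp E y z w)"
    and exzw: "prefunctor n (ftens n (ehom E x z) B) (ehom E x w) (ecomp E x z w)"
    and exyw: "prefunctor n (ftens n C (ehom E y w)) (ehom E x w) (ecomp E x y w)"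
    using ecomp x y z w by (auto simp: C_def D_def B_def)
  note m1 = ftens_map_props[OF P B xz B exyz prefunctor_pid[OF B]]
  note m2 = ftens_map_props[OF C Q C yw prefunctor_pid[OF C] eyzw]
  note fa = fassoc_props[OF C D B]
  have a: "prefunctor n ?L (ehom E x w) ?a"
    by (rule prefunctor_pcomp[OF L m1(1) exzw])
  have b: "prefunctor n ?L (ehom E x w) ?b"
    by (rule prefunctor_pcomp[OF L fa(1) prefunctor_pcomp[OF R m2(1) exyw]])
  have a1: "?a k (fl ?P B k (fl C D k u v) t) = ewl n E x z w k (ewl n E x y z k u v) t"
    and b1: "?b k (fl ?P B k (fl C D k u v) t) = ewl n E x y w k u (ewl n E y z w 0 v t)"
    if *: "k \<le> n" "u \<in> cells C k" "v \<in> cells D 0" "t \<in> cells B 0" for k u v t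
  proof -
    have p: "fl C D k u v \<in> cells ?P k" by (rule fl_cells[OF C D *(1-3)])
    have q: "fl D B 0 v t \<in> cells ?Q 0" using fl_cells[OF D B, of 0] * by simp
    show "?a k (fl ?P B k (fl C D k u v) t) = ewl n E x z w k (ewl n E x y z k u v) t"
      using agreesD(1)[OF m1(2) *(1) p *(4)] fl_cells[OF P B *(1) p *(4)] * by (simp add: ewl_def C_def D_def B_def)
    show "?b k (fl ?P B k (fl C D k u v) t) = ewl n E x y w k u (ewl n E y z w 0 v t)"
      using agreesD(1)[OF m2(2) *(1) *(2) q] fl_cells[OF P B *(1) p *(4)] fl_cells[OF C Q *(1,2) q] fa(2)[OF *] *
      by (simp add: ewl_def C_def D_def B_def)
  qed
  have a2: "?a k (fl ?P B k (fr C D k u v) t) = ewl n E x z w k (ewr n E x y z k u v) t"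
    and b2: "?b k (fl ?P B k (fr C D k u v) t) = ewr n E x y w k u (ewl n E y z w k v t)"
    if *: "k \<le> n" "u \<in> cells C 0" "v \<in> cells D k" "t \<in> cells B 0" for k u v t
  proof -
    have p: "fr C D k u v \<in> cells ?P k" by (rule fr_cells[OF C D *(1-3)])
    have q: "fl D B k v t \<in> cells ?Q k" by (rule fl_cells[OF D B *(1,3,4)])
    show "?a k (fl ?P B k (fr C D k u v) t) = ewl n E x z w k (ewr n E x y z k u v) t"
      using agreesD(1)[OF m1(2) *(1) p *(4)] fl_cells[OF P B *(1) p *(4)] * by (simp add: ewl_def ewr_def C_def D_def B_def)
    show "?b k (fl ?P B k (fr C D k u v) t) = ewr n E x y w k u (ewl n E y z w k v t)"
      using agreesD(2)[OF m2(2) *(1) *(2) q] fl_cells[OF P B *(1) p *(4)] fr_cells[OF C Q *(1,2) q] fa(3)[OF *] *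
      by (simp add: ewl_def ewr_def C_def D_def B_def)
  qed
  have a3: "?a k (fr ?P B k (fl C D 0 u v) t) = ewr n E x z w k (ewl n E x y z 0 u v) t"
    and b3: "?b k (fr ?P B k (fl C D 0 u v) t) = ewr n E x y w k u (ewr n E y z w k v t)"
    if *: "k \<le> n" "u \<in> cells C 0" "v \<in> cells D 0" "t \<in> cells B k" for k u v t
  proof -
    have p: "fl C D 0 u v \<in> cells ?P 0" using fl_cells[OF C D, of 0] * by simp
    have q: "fr D B k v t \<in> cells ?Q k" by (rule fr_cells[OF D B *(1,3,4)])
    show "?a k (fr ?P B k (fl C D 0 u v) t) = ewr n E x z w k (ewl n E x y z 0 u v) t"
      using agreesD(2)[OF m1(2) *(1) p *(4)] fr_cells[OF P B *(1) p *(4)] * by (simp add: ewl_def ewr_def C_def D_def B_def)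
    show "?b k (fr ?P B k (fl C D 0 u v) t) = ewr n E x y w k u (ewr n E y z w k v t)"
      using agreesD(2)[OF m2(2) *(1) *(2) q] fr_cells[OF P B *(1) p *(4)] fr_cells[OF C Q *(1,2) q] fa(4)[OF *] *
      by (simp add: ewl_def ewr_def C_def D_def B_def)
  qed
  show ?thesis (is "_ \<longleftrightarrow> ?r")
  proof
    assume eq: "?a = ?b"
    show ?r
    proof (intro allI impI conjI ballI)
      fix k u v t assume "k \<le> n" "u \<in> cells C k" "v \<in> cells D 0" "t \<in> cells B 0"
      from a1[OF this] b1[OF this] show "ewl n E x z w k (ewl n E x y z k u v) t = ewl n E x y w k u (ewl n E y z w 0 v t)"
        unfolding eq by (rule trans[OF sym])
    next
      fix k u v t assume "k \<le> n" "u \<in> cells C 0" "v \<in> cells D k" "t \<in> cells B 0"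
      from a2[OF this] b2[OF this] show "ewl n E x z w k (ewr n E x y z k u v) t = ewr n E x y w k u (ewl n E y z w k v t)"
        unfolding eq by (rule trans[OF sym])
    next
      fix k u v t assume "k \<le> n" "u \<in> cells C 0" "v \<in> cells D 0" "t \<in> cells B k"
      from a3[OF this] b3[OF this] show "ewr n E x z w k (ewl n E x y z 0 u v) t = ewr n E x y w k u (ewr n E y z w k v t)"
        unfolding eq by (rule trans[OF sym])
    qed
  next
    assume r: ?r
    show "?a = ?b"
    proof (rule ftens3_ext[OF C D B xw a b])
      fix k u v t assume *: "k \<le> n" "u \<in> cells C k" "v \<in> cells D 0" "t \<in> cells B 0"
      show "?a k (fl ?P B k (fl C D k u v) t) = ?b k (fl ?P B k (fl C D k u v) t)"
        unfolding a1[OF *] b1[OF *] using r * by blast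
    next
      fix k u v t assume *: "k \<le> n" "u \<in> cells C 0" "v \<in> cells D k" "t \<in> cells B 0"
      show "?a k (fl ?P B k (fr C D k u v) t) = ?b k (fl ?P B k (fr C D k u v) t)"
        unfolding a2[OF *] b2[OF *] using r * by blast
    next
      fix k u v t assume *: "k \<le> n" "u \<in> cells C 0" "v \<in> cells D 0" "t \<in> cells B k"
      show "?a k (fr ?P B k (fl C D 0 u v) t) = ?b k (fr ?P B k (fl C D 0 u v) t)"
        unfolding a3[OF *] b3[OF *] using r * by blast
    qed
  qed
qed

lemma eid_left_iff:
  assumes x: "x \<in> eobj E" and y: "y \<in> eobj E"
  shows "pcomp n (ftens n pterminal (ehom E x y)) (ecomp E x x y)
         (ftens_map n pterminal (ehom E x x) (ehom E x y) (ehom E x y) (eid E x) (pid n (ehom E x y)))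
       = flunit n (ehom E x y)
     \<longleftrightarrow> (\<forall>k\<le>n. \<forall>u \<in> cells (ehom E x y) k. ewr n E x x y k (eunit E x) u = u)" (is "?a = ?b \<longleftrightarrow> ?r")
proof -
  let ?C = "ehom E x y"
  have C: "precategory n ?C" and xx: "precategory n (ehom E x x)" using hom x y by auto
  note I = precategory_pterminal[of n]
  note m = ftens_map_props[OF I C xx C eid[OF x] prefunctor_pid[OF C]]
  note L = precategory_ftens[OF I C]
  note fu = flunit_props[OF C]
  have a: "prefunctor n (ftens n pterminal ?C) ?C ?a"
    by (rule prefunctor_pcomp[OF L m(1) ecomp[OF x x y]])
  have ar: "?a k (fr pterminal ?C k undefined u) = ewr n E x x y k (eunit E x) u"
    and br: "?b k (fr pterminal ?C k undefined u) = u"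
    if *: "k \<le> n" "u \<in> cells ?C k" for k u
    using agreesD(2)[OF m(2) *(1) _ *(2), of undefined] agreesD(2)[OF fu(2) *(1) _ *(2), of undefined]
      fr_cells[OF I C *(1) _ *(2), of undefined] * by (simp_all add: ewr_def eunit_def)
  \<comment> \<open>On this leg both sides are iterated identities of their values in dimension 0,
    where \<open>ewl\<close> and \<open>ewr\<close> coincide. Hence the case \<open>k = 0\<close> of
    the condition on the other leg settles it.\<close>
  have al: "?a k (fl pterminal ?C k undefined d) = idn_iter ?C k (ewr n E x x y 0 (eunit E x) d)"
    and bl: "?b k (fl pterminal ?C k undefined d) = idn_iter ?C k d"
    if *: "k \<le> n" "d \<in> cells ?C 0" for k d
  proof -
    have "?a k (fl pterminal ?C k undefined d) = ewl n E x x y k (idn_iter (ehom E x x) k (eunit E x)) d"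
      using agreesD(1)[OF m(2) *(1) _ *(2), of undefined] fl_cells[OF I C *(1) _ *(2), of undefined] *
      by (simp add: ewl_def eid_eq[OF x])
    also have "\<dots> = idn_iter ?C k (ewl n E x x y 0 (eunit E x) d)"
      by (rule premor.premor_idn_iter[OF premor_ewl[OF x x y *(2)] xx *(1) eunit_cells[OF x]])
    finally show "?a k (fl pterminal ?C k undefined d) = idn_iter ?C k (ewr n E x x y 0 (eunit E x) d)"
      using ewl_ewr[OF x x y eunit_cells[OF x] *(2)] by simp
    show "?b k (fl pterminal ?C k undefined d) = idn_iter ?C k d"
      using agreesD(1)[OF fu(2) *(1) _ *(2), of undefined] by simp
  qed
  show ?thesis
  proof
    assume eq: "?a = ?b"
    show ?r
    proof (intro allI impI ballI)
      fix k u assume "k \<le> n" "u \<in> cells ?C k"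
      from ar[OF this] br[OF this] show "ewr n E x x y k (eunit E x) u = u"
        unfolding eq by (rule trans[OF sym])
    qed
  next
    assume r: ?r
    show "?a = ?b"
    proof (rule ftens_ext[OF I C C a fu(1)])
      fix k c v assume *: "k \<le> n" "c \<in> cells (pterminal :: 'a precat) 0" "v \<in> cells ?C k"
      then show "?a k (fr pterminal ?C k c v) = ?b k (fr pterminal ?C k c v)"
        using ar[OF *(1,3)] br[OF *(1,3)] r by simp
    next
      fix k u d assume *: "k \<le> n" "u \<in> cells (pterminal :: 'a precat) k" "d \<in> cells ?C 0"
      then show "?a k (fl pterminal ?C k u d) = ?b k (fl pterminal ?C k u d)"
        using al[OF *(1,3)] bl[OF *(1,3)] r by simp
    qed
  qed
qed

lemma eid_right_iff:
  assumes x: "x \<in> eobj E" and y: "y \<in> eobj E"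
  shows "pcomp n (ftens n (ehom E x y) pterminal) (ecomp E x y y)
         (ftens_map n (ehom E x y) (ehom E x y) pterminal (ehom E y y) (pid n (ehom E x y)) (eid E y))
       = frunit n (ehom E x y)
     \<longleftrightarrow> (\<forall>k\<le>n. \<forall>u \<in> cells (ehom E x y) k. ewl n E x y y k u (eunit E y) = u)" (is "?a = ?b \<longleftrightarrow> ?r")
proof -
  let ?C = "ehom E x y"
  have C: "precategory n ?C" and yy: "precategory n (ehom E y y)" using hom x y by auto
  note I = precategory_pterminal[of n]
  note m = ftens_map_props[OF C I C yy prefunctor_pid[OF C] eid[OF y]]
  note L = precategory_ftens[OF C I]
  note fu = frunit_props[OF C]
  have a: "prefunctor n (ftens n ?C pterminal) ?C ?a"
    by (rule prefunctor_pcomp[OF L m(1) ecomp[OF x y y]])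
  have al: "?a k (fl ?C pterminal k u undefined) = ewl n E x y y k u (eunit E y)"
    and bl: "?b k (fl ?C pterminal k u undefined) = u"
    if *: "k \<le> n" "u \<in> cells ?C k" for k u
    using agreesD(1)[OF m(2) *(1) *(2), of undefined] agreesD(1)[OF fu(2) *(1) *(2), of undefined]
      fl_cells[OF C I *(1) *(2), of undefined] * by (simp_all add: ewl_def eunit_def)
  have ar: "?a k (fr ?C pterminal k d undefined) = idn_iter ?C k (ewl n E x y y 0 d (eunit E y))"
    and br: "?b k (fr ?C pterminal k d undefined) = idn_iter ?C k d"
    if *: "k \<le> n" "d \<in> cells ?C 0" for k d
  proof -
    have "?a k (fr ?C pterminal k d undefined) = ewr n E x y y k d (idn_iter (ehom E y y) k (eunit E y))"
      using agreesD(2)[OF m(2) *(1) *(2), of undefined] fr_cells[OF C I *(1) *(2), of undefined] *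
      by (simp add: ewr_def eid_eq[OF y])
    also have "\<dots> = idn_iter ?C k (ewr n E x y y 0 d (eunit E y))"
      by (rule premor.premor_idn_iter[OF premor_ewr[OF x y y *(2)] yy *(1) eunit_cells[OF y]])
    finally show "?a k (fr ?C pterminal k d undefined) = idn_iter ?C k (ewl n E x y y 0 d (eunit E y))"
      using ewl_ewr[OF x y y *(2) eunit_cells[OF y]] by simp
    show "?b k (fr ?C pterminal k d undefined) = idn_iter ?C k d"
      using agreesD(2)[OF fu(2) *(1) *(2), of undefined] by simp
  qed
  show ?thesis
  proof
    assume eq: "?a = ?b"
    show ?r
    proof (intro allI impI ballI)
      fix k u assume "k \<le> n" "u \<in> cells ?C k"
      from al[OF this] bl[OF this] show "ewl n E x y y k u (eunit E y) = u"
        unfolding eq by (rule trans[OF sym])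
    qed
  next
    assume r: ?r
    show "?a = ?b"
    proof (rule ftens_ext[OF C I C a fu(1)])
      fix k c v assume *: "k \<le> n" "c \<in> cells ?C 0" "v \<in> cells (pterminal :: 'a precat) k"
      then show "?a k (fr ?C pterminal k c v) = ?b k (fr ?C pterminal k c v)"
        using ar[OF *(1,2)] br[OF *(1,2)] r by simp
    next
      fix k u d assume *: "k \<le> n" "u \<in> cells ?C k" "d \<in> cells (pterminal :: 'a precat) 0"
      then show "?a k (fl ?C pterminal k u d) = ?b k (fl ?C pterminal k u d)"
        using al[OF *(1,2)] bl[OF *(1,2)] r by simp
    qed
  qed
qed

lemma enriched_category_iff_whiskered:
  "enriched_category (FunnyPCat n) E \<longleftrightarrow> whiskered n (eobj E) (ehom E) (eunit E) (ewl n E) (ewr n E)"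
proof
  assume "enriched_category (FunnyPCat n) E"
  then interpret En: enriched_category "FunnyPCat n" E .
  note assoc = iffD1[OF ecomp_assoc_iff En.ecomp_assoc[unfolded FunnyPCat_simps]]
  show "whiskered n (eobj E) (ehom E) (eunit E) (ewl n E) (ewr n E)"
  proof (rule whiskered.intro, goal_cases)
    case (6 x y z w k u v t)
    from assoc[OF 6(1-4) 6(1-4)] 6(5-8) show ?case by simp
  next
    case (7 x y z w k u v t)
    from assoc[OF 7(1-4) 7(1-4)] 7(5-8) show ?case by simp
  next
    case (8 x y z w k u v t)
    from assoc[OF 8(1-4) 8(1-4)] 8(5-8) show ?case by simp
  next
    case (9 x y k u)
    from iffD1[OF eid_left_iff[OF 9(1,2)] En.eid_left[OF 9(1,2), unfolded FunnyPCat_simps]] 9(3,4) show ?case by simp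
  next
    case (10 x y k u)
    from iffD1[OF eid_right_iff[OF 10(1,2)] En.eid_right[OF 10(1,2), unfolded FunnyPCat_simps]] 10(3,4) show ?case by simp
  qed (simp_all add: hom eunit_cells premor_ewl premor_ewr ewl_ewr)
next
  assume "whiskered n (eobj E) (ehom E) (eunit E) (ewl n E) (ewr n E)"
  then interpret W: whiskered n "eobj E" "ehom E" "eunit E" "ewl n E" "ewr n E" .
  show "enriched_category (FunnyPCat n) E"
  proof (rule enriched_category.intro, unfold FunnyPCat_simps, goal_cases)
    case (4 x y z w)
    show ?case unfolding ecomp_assoc_iff[OF 4]
      by (intro allI impI conjI ballI W.wl_wl W.wl_wr_assoc W.wr_wr 4; assumption)
  next
    case (5 x y)
    show ?case unfolding eid_left_iff[OF 5] by (simp add: W.unit_left 5)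
  next
    case (6 x y)
    show ?case unfolding eid_right_iff[OF 6] by (simp add: W.unit_right 6)
  qed (simp_all add: hom eid ecomp)
qed

end

section \<open>Enriched functors by elements, and their category\<close>

lemma (in funny_tensor) pre_enriched_if_enriched:
  fixes E :: "('a, 'a precat, 'a pmap) ecat"
  assumes "enriched_category (FunnyPCat n) E" shows "pre_enriched n E"
proof -
  interpret enriched_category "FunnyPCat n" E by (rule assms)
  show ?thesis
    by (intro pre_enriched.intro funny_tensor_axioms pre_enriched_axioms.intro)
      (use ehom eid ecomp in simp_all)
qed

text \<open>The counterpart of \<open>enriched_functor\<close> on generators of the tensor product.
  The normalisation conditions are retained, so that functors can still be compared by their
  values.\<close>

locale whiskered_functor =
  fixes n :: nat and E E' :: "('a, 'a precat, 'a pmap) ecat" and F :: "('a, 'a pmap) efun"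
  assumes obj: "x \<in> eobj E \<Longrightarrow> efobj F x \<in> eobj E'"
    and mor: "\<lbrakk>x \<in> eobj E; y \<in> eobj E\<rbrakk>
      \<Longrightarrow> prefunctor n (ehom E x y) (ehom E' (efobj F x) (efobj F y)) (efmap F x y)"
    and unit: "x \<in> eobj E \<Longrightarrow> efmap F x x 0 (eunit E x) = eunit E' (efobj F x)"
    and wl: "\<lbrakk>x \<in> eobj E; y \<in> eobj E; z \<in> eobj E; k \<le> n; u \<in> cells (ehom E x y) k; v \<in> cells (ehom E y z) 0\<rbrakk>
      \<Longrightarrow> efmap F x z k (ewl n E x y z k u v)
        = ewl n E' (efobj F x) (efobj F y) (efobj F z) k (efmap F x y k u) (efmap F y z 0 v)"
    and wr: "\<lbrakk>x \<in> eobj E; y \<in> eobj E; z \<in> eobj E; k \<le> n; u \<in> cells (ehom E x y) 0; v \<in> cells (ehom E y z) k\<rbrakk>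
      \<Longrightarrow> efmap F x z k (ewr n E x y z k u v)
        = ewr n E' (efobj F x) (efobj F y) (efobj F z) k (efmap F x y 0 u) (efmap F y z k v)"
    and obj_undefined: "x \<notin> eobj E \<Longrightarrow> efobj F x = undefined"
    and mor_undefined: "\<not> (x \<in> eobj E \<and> y \<in> eobj E) \<Longrightarrow> efmap F x y = undefined"

context funny_tensor begin

lemma enriched_functor_iff_whiskered:
  fixes E E' :: "('a, 'a precat, 'a pmap) ecat"
  assumes E: "pre_enriched n E" and E': "pre_enriched n E'"
  shows "enriched_functor (FunnyPCat n) E E' F \<longleftrightarrow> whiskered_functor n E E' F"
proof -
  interpret E: pre_enriched T n E by (rule E)
  interpret E': pre_enriched T n E' by (rule E')
  \<comment> \<open>Morphisms out of the terminal precategory are compared in dimension 0, since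
    morphisms preserve iterated identities.\<close>
  have unit_iff: "pcomp n pterminal (efmap F x x) (eid E x) = eid E' (efobj F x)
      \<longleftrightarrow> efmap F x x 0 (eunit E x) = eunit E' (efobj F x)" (is "?a = ?b \<longleftrightarrow> ?r")
    if x: "x \<in> eobj E" and Fx: "efobj F x \<in> eobj E'"
      and m: "prefunctor n (ehom E x x) (ehom E' (efobj F x) (efobj F x)) (efmap F x x)" for x
  proof
    assume eq: "?a = ?b"
    have "?a 0 undefined = efmap F x x 0 (eunit E x)" by (simp add: eunit_def)
    then show ?r unfolding eq by (simp add: eunit_def)
  next
    assume r: ?r
    show "?a = ?b"
    proof (rule prefunctor_eqI[OF prefunctor_pcomp[OF precategory_pterminal E.eid[OF x] m] E'.eid[OF Fx]])
      fix k u assume k: "k \<le> n" and "u \<in> cells (pterminal :: 'a precat) k"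
      then have u: "u = undefined" by simp
      have "?a k u = efmap F x x k (idn_iter (ehom E x x) k (eunit E x))"
        using k u by (simp add: E.eid_eq[OF x])
      also have "\<dots> = idn_iter (ehom E' (efobj F x) (efobj F x)) k (eunit E' (efobj F x))"
        unfolding r[symmetric]
        by (rule premor.premor_idn_iter[OF prefunctor_premor[OF m] E.hom[OF x x] k E.eunit_cells[OF x]])
      also have "\<dots> = ?b k u" using k u by (simp add: E'.eid_eq[OF Fx])
      finally show "?a k u = ?b k u" .
    qed
  qed
  have comp_iff: "pcomp n (ftens n (ehom E x y) (ehom E y z)) (efmap F x z) (ecomp E x y z)
      = pcomp n (ftens n (ehom E x y) (ehom E y z)) (ecomp E' (efobj F x) (efobj F y) (efobj F z))
          (ftens_map n (ehom E x y) (ehom E' (efobj F x) (efobj F y)) (ehom E y z) (ehom E' (efobj F y) (efobj F z))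
            (efmap F x y) (efmap F y z))
     \<longleftrightarrow> (\<forall>k\<le>n. (\<forall>u \<in> cells (ehom E x y) k. \<forall>v \<in> cells (ehom E y z) 0. efmap F x z k (ewl n E x y z k u v)
        = ewl n E' (efobj F x) (efobj F y) (efobj F z) k (efmap F x y k u) (efmap F y z 0 v)) \<and>
       (\<forall>u \<in> cells (ehom E x y) 0. \<forall>v \<in> cells (ehom E y z) k. efmap F x z k (ewr n E x y z k u v)
        = ewr n E' (efobj F x) (efobj F y) (efobj F z) k (efmap F x y 0 u) (efmap F y z k v)))"
    (is "?a = ?b \<longleftrightarrow> ?r")
    if x: "x \<in> eobj E" and y: "y \<in> eobj E" and z: "z \<in> eobj E"
      and o: "\<And>x. x \<in> eobj E \<Longrightarrow> efobj F x \<in> eobj E'"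
      and m: "\<And>x y. \<lbrakk>x \<in> eobj E; y \<in> eobj E\<rbrakk>
        \<Longrightarrow> prefunctor n (ehom E x y) (ehom E' (efobj F x) (efobj F y)) (efmap F x y)" for x y z
  proof -
    let ?C = "ehom E x y" and ?D = "ehom E y z"
    have C: "precategory n ?C" and D: "precategory n ?D" and C': "precategory n (ehom E' (efobj F x) (efobj F y))"
      and D': "precategory n (ehom E' (efobj F y) (efobj F z))"
      and Z: "precategory n (ehom E' (efobj F x) (efobj F z))"
      using x y z o E.hom E'.hom by auto
    note P = precategory_ftens[OF C D]
    note mm = ftens_map_props[OF C D C' D' m[OF x y] m[OF y z]]
    have a: "prefunctor n (ftens n ?C ?D) (ehom E' (efobj F x) (efobj F z)) ?a"
      by (rule prefunctor_pcomp[OF P E.ecomp[OF x y z] m[OF x z]])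
    have b: "prefunctor n (ftens n ?C ?D) (ehom E' (efobj F x) (efobj F z)) ?b"
      by (rule prefunctor_pcomp[OF P mm(1) E'.ecomp[OF o o o, OF x y z]])
    have al: "?a k (fl ?C ?D k u v) = efmap F x z k (ewl n E x y z k u v)"
      and bl: "?b k (fl ?C ?D k u v) = ewl n E' (efobj F x) (efobj F y) (efobj F z) k (efmap F x y k u) (efmap F y z 0 v)"
      if *: "k \<le> n" "u \<in> cells ?C k" "v \<in> cells ?D 0" for k u v
      using fl_cells[OF C D *] *(1) agreesD(1)[OF mm(2) *] by (simp_all add: ewl_def)
    have ar: "?a k (fr ?C ?D k u v) = efmap F x z k (ewr n E x y z k u v)"
      and br: "?b k (fr ?C ?D k u v) = ewr n E' (efobj F x) (efobj F y) (efobj F z) k (efmap F x y 0 u) (efmap F y z k v)"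
      if *: "k \<le> n" "u \<in> cells ?C 0" "v \<in> cells ?D k" for k u v
      using fr_cells[OF C D *] *(1) agreesD(2)[OF mm(2) *] by (simp_all add: ewr_def)
    show ?thesis
    proof
      assume eq: "?a = ?b"
      show ?r
      proof (intro allI impI conjI ballI)
        fix k u v assume "k \<le> n" "u \<in> cells ?C k" "v \<in> cells ?D 0"
        from al[OF this] bl[OF this] show "efmap F x z k (ewl n E x y z k u v)
          = ewl n E' (efobj F x) (efobj F y) (efobj F z) k (efmap F x y k u) (efmap F y z 0 v)"
          unfolding eq by (rule trans[OF sym])
      next
        fix k u v assume "k \<le> n" "u \<in> cells ?C 0" "v \<in> cells ?D k"
        from ar[OF this] br[OF this] show "efmap F x z k (ewr n E x y z k u v)
          = ewr n E' (efobj F x) (efobj F y) (efobj F z) k (efmap F x y 0 u) (efmap F y z k v)"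
          unfolding eq by (rule trans[OF sym])
      qed
    next
      assume r: ?r
      show "?a = ?b"
      proof (rule ftens_ext[OF C D Z a b])
        fix k u v assume *: "k \<le> n" "u \<in> cells ?C k" "v \<in> cells ?D 0"
        show "?a k (fl ?C ?D k u v) = ?b k (fl ?C ?D k u v)"
          unfolding al[OF *] bl[OF *] using r * by simp
      next
        fix k u v assume *: "k \<le> n" "u \<in> cells ?C 0" "v \<in> cells ?D k"
        show "?a k (fr ?C ?D k u v) = ?b k (fr ?C ?D k u v)"
          unfolding ar[OF *] br[OF *] using r * by simp
      qed
    qed
  qed
  show ?thesis
  proof
    assume "enriched_functor (FunnyPCat n) E E' F"
    then interpret F: enriched_functor "FunnyPCat n" E E' F .
    note o = F.efobj and m = F.efmap[unfolded FunnyPCat_simps]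
    show "whiskered_functor n E E' F"
    proof (rule whiskered_functor.intro, goal_cases)
      case (3 x)
      show ?case
        using iffD1[OF unit_iff[OF 3 o[OF 3] m[OF 3 3]] F.efmap_eid[OF 3, unfolded FunnyPCat_simps]] .
    next
      case (4 x y z k u v)
      from iffD1[OF comp_iff[OF 4(1-3) o m] F.efmap_ecomp[OF 4(1-3), unfolded FunnyPCat_simps]] 4(4-)
      show ?case by simp
    next
      case (5 x y z k u v)
      from iffD1[OF comp_iff[OF 5(1-3) o m] F.efmap_ecomp[OF 5(1-3), unfolded FunnyPCat_simps]] 5(4-)
      show ?case by simp
    qed (simp_all add: o m F.efobj_undefined F.efmap_undefined)
  next
    assume "whiskered_functor n E E' F"
    then interpret F: whiskered_functor n E E' F .
    show "enriched_functor (FunnyPCat n) E E' F"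
    proof (rule enriched_functor.intro, unfold FunnyPCat_simps, goal_cases)
      case (3 x)
      show ?case using iffD2[OF unit_iff[OF 3 F.obj[OF 3] F.mor[OF 3 3]] F.unit[OF 3]] .
    next
      case (4 x y z)
      show ?case by (rule iffD2[OF comp_iff[OF 4]]) (simp_all add: F.obj F.mor F.wl F.wr 4)
    qed (simp_all add: F.obj F.mor F.obj_undefined F.mor_undefined)
  qed
qed

lemma EnrCat_Obj: "E \<in> Obj (EnrCat \<V>) \<longleftrightarrow> enriched_category \<V> E"
  by (simp add: EnrCat_def)

lemma EnrCat_Hom: "F \<in> Hom (EnrCat \<V>) E E' \<longleftrightarrow> enriched_functor \<V> E E' F"
  by (simp add: EnrCat_def)

lemma EnrCat_Ide:
  fixes E :: "('a, 'a precat, 'a pmap) ecat"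
  shows "efobj (Ide (EnrCat (FunnyPCat n)) E) x = (if x \<in> eobj E then x else undefined)"
    "efmap (Ide (EnrCat (FunnyPCat n)) E) x y
      = (if x \<in> eobj E \<and> y \<in> eobj E then pid n (ehom E x y) else undefined)"
  by (simp_all add: EnrCat_def)

lemma EnrCat_Comp:
  fixes E E' E'' :: "('a, 'a precat, 'a pmap) ecat"
  shows "efobj (Comp (EnrCat (FunnyPCat n)) E E' E'' G F) x = (if x \<in> eobj E then efobj G (efobj F x) else undefined)"
    "efmap (Comp (EnrCat (FunnyPCat n)) E E' E'' G F) x y
      = (if x \<in> eobj E \<and> y \<in> eobj E
         then pcomp n (ehom E x y) (efmap G (efobj F x) (efobj F y)) (efmap F x y) else undefined)"
  by (simp_all add: EnrCat_def)

lemma efun_eqI: "(\<And>x. efobj F x = efobj G x) \<Longrightarrow> (\<And>x y. efmap F x y = efmap G x y) \<Longrightarrow> F = G"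
  for F G :: "('x, 'm) efun"
  by (cases F; cases G) (simp add: fun_eq_iff)

lemma enriched_functorE:
  fixes E E' :: "('a, 'a precat, 'a pmap) ecat"
  assumes "enriched_category (FunnyPCat n) E" "enriched_category (FunnyPCat n) E'"
  shows "enriched_functor (FunnyPCat n) E E' F \<longleftrightarrow> whiskered_functor n E E' F"
  using enriched_functor_iff_whiskered pre_enriched_if_enriched assms by blast

lemma category_EnrCat:
  "category (EnrCat (FunnyPCat n) :: (('a, 'a precat, 'a pmap) ecat, ('a, 'a pmap) efun) cat)"
proof (rule category.intro, unfold EnrCat_Obj EnrCat_Hom, goal_cases)
  case (1 E)
  interpret E: pre_enriched T n E using 1 by (rule pre_enriched_if_enriched)
  show ?case unfolding enriched_functorE[OF 1 1]
    by (rule whiskered_functor.intro)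
      (auto simp: EnrCat_Ide prefunctor_pid E.hom E.eunit_cells
        premor.map_cells[OF E.premor_ewl] premor.map_cells[OF E.premor_ewr])
next
  case (2 E E' E'' F G)
  interpret E: pre_enriched T n E using 2(1) by (rule pre_enriched_if_enriched)
  interpret F: whiskered_functor n E E' F using 2 enriched_functorE by blast
  interpret G: whiskered_functor n E' E'' G using 2 enriched_functorE by blast
  have Fc: "efmap F x y k u \<in> cells (ehom E' (efobj F x) (efobj F y)) k"
    if "x \<in> eobj E" "y \<in> eobj E" "k \<le> n" "u \<in> cells (ehom E x y) k" for x y k u
    using premor.map_cells[OF prefunctor_premor[OF F.mor]] that by blast
  show ?case unfolding enriched_functorE[OF 2(1,3)]
    by (rule whiskered_functor.intro)
      (auto simp: EnrCat_Comp F.obj G.obj prefunctor_pcomp[OF E.hom F.mor G.mor] E.eunit_cells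
        F.unit G.unit F.wl G.wl F.wr G.wr Fc
        premor.map_cells[OF E.premor_ewl] premor.map_cells[OF E.premor_ewr])
next
  case (3 E E' F)
  interpret E: pre_enriched T n E using 3(1) by (rule pre_enriched_if_enriched)
  interpret E': pre_enriched T n E' using 3(2) by (rule pre_enriched_if_enriched)
  interpret F: whiskered_functor n E E' F using 3 enriched_functorE by blast
  show ?case
  proof (rule efun_eqI, goal_cases)
    case (2 x y)
    show ?case
    proof (cases "x \<in> eobj E \<and> y \<in> eobj E")
      case True
      then have xy: "x \<in> eobj E" "y \<in> eobj E" by auto
      have "pcomp n (ehom E x y) (pid n (ehom E' (efobj F x) (efobj F y))) (efmap F x y) = efmap F x y"
        by (rule prefunctor_eqI[OF prefunctor_pcomp[OF E.hom F.mor prefunctor_pid[OF E'.hom]] F.mor])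
          (simp_all add: xy F.obj premor.map_cells[OF prefunctor_premor[OF F.mor]])
      then show ?thesis using xy by (simp add: EnrCat_Comp EnrCat_Ide F.obj)
    qed (auto simp: EnrCat_Comp F.mor_undefined)
  qed (simp add: EnrCat_Comp EnrCat_Ide F.obj F.obj_undefined)
next
  case (4 E E' F)
  interpret E: pre_enriched T n E using 4(1) by (rule pre_enriched_if_enriched)
  interpret F: whiskered_functor n E E' F using 4 enriched_functorE by blast
  show ?case
  proof (rule efun_eqI, goal_cases)
    case (2 x y)
    show ?case
    proof (cases "x \<in> eobj E \<and> y \<in> eobj E")
      case True
      then have xy: "x \<in> eobj E" "y \<in> eobj E" by auto
      have "pcomp n (ehom E x y) (efmap F x y) (pid n (ehom E x y)) = efmap F x y"
        by (rule prefunctor_eqI[OF prefunctor_pcomp[OF E.hom prefunctor_pid[OF E.hom] F.mor] F.mor])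
          (simp_all add: xy)
      then show ?thesis using xy by (simp add: EnrCat_Comp EnrCat_Ide)
    qed (auto simp: EnrCat_Comp F.mor_undefined)
  qed (simp add: EnrCat_Comp EnrCat_Ide F.obj_undefined)
next
  case (5 E E' E'' E''' F G H)
  interpret F: whiskered_functor n E E' F using 5 enriched_functorE by blast
  show ?case
  proof (rule efun_eqI, goal_cases)
    case (2 x y)
    show ?case
      by (auto simp: EnrCat_Comp F.obj premor.map_cells[OF prefunctor_premor[OF F.mor]] intro!: pcomp_eqI)
  qed (simp add: EnrCat_Comp F.obj)
qed

section \<open>Enriched categories built from whiskerings\<close>

definition mk_ecat :: "'a set \<Rightarrow> ('a \<Rightarrow> 'a \<Rightarrow> 'a precat) \<Rightarrow> ('a \<Rightarrow> 'a) \<Rightarrow>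
    ('a \<Rightarrow> 'a \<Rightarrow> 'a \<Rightarrow> nat \<Rightarrow> 'a \<Rightarrow> 'a \<Rightarrow> 'a) \<Rightarrow> ('a \<Rightarrow> 'a \<Rightarrow> 'a \<Rightarrow> nat \<Rightarrow> 'a \<Rightarrow> 'a \<Rightarrow> 'a) \<Rightarrow>
    ('a, 'a precat, 'a pmap) ecat" where
  "mk_ecat X H \<epsilon> wl wr = \<lparr>eobj = X, ehom = H,
     eid = (\<lambda>x. prestrict n pterminal (\<lambda>k u. idn_iter (H x x) k (\<epsilon> x))),
     ecomp = (\<lambda>x y z. THE h. prefunctor n (ftens n (H x y) (H y z)) (H x z) h \<and>
       agrees (H x y) (H y z) h (wl x y z) (wr x y z))\<rparr>"

lemma mk_ecat_simps [simp]: "eobj (mk_ecat X H \<epsilon> wl wr) = X" "ehom (mk_ecat X H \<epsilon> wl wr) = H"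
  "eunit (mk_ecat X H \<epsilon> wl wr) x = \<epsilon> x"
  by (simp_all add: mk_ecat_def eunit_def)

context
  fixes X :: "'a set" and H \<epsilon> wl wr
  assumes W: "whiskered n X H \<epsilon> wl wr"
begin

interpretation W: whiskered n X H \<epsilon> wl wr by (rule W)

text \<open>The two whiskerings form a \<open>bimor\<close>, from which the universal property
  recovers the composition morphism. This inverts the passage from \<open>ecomp\<close> to
  \<open>ewl\<close> and \<open>ewr\<close>.\<close>

lemma mk_ecat_ecomp:
  assumes "x \<in> X" "y \<in> X" "z \<in> X"
  shows "prefunctor n (ftens n (H x y) (H y z)) (H x z) (ecomp (mk_ecat X H \<epsilon> wl wr) x y z)"
    "agrees (H x y) (H y z) (ecomp (mk_ecat X H \<epsilon> wl wr) x y z) (wl x y z) (wr x y z)"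
proof -
  have "bimor (H x y) (H y z) (H x z) (wl x y z) (wr x y z)"
    unfolding bimor_def using assms W.wl W.wr W.wl_wr by blast
  from theI'[OF ftens_universal[OF W.hom W.hom W.hom this]] assms
  show "prefunctor n (ftens n (H x y) (H y z)) (H x z) (ecomp (mk_ecat X H \<epsilon> wl wr) x y z)"
    "agrees (H x y) (H y z) (ecomp (mk_ecat X H \<epsilon> wl wr) x y z) (wl x y z) (wr x y z)"
    by (simp_all add: mk_ecat_def)
qed

lemma ewl_mk_ecat:
  "\<lbrakk>x \<in> X; y \<in> X; z \<in> X; k \<le> n; u \<in> cells (H x y) k; v \<in> cells (H y z) 0\<rbrakk>
   \<Longrightarrow> ewl n (mk_ecat X H \<epsilon> wl wr) x y z k u v = wl x y z k u v"
  unfolding ewl_def mk_ecat_simps by (rule agreesD(1)[OF mk_ecat_ecomp(2)])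

lemma ewr_mk_ecat:
  "\<lbrakk>x \<in> X; y \<in> X; z \<in> X; k \<le> n; u \<in> cells (H x y) 0; v \<in> cells (H y z) k\<rbrakk>
   \<Longrightarrow> ewr n (mk_ecat X H \<epsilon> wl wr) x y z k u v = wr x y z k u v"
  unfolding ewr_def mk_ecat_simps by (rule agreesD(2)[OF mk_ecat_ecomp(2)])

lemma pre_enriched_mk_ecat: "pre_enriched n (mk_ecat X H \<epsilon> wl wr)"
proof (intro pre_enriched.intro funny_tensor_axioms pre_enriched_axioms.intro, goal_cases)
  case (2 x)
  then show ?case
    using prefunctor_prestrict[OF precategory_pterminal premor_pterminal[OF W.hom W.unit_cells]]
    by (simp add: mk_ecat_def)
qed (simp_all add: W.hom mk_ecat_ecomp)

lemma enriched_mk_ecat: "enriched_category (FunnyPCat n) (mk_ecat X H \<epsilon> wl wr)"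
proof -
  let ?E = "mk_ecat X H \<epsilon> wl wr"
  interpret E: pre_enriched T n ?E by (rule pre_enriched_mk_ecat)
  note c = premor.map_cells[OF W.wl] premor.map_cells[OF W.wr]
  show ?thesis unfolding E.enriched_category_iff_whiskered mk_ecat_simps
  proof (rule whiskered.intro, goal_cases)
    case (3 x y z v) then show ?case using E.premor_ewl by simp
  next
    case (4 x y z v) then show ?case using E.premor_ewr by simp
  next
    case (6 x y z w k u v t) then show ?case using W.wl_wl[OF 6] by (simp add: ewl_mk_ecat c)
  next
    case (7 x y z w k u v t) then show ?case using W.wl_wr_assoc[OF 7] by (simp add: ewl_mk_ecat ewr_mk_ecat c)
  next
    case (8 x y z w k u v t) then show ?case using W.wr_wr[OF 8] by (simp add: ewl_mk_ecat ewr_mk_ecat c)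
  qed (simp_all add: W.hom W.unit_cells ewl_mk_ecat ewr_mk_ecat W.wl_wr W.unit_left W.unit_right)
qed

end

end

section \<open>The enriched category of a precategory\<close>

definition phom :: "'a precat \<Rightarrow> 'a \<Rightarrow> 'a \<Rightarrow> 'a precat" where
  "phom C x y =
     \<lparr>cells = (\<lambda>k. {u \<in> cells C (Suc k). bdto C Src 0 (Suc k) u = x \<and> bdto C Tgt 0 (Suc k) u = y}),
      bd = (\<lambda>e i. bd C e (Suc i)), idn = (\<lambda>k. idn C (Suc k)), cmp = (\<lambda>k l. cmp C (Suc k) (Suc l))\<rparr>"

lemma cells_phom: "u \<in> cells (phom C x y) k \<longleftrightarrow>
    u \<in> cells C (Suc k) \<and> bdto C Src 0 (Suc k) u = x \<and> bdto C Tgt 0 (Suc k) u = y"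
  by (simp add: phom_def)

lemma phom_ops [simp]: "bd (phom C x y) e i = bd C e (Suc i)" "idn (phom C x y) k = idn C (Suc k)"
  "cmp (phom C x y) k l = cmp C (Suc k) (Suc l)"
  by (simp_all add: phom_def)

lemma bdto_phom [simp]: "bdto (phom C x y) e i k u = bdto C e (Suc i) (Suc k) u"
  by (induction k arbitrary: u) (auto simp: bdto.simps(2))

text \<open>With truncated subtraction, \<open>min (Suc k) (Suc l) - 1\<close> equals
  \<open>Suc (min k l - 1)\<close> only for positive \<open>k\<close> and \<open>l\<close>. If one
  of them is 0, composition in \<open>C\<close> is along 0-cells and is a whiskering between homs
  instead.\<close>

lemma comp_defined_phom:
  "comp_defined n (phom C x y) i k l u v \<longleftrightarrow>
     comp_defined (Suc n) C (Suc i) (Suc k) (Suc l) u v \<and> 0 < k \<and> 0 < l \<and>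
     u \<in> cells (phom C x y) k \<and> v \<in> cells (phom C x y) l"
  by (auto simp: comp_defined_def i_composable_def cells_phom)

lemma i_composable_phom:
  "i_composable (phom C x y) i k l u v \<Longrightarrow> i_composable C (Suc i) (Suc k) (Suc l) u v"
  by (auto simp: i_composable_def cells_phom)

locale precategory_Suc = precategory "Suc n" C for n and C :: "'a precat"
begin

lemma phom_bd: "\<lbrakk>i < n; u \<in> cells (phom C x y) (Suc i)\<rbrakk> \<Longrightarrow> bd C e (Suc i) u \<in> cells (phom C x y) i"
  by (auto simp: cells_phom bd_cells bdto_bd)

lemma phom_idn: "\<lbrakk>k < n; u \<in> cells (phom C x y) k\<rbrakk> \<Longrightarrow> idn C (Suc k) u \<in> cells (phom C x y) (Suc k)"
  by (auto simp: cells_phom idn_cells bdto_idn)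

lemma phom_cmp: "comp_defined n (phom C x y) i k l u v \<Longrightarrow> cmp C (Suc k) (Suc l) u v \<in> cells (phom C x y) (max k l)"
  using cmp_cells[of "Suc i" "Suc k" "Suc l" u v] bdto_cmp[of "Suc i" "Suc k" "Suc l" u v]
  by (auto simp: comp_defined_phom cells_phom)

lemma phom_self: "u \<in> cells C (Suc k) \<Longrightarrow> u \<in> cells (phom C (bdto C Src 0 (Suc k) u) (bdto C Tgt 0 (Suc k) u)) k"
  by (simp add: cells_phom)

lemma phom_src: "k \<le> n \<Longrightarrow> u \<in> cells C (Suc k) \<Longrightarrow> bdto C e 0 (Suc k) u \<in> cells C 0"
  by (rule bdto_cells) simp_all

lemma comp_defined_wl:
  "\<lbrakk>k \<le> n; u \<in> cells (phom C x y) k; v \<in> cells (phom C y z) 0\<rbrakk> \<Longrightarrow> comp_defined (Suc n) C 0 (Suc k) 1 u v"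
  by (auto simp: comp_defined_def i_composable_def cells_phom)

lemma comp_defined_wr:
  "\<lbrakk>k \<le> n; u \<in> cells (phom C x y) 0; v \<in> cells (phom C y z) k\<rbrakk> \<Longrightarrow> comp_defined (Suc n) C 0 1 (Suc k) u v"
  by (auto simp: comp_defined_def i_composable_def cells_phom)

lemma wl_cells:
  "\<lbrakk>k \<le> n; u \<in> cells (phom C x y) k; v \<in> cells (phom C y z) 0\<rbrakk> \<Longrightarrow> cmp C (Suc k) 1 u v \<in> cells (phom C x z) k"
  using cmp_cells[OF comp_defined_wl[of k u x y v z]] bdto_cmp[OF comp_defined_wl[of k u x y v z]]
  by (simp add: cells_phom)

lemma wr_cells:
  "\<lbrakk>k \<le> n; u \<in> cells (phom C x y) 0; v \<in> cells (phom C y z) k\<rbrakk> \<Longrightarrow> cmp C 1 (Suc k) u v \<in> cells (phom C x z) k"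
  using cmp_cells[OF comp_defined_wr[of k u x y v z]] bdto_cmp[OF comp_defined_wr[of k u x y v z]]
  by (simp add: cells_phom)

text \<open>Each axiom is the same axiom of \<open>C\<close> one dimension higher.\<close>

lemma precategory_phom: "precategory n (phom C x y)"
proof (rule precategory.intro, unfold phom_ops, goal_cases)
  case (1 i u e) then show ?case by (rule phom_bd)
next
  case (2 i u e) then show ?case using globular by (simp add: cells_phom)
next
  case (3 k u) then show ?case by (rule phom_idn)
next
  case (4 i k l u v) then show ?case by (rule phom_cmp)
next
  case (5 k u e) then show ?case using bd_idn by (simp add: cells_phom)
next
  case (6 i k l u v e)
  then show ?case using bd_cmp_less[of "Suc i" "Suc k" "Suc l" u v e] by (simp add: comp_defined_phom)
next
  case (7 i k l u v e)
  then show ?case using bd_cmp_greater[of "Suc i" "Suc k" "Suc l" u v e] by (simp add: comp_defined_phom)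
next
  case (8 i k u v)
  then show ?case using src_cmp_eq[of "Suc i" "Suc k" u v] by (simp add: comp_defined_phom)
next
  case (9 i k u v)
  then show ?case using tgt_cmp_eq[of "Suc i" "Suc k" u v] by (simp add: comp_defined_phom)
next
  case (10 u k i l v)
  then show ?case using idn_cmp_le[of u "Suc k" "Suc i" "Suc l" v] by (simp add: comp_defined_phom cells_phom)
next
  case (11 u k i l v)
  then show ?case using idn_cmp_greater[of u "Suc k" "Suc i" "Suc l" v] by (simp add: comp_defined_phom cells_phom)
next
  case (12 u k i l v)
  then show ?case using cmp_idn_le[of u "Suc k" "Suc i" "Suc l" v] by (simp add: comp_defined_phom cells_phom)
next
  case (13 u k i l v)
  then show ?case using cmp_idn_greater[of u "Suc k" "Suc i" "Suc l" v] by (simp add: comp_defined_phom cells_phom)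
next
  case (14 i k l u v m w)
  then show ?case using cmp_assoc[of "Suc i" "Suc k" "Suc l" u v "Suc m" w] by (simp add: comp_defined_phom)
next
  case (15 i j u k l v v')
  then show ?case using cmp_distrib_left[of "Suc i" "Suc j" u "Suc k" "Suc l" v v'] i_composable_phom[of C x y i "Suc i" k u v]
    by (simp add: comp_defined_phom cells_phom)
next
  case (16 i j u k l v v')
  then show ?case using cmp_distrib_right[of "Suc i" "Suc j" u "Suc k" "Suc l" v v'] i_composable_phom[of C x y i k "Suc i" v u]
    by (simp add: comp_defined_phom cells_phom)
qed

text \<open>That whiskering is a morphism combines the axioms on boundaries and identities of
  composites of unequal dimension with distributivity over composition in positive dimension. The
  three associativity laws are \<open>cmp_assoc\<close> along 0-cells with two of the three factors
  1-cells.\<close>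

lemma whiskered_phom:
  "whiskered n (cells C 0) (phom C) (idn C 0) (\<lambda>x y z k u v. cmp C (Suc k) 1 u v) (\<lambda>x y z k u v. cmp C 1 (Suc k) u v)"
proof (rule whiskered.intro, goal_cases)
  case (1 x y) show ?case by (rule precategory_phom)
next
  case (2 x) then show ?case by (simp add: cells_phom idn_cells bdto_Suc bd_idn)
next
  case (3 x y z v)
  note v = 3(4)
  show ?case
  proof (rule premor.intro, unfold phom_ops, goal_cases)
    case (1 k u) then show ?case using v wl_cells by blast
  next
    case (2 i u e)
    then have "comp_defined (Suc n) C 0 (Suc (Suc i)) 1 u v" using v by (intro comp_defined_wl) simp_all
    from bd_cmp_greater[OF this, of e] show ?case by simp
  next
    case (3 k u) note k = this
    have "comp_defined (Suc n) C 0 (Suc (Suc k)) 1 (idn C (Suc k) u) v"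
      using v k phom_idn by (intro comp_defined_wl) simp_all
    then show ?case using idn_cmp_greater[of u "Suc k" 0 1 v] k by (simp add: cells_phom)
  next
    case (4 i k l u u') note d = this
    have "i_composable C 0 (Suc k) (Suc 0) u v"
      using d v by (auto simp: comp_defined_phom cells_phom i_composable_def)
    then show ?case using cmp_distrib_right[of 0 "Suc i" v "Suc k" "Suc l" u u'] d v
      by (simp add: comp_defined_phom cells_phom)
  qed
next
  case (4 x y z u)
  note u = 4(4)
  show ?case
  proof (rule premor.intro, unfold phom_ops, goal_cases)
    case (1 k v) then show ?case using u wr_cells by blast
  next
    case (2 i v e)
    then have "comp_defined (Suc n) C 0 1 (Suc (Suc i)) u v" using u by (intro comp_defined_wr) simp_all
    from bd_cmp_less[OF this, of e] show ?case by simp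
  next
    case (3 k v) note k = this
    have "comp_defined (Suc n) C 0 1 (Suc (Suc k)) u (idn C (Suc k) v)"
      using u k phom_idn by (intro comp_defined_wr) simp_all
    then show ?case using cmp_idn_greater[of v "Suc k" 0 1 u] k by (simp add: cells_phom)
  next
    case (4 i k l v v') note d = this
    have "i_composable C 0 (Suc 0) (Suc k) u v"
      using d u by (auto simp: comp_defined_phom cells_phom i_composable_def)
    then show ?case using cmp_distrib_left[of 0 "Suc i" u "Suc k" "Suc l" v v'] d u
      by (simp add: comp_defined_phom cells_phom)
  qed
next
  case (6 x y z w k u v t)
  show ?case
    using cmp_assoc[of 0 "Suc k" 1 u v 1 t] comp_defined_wl[OF 6(5,6,7)] comp_defined_wl[OF le0 6(7,8)]
      comp_defined_wl[OF 6(5) wl_cells[OF 6(5,6,7)] 6(8)] comp_defined_wl[OF 6(5,6) wl_cells[OF le0 6(7,8)]]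
    by simp
next
  case (7 x y z w k u v t)
  show ?case
    using cmp_assoc[of 0 1 "Suc k" u v 1 t] comp_defined_wr[OF 7(5,6,7)] comp_defined_wl[OF 7(5,7,8)]
      comp_defined_wl[OF 7(5) wr_cells[OF 7(5,6,7)] 7(8)] comp_defined_wr[OF 7(5,6) wl_cells[OF 7(5,7,8)]]
    by simp
next
  case (8 x y z w k u v t)
  show ?case
    using cmp_assoc[of 0 1 1 u v "Suc k" t] comp_defined_wr[OF le0 8(6,7)] comp_defined_wr[OF 8(5,7,8)]
      comp_defined_wr[OF 8(5) wl_cells[OF le0 8(6,7)] 8(8)] comp_defined_wr[OF 8(5,6) wr_cells[OF 8(5,7,8)]]
    by simp
next
  case (9 x y k u)
  have "idn C 0 x \<in> cells (phom C x x) 0" using 9 by (simp add: cells_phom idn_cells bdto_Suc bd_idn)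
  then have "comp_defined (Suc n) C 0 (Suc 0) (Suc k) (idn C 0 x) u"
    using comp_defined_wr[OF 9(3) _ 9(4)] by simp
  then show ?case using idn_cmp_le[OF 9(1)] by simp
next
  case (10 x y k u)
  have "idn C 0 y \<in> cells (phom C y y) 0" using 10 by (simp add: cells_phom idn_cells bdto_Suc bd_idn)
  then have "comp_defined (Suc n) C 0 (Suc k) (Suc 0) u (idn C 0 y)"
    using comp_defined_wl[OF 10(3,4)] by simp
  then show ?case using cmp_idn_le[OF 10(2)] by simp
qed simp

text \<open>Composition along 0-cells forces one of the dimensions to be 1, which is a whiskering.
  Above that, both cells have the same 0-source and the same 0-target, so the composite is formed
  inside one hom. Two composable 1-cells fit both whiskering cases.\<close>

lemma comp_defined_Suc_cases:
  assumes a: "comp_defined (Suc n) C i k l u v"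
  obtains (wr) m x y z where "k = 1" "l = Suc m" "m \<le> n" "x \<in> cells C 0" "y \<in> cells C 0" "z \<in> cells C 0"
      "u \<in> cells (phom C x y) 0" "v \<in> cells (phom C y z) m"
  | (wl) m x y z where "k = Suc m" "l = 1" "m \<le> n" "x \<in> cells C 0" "y \<in> cells C 0" "z \<in> cells C 0"
      "u \<in> cells (phom C x y) m" "v \<in> cells (phom C y z) 0"
  | (hom) j k' l' x y where "k = Suc k'" "l = Suc l'" "x \<in> cells C 0" "y \<in> cells C 0"
      "comp_defined n (phom C x y) j k' l' u v"
proof -
  note D = comp_definedD[OF a]
  obtain k' l' where kl: "k = Suc k'" "l = Suc l'" using D by (cases k; cases l) auto
  let ?x = "bdto C Src 0 k u" and ?y = "bdto C Tgt 0 k u" and ?z = "bdto C Tgt 0 l v"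
  have xyz: "?x \<in> cells C 0" "?y \<in> cells C 0" "?z \<in> cells C 0"
    using D(1-4,8,9) by (simp_all add: bdto_cells)
  have u: "u \<in> cells (phom C ?x ?y) k'" using D(8) kl by (simp add: cells_phom)
  show thesis
  proof (cases i)
    case 0
    then have "?y = bdto C Src 0 l v" using D(10) by simp
    then have v: "v \<in> cells (phom C ?y ?z) l'" using D(9) kl by (simp add: cells_phom)
    have "k' = 0 \<or> l' = 0" using 0 D(7) kl by auto
    then show thesis
    proof
      assume "k' = 0"
      with u kl have "k = 1" "u \<in> cells (phom C ?x ?y) 0" by simp_all
      then show thesis using wr[OF _ kl(2) _ xyz _ v] D(4) kl(2) by simp
    next
      assume "l' = 0"
      with v kl have "l = 1" "v \<in> cells (phom C ?y ?z) 0" by simp_all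
      then show thesis using wl[OF kl(1) _ _ xyz u] D(2) kl(1) by simp
    qed
  next
    case (Suc j)
    have "bdto C e 0 k u = bdto C e 0 l v" for e
      using bdto_cmp_lower(1)[OF a, of 0] Suc by simp
    then have "v \<in> cells (phom C ?x ?y) l'" using D(9) kl by (simp add: cells_phom)
    moreover have "0 < k'" "0 < l'" using D(5,6) kl Suc by simp_all
    ultimately have "comp_defined n (phom C ?x ?y) j k' l' u v"
      using a u kl Suc by (simp add: comp_defined_phom)
    then show thesis by (rule hom[OF kl xyz(1,2)])
  qed
qed

end

lemma precategory_SucI: "precategory (Suc n) C \<Longrightarrow> precategory_Suc n C"
  by (simp add: precategory_Suc_def)

section \<open>The functor from precategories to enriched categories is fully faithful\<close>

context funny_tensor begin

definition penr :: "'a precat \<Rightarrow> ('a, 'a precat, 'a pmap) ecat" where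
  "penr C = mk_ecat (cells C 0) (phom C) (idn C 0) (\<lambda>x y z k u v. cmp C (Suc k) 1 u v) (\<lambda>x y z k u v. cmp C 1 (Suc k) u v)"

lemma penr_simps [simp]: "eobj (penr C) = cells C 0" "ehom (penr C) = phom C" "eunit (penr C) x = idn C 0 x"
  by (simp_all add: penr_def)

lemma enriched_penr: "precategory (Suc n) C \<Longrightarrow> enriched_category (FunnyPCat n) (penr C)"
  unfolding penr_def by (intro enriched_mk_ecat precategory_Suc.whiskered_phom precategory_SucI)

lemma ewl_penr:
  "\<lbrakk>precategory (Suc n) C; x \<in> cells C 0; y \<in> cells C 0; z \<in> cells C 0; k \<le> n; u \<in> cells (phom C x y) k; v \<in> cells (phom C y z) 0\<rbrakk>
   \<Longrightarrow> ewl n (penr C) x y z k u v = cmp C (Suc k) 1 u v"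
  unfolding penr_def by (rule ewl_mk_ecat[OF precategory_Suc.whiskered_phom[OF precategory_SucI]])

lemma ewr_penr:
  "\<lbrakk>precategory (Suc n) C; x \<in> cells C 0; y \<in> cells C 0; z \<in> cells C 0; k \<le> n; u \<in> cells (phom C x y) 0; v \<in> cells (phom C y z) k\<rbrakk>
   \<Longrightarrow> ewr n (penr C) x y z k u v = cmp C 1 (Suc k) u v"
  unfolding penr_def by (rule ewr_mk_ecat[OF precategory_Suc.whiskered_phom[OF precategory_SucI]])

definition penr_map :: "'a precat \<Rightarrow> 'a pmap \<Rightarrow> ('a, 'a pmap) efun" where
  "penr_map C f = \<lparr>efobj = (\<lambda>x. if x \<in> cells C 0 then f 0 x else undefined),
     efmap = (\<lambda>x y. if x \<in> cells C 0 \<and> y \<in> cells C 0 then prestrict n (phom C x y) (\<lambda>k. f (Suc k)) else undefined)\<rparr>"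

lemma penr_map_simps [simp]: "x \<in> cells C 0 \<Longrightarrow> efobj (penr_map C f) x = f 0 x"
  "x \<in> cells C 0 \<Longrightarrow> y \<in> cells C 0 \<Longrightarrow> efmap (penr_map C f) x y = prestrict n (phom C x y) (\<lambda>k. f (Suc k))"
  by (simp_all add: penr_map_def)

lemma premor_phom:
  assumes C: "precategory (Suc n) C" and f: "premor (Suc n) C D f" and "x \<in> cells C 0" "y \<in> cells C 0"
  shows "premor n (phom C x y) (phom D (f 0 x) (f 0 y)) (\<lambda>k. f (Suc k))"
proof (rule premor.intro, unfold phom_ops, goal_cases)
  case (1 k u)
  then show ?case using premor.premor_bdto[OF f C, of "Suc k" u 0 Src] premor.premor_bdto[OF f C, of "Suc k" u 0 Tgt]
    by (auto simp: cells_phom premor.map_cells[OF f])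
next
  case (2 i u e) then show ?case using premor.map_bd[OF f, of "Suc i" u e] by (simp add: cells_phom)
next
  case (3 k u) then show ?case using premor.map_idn[OF f, of "Suc k" u] by (simp add: cells_phom)
next
  case (4 i k l u v)
  then show ?case using premor.map_cmp[OF f, of "Suc i" "Suc k" "Suc l" u v] by (simp add: comp_defined_phom)
qed

lemma penr_map_functor:
  assumes C: "precategory (Suc n) C" and D: "precategory (Suc n) D" and f: "prefunctor (Suc n) C D f"
  shows "whiskered_functor n (penr C) (penr D) (penr_map C f)"
proof -
  interpret C: precategory_Suc n C using C by (rule precategory_SucI)
  interpret f: premor "Suc n" C D f using f by (rule prefunctor_premor)
  have f0: "f 0 x \<in> cells D 0" if "x \<in> cells C 0" for x using that f.map_cells by simp
  have fc: "f (Suc k) u \<in> cells (phom D (f 0 x) (f 0 y)) k"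
    if "x \<in> cells C 0" "y \<in> cells C 0" "k \<le> n" "u \<in> cells (phom C x y) k" for k x y u
    using premor.map_cells[OF premor_phom[OF C f.premor_axioms]] that by blast
  show ?thesis
  proof (rule whiskered_functor.intro, unfold penr_simps, goal_cases)
    case (2 x y)
    then show ?case using prefunctor_prestrict[OF C.precategory_phom premor_phom[OF C f.premor_axioms]] by simp
  next
    case (3 x)
    have "idn C 0 x \<in> cells (phom C x x) 0" using 3 by (simp add: cells_phom C.idn_cells bdto_Suc C.bd_idn)
    then show ?case using 3 f.map_idn[of 0 x] by simp
  next
    case (4 x y z k u v)
    note cd = C.comp_defined_wl[OF 4(4-6)]
    have "cmp C (Suc k) 1 u v \<in> cells (phom C x z) k" using C.wl_cells 4 by blast
    then show ?case using 4 f.map_cmp[OF cd] by (simp add: ewl_penr[OF C] ewl_penr[OF D] f0 fc)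
  next
    case (5 x y z k u v)
    note cd = C.comp_defined_wr[OF 5(4-6)]
    have "cmp C 1 (Suc k) u v \<in> cells (phom C x z) k" using C.wr_cells 5 by blast
    then show ?case using 5 f.map_cmp[OF cd] by (simp add: ewr_penr[OF C] ewr_penr[OF D] f0 fc)
  qed (auto simp: f0 penr_map_def)
qed

definition penr_functor :: "('a precat, 'a pmap, ('a, 'a precat, 'a pmap) ecat, ('a, 'a pmap) efun) funct" where
  "penr_functor = \<lparr>fun_obj = penr, fun_map = (\<lambda>C D. penr_map C)\<rparr>"

lemma PCat_simps: "C \<in> Obj (PCat m) \<longleftrightarrow> precategory m C" "f \<in> Hom (PCat m) C D \<longleftrightarrow> prefunctor m C D f"
  "Ide (PCat m) = pid m" "Comp (PCat m) A B D g f = pcomp m A g f"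
  by (auto simp: PCat_def)

lemma is_functor_penr: "is_functor (PCat (Suc n)) (EnrCat (FunnyPCat n)) penr_functor"
proof (rule is_functor.intro, unfold PCat_simps EnrCat_Obj EnrCat_Hom, goal_cases)
  case (1 C) then show ?case by (simp add: penr_functor_def enriched_penr)
next
  case (2 C D f)
  then show ?case
    by (simp add: penr_functor_def enriched_functorE[OF enriched_penr enriched_penr] penr_map_functor)
next
  case (3 C)
  show ?case
    by (rule efun_eqI) (auto simp: penr_functor_def EnrCat_Ide penr_map_def pid_def cells_phom intro!: prestrict_eqI)
next
  case (4 A B D f g)
  have f: "f (Suc k) u \<in> cells (phom B (f 0 x) (f 0 y)) k"
    if "x \<in> cells A 0" "y \<in> cells A 0" "k \<le> n" "u \<in> cells (phom A x y) k" for k x y u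
    using premor.map_cells[OF premor_phom[OF 4(1) prefunctor_premor[OF 4(4)]]] that by blast
  have f0: "f 0 x \<in> cells B 0" if "x \<in> cells A 0" for x
    using premor.map_cells[OF prefunctor_premor[OF 4(4)]] that by simp
  have A: "u \<in> cells A (Suc k)" if "u \<in> cells (phom A x y) k" for u k x y using that by (simp add: cells_phom)
  show ?case
  proof (rule efun_eqI, goal_cases)
    case (1 x) show ?case by (simp add: penr_functor_def EnrCat_Comp penr_map_def f0)
  next
    case (2 x y)
    show ?case
    proof (cases "x \<in> cells A 0 \<and> y \<in> cells A 0")
      case True
      then show ?thesis
        by (simp add: penr_functor_def EnrCat_Comp f0 pcomp_def[of n]) (rule prestrict_eqI, simp add: f A)
    qed (auto simp: penr_functor_def EnrCat_Comp penr_map_def)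
  qed
qed

text \<open>Every cell of positive dimension lies in the hom between its own 0-boundaries, so the
  action on objects and homs determines \<open>f\<close> on all cells.\<close>

lemma penr_faithful:
  assumes C: "precategory (Suc n) C" and f: "prefunctor (Suc n) C D f" and g: "prefunctor (Suc n) C D g"
    and eq: "penr_map C f = penr_map C g"
  shows "f = g"
proof (rule prefunctor_eqI[OF f g])
  interpret C: precategory_Suc n C using C by (rule precategory_SucI)
  fix k u assume k: "k \<le> Suc n" and u: "u \<in> cells C k"
  show "f k u = g k u"
  proof (cases k)
    case 0
    then show ?thesis using arg_cong[OF eq, of "\<lambda>F. efobj F u"] u by simp
  next
    case (Suc m)
    let ?x = "bdto C Src 0 (Suc m) u" and ?y = "bdto C Tgt 0 (Suc m) u"
    have "?x \<in> cells C 0" "?y \<in> cells C 0" using C.phom_src u k Suc by auto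
    then show ?thesis
      using arg_cong[OF eq, of "\<lambda>F. efmap F ?x ?y m u"] C.phom_self[of u m] u k Suc by simp
  qed
qed

lemma penr_full:
  assumes C: "precategory (Suc n) C" and D: "precategory (Suc n) D"
    and h: "whiskered_functor n (penr C) (penr D) h"
  shows "\<exists>f. prefunctor (Suc n) C D f \<and> penr_map C f = h"
proof -
  interpret C: precategory_Suc n C using C by (rule precategory_SucI)
  interpret D: precategory_Suc n D using D by (rule precategory_SucI)
  interpret h: whiskered_functor n "penr C" "penr D" h by (rule h)
  note hobj = h.obj[unfolded penr_simps]
  note hmor = prefunctor_premor[OF h.mor[unfolded penr_simps]]
  note hcells = premor.map_cells[OF hmor]
  \<comment> \<open>The prefunctor is assembled cellwise: a cell of positive dimension is sent along
    the component of \<open>h\<close> at its own 0-source and 0-target.\<close>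
  define f where "f k u = (case k of 0 \<Rightarrow> efobj h u
    | Suc m \<Rightarrow> efmap h (bdto C Src 0 k u) (bdto C Tgt 0 k u) m u)" for k u
  have f0: "f 0 x = efobj h x" for x by (simp add: f_def)
  have fS: "f (Suc m) u = efmap h x y m u" if "u \<in> cells (phom C x y) m" for m u x y
    using that by (simp add: f_def cells_phom)
  have ex: "\<exists>x \<in> cells C 0. \<exists>y \<in> cells C 0. u \<in> cells (phom C x y) m" if "m \<le> n" "u \<in> cells C (Suc m)" for m u
    using that C.phom_self C.phom_src by blast
  have "premor (Suc n) C D f"
  proof
    fix k u assume k: "k \<le> Suc n" and u: "u \<in> cells C k"
    show "f k u \<in> cells D k"
    proof (cases k)
      case 0 then show ?thesis using u hobj by (simp add: f0)
    next
      case (Suc m)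
      then obtain x y where xy: "x \<in> cells C 0" "y \<in> cells C 0" "u \<in> cells (phom C x y) m"
        using ex[of m u] k u by auto
      have "m \<le> n" using Suc k by simp
      from hcells[OF xy(1,2) this xy(3)] show ?thesis using Suc xy by (simp add: fS cells_phom)
    qed
  next
    fix i u e assume i: "i < Suc n" and u: "u \<in> cells C (Suc i)"
    obtain x y where xy: "x \<in> cells C 0" "y \<in> cells C 0" "u \<in> cells (phom C x y) i"
      using ex[of i u] i u by auto
    show "f i (bd C e i u) = bd D e i (f (Suc i) u)"
    proof (cases i)
      case 0
      then show ?thesis using hcells[OF xy(1,2) _ xy(3)] xy fS[OF xy(3)]
        by (cases e) (simp_all add: f0 cells_phom bdto_Suc)
    next
      case (Suc j)
      have j: "j < n" using i Suc by simp
      show ?thesis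
        using premor.map_bd[OF hmor[OF xy(1,2)] j xy(3)[unfolded Suc], of e] C.phom_bd[OF j xy(3)[unfolded Suc], of e] xy(3) Suc
        by (simp add: fS)
    qed
  next
    fix k u assume k: "k < Suc n" and u: "u \<in> cells C k"
    show "f (Suc k) (idn C k u) = idn D k (f k u)"
    proof (cases k)
      case 0
      then have "idn C 0 u \<in> cells (phom C u u) 0" using u by (simp add: cells_phom C.idn_cells bdto_Suc C.bd_idn)
      then show ?thesis using 0 u h.unit[of u] by (simp add: fS f0)
    next
      case (Suc m)
      then obtain x y where xy: "x \<in> cells C 0" "y \<in> cells C 0" "u \<in> cells (phom C x y) m"
        using ex[of m u] k u by auto
      have m: "m < n" using k Suc by simp
      show ?thesis
        using premor.map_idn[OF hmor[OF xy(1,2)] m xy(3)] C.phom_idn[OF m xy(3)] xy(3) Suc by (simp add: fS)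
    qed
  next
    \<comment> \<open>Each kind of composite is preserved for a different reason: whiskerings by
      compatibility of \<open>h\<close> with enriched composition, composites inside a hom because
      \<open>h\<close> acts there by a prefunctor.\<close>
    fix i k l u v assume a: "comp_defined (Suc n) C i k l u v"
    then show "f (max k l) (cmp C k l u v) = cmp D k l (f k u) (f l v)"
    proof (cases rule: C.comp_defined_Suc_cases)
      case (wr m x y z)
      note c = C.wr_cells[OF wr(3,7,8)]
      show ?thesis
        using h.wr[unfolded penr_simps, OF wr(4,5,6,3,7,8)] wr c fS[OF wr(7)] fS[OF wr(8)] fS[OF c]
          hcells[OF wr(4,5) _ wr(7)] hcells[OF wr(5,6,3,8)] hobj
        by (simp add: ewr_penr[OF C] ewr_penr[OF D])
    next
      case (wl m x y z)
      note c = C.wl_cells[OF wl(3,7,8)]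
      show ?thesis
        using h.wl[unfolded penr_simps, OF wl(4,5,6,3,7,8)] wl c fS[OF wl(7)] fS[OF wl(8)] fS[OF c]
          hcells[OF wl(4,5,3,7)] hcells[OF wl(5,6) _ wl(8)] hobj
        by (simp add: ewl_penr[OF C] ewl_penr[OF D])
    next
      case (hom j k' l' x y)
      have u: "u \<in> cells (phom C x y) k'" and v: "v \<in> cells (phom C x y) l'"
        using hom(5) by (auto simp: comp_defined_phom)
      show ?thesis
        using premor.map_cmp[OF hmor[OF hom(3,4)] hom(5)] C.phom_cmp[OF hom(5)] hom(1,2) fS[OF u] fS[OF v]
        by (simp add: fS)
    qed
  qed
  then have F: "prefunctor (Suc n) C D (prestrict (Suc n) C f)" by (rule prefunctor_prestrict[OF C])
  have "penr_map C (prestrict (Suc n) C f) = h"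
  proof (rule efun_eqI, goal_cases)
    case (1 x)
    show ?case by (cases "x \<in> cells C 0") (simp_all add: f0, simp add: penr_map_def h.obj_undefined)
  next
    case (2 x y)
    show ?case
    proof (cases "x \<in> cells C 0 \<and> y \<in> cells C 0")
      case True
      then have "prefunctor n (phom C x y) (phom D (efobj h x) (efobj h y)) (efmap h x y)" using h.mor by simp
      then have "prestrict n (phom C x y) (efmap h x y) = efmap h x y" by (simp add: prefunctor_iff_premor)
      moreover have "prestrict n (phom C x y) (\<lambda>k. prestrict (Suc n) C f (Suc k)) = prestrict n (phom C x y) (efmap h x y)"
      proof (rule prestrict_eqI)
        fix k u assume "k \<le> n" "u \<in> cells (phom C x y) k"
        moreover from this have "u \<in> cells C (Suc k)" by (simp add: cells_phom)
        ultimately show "prestrict (Suc n) C f (Suc k) u = efmap h x y k u" by (simp add: fS)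
      qed
      ultimately show ?thesis using True by simp
    qed (auto simp: penr_map_def h.mor_undefined)
  qed
  then show ?thesis using F by blast
qed

end

section \<open>The precategory of an enriched category\<close>

locale glueing = whiskered n X H \<epsilon> wl wr + coding T
  for T :: "'a itself" and n and X :: "'a set" and H \<epsilon> wl wr
begin

text \<open>Different homs of an enriched category may share cells; tagging with both end objects
  makes them disjoint and lets the 0-boundaries be read off.\<close>

abbreviation tri :: "'a \<Rightarrow> 'a \<Rightarrow> 'a \<Rightarrow> 'a" where
  "tri x y u \<equiv> pcode (x, pcode (y, u))"

text \<open>A \<open>(k+1)\<close>-cell is a triple of its \<open>0\<close>-source \<open>x\<close>, its \<open>0\<close>-target \<open>y\<close> and a \<open>k\<close>-cell of \<open>H(x,y)\<close>.\<close>

definition glue :: "'a precat" where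
  "glue =
     \<lparr>cells = (\<lambda>k. case k of 0 \<Rightarrow> X | Suc m \<Rightarrow> {tri x y u | x y u. x \<in> X \<and> y \<in> X \<and> u \<in> cells (H x y) m}),
      bd = (\<lambda>e i p. case i of 0 \<Rightarrow> (if e = Src then pfst p else pfst (psnd p))
        | Suc j \<Rightarrow> tri (pfst p) (pfst (psnd p)) (bd (H (pfst p) (pfst (psnd p))) e j (psnd (psnd p)))),
      idn = (\<lambda>k p. case k of 0 \<Rightarrow> tri p p (\<epsilon> p)
        | Suc m \<Rightarrow> tri (pfst p) (pfst (psnd p)) (idn (H (pfst p) (pfst (psnd p))) m (psnd (psnd p)))),
      cmp = (\<lambda>k l p q.
        if k = 1 then tri (pfst p) (pfst (psnd q))
          (wr (pfst p) (pfst (psnd p)) (pfst (psnd q)) (l - 1) (psnd (psnd p)) (psnd (psnd q)))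
        else if l = 1 then tri (pfst p) (pfst (psnd q))
          (wl (pfst p) (pfst (psnd p)) (pfst (psnd q)) (k - 1) (psnd (psnd p)) (psnd (psnd q)))
        else tri (pfst p) (pfst (psnd p))
          (cmp (H (pfst p) (pfst (psnd p))) (k - 1) (l - 1) (psnd (psnd p)) (psnd (psnd q))))\<rparr>"

lemma cells_glue_0 [simp]: "cells glue 0 = X"
  by (simp add: glue_def)

lemma cells_glue_Suc: "p \<in> cells glue (Suc k) \<longleftrightarrow> (\<exists>x y u. p = tri x y u \<and> x \<in> X \<and> y \<in> X \<and> u \<in> cells (H x y) k)"
  by (simp add: glue_def)

lemma tri_cells_glue [simp]: "tri x y u \<in> cells glue (Suc k) \<longleftrightarrow> x \<in> X \<and> y \<in> X \<and> u \<in> cells (H x y) k"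
  by (auto simp: cells_glue_Suc)

lemma glue_ops [simp]:
  "bd glue Src 0 (tri x y u) = x" "bd glue Tgt 0 (tri x y u) = y"
  "bd glue e (Suc i) (tri x y u) = tri x y (bd (H x y) e i u)"
  "idn glue 0 x = tri x x (\<epsilon> x)" "idn glue (Suc k) (tri x y u) = tri x y (idn (H x y) k u)"
  "cmp glue (Suc 0) (Suc l) (tri x y u) (tri y' z v) = tri x z (wr x y z l u v)"
  by (simp_all add: glue_def)

text \<open>The definition of \<open>cmp\<close> tests for a left factor of dimension 1 first, so
  for two 1-cells it yields \<open>wr\<close>. The two whiskerings agree there by
  \<open>wl_wr\<close>.\<close>

lemma glue_wl [simp]: "\<lbrakk>x \<in> X; y \<in> X; z \<in> X; u \<in> cells (H x y) k; v \<in> cells (H y z) 0\<rbrakk>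
  \<Longrightarrow> cmp glue (Suc k) (Suc 0) (tri x y u) (tri y z v) = tri x z (wl x y z k u v)"
  by (cases k) (simp_all add: glue_def wl_wr)

lemma glue_hom [simp]: "0 < k \<Longrightarrow> 0 < l \<Longrightarrow> cmp glue (Suc k) (Suc l) (tri x y u) (tri x' y' v) = tri x y (cmp (H x y) k l u v)"
  by (simp add: glue_def)

lemma bdto_glue_Suc [simp]: "bdto glue e (Suc i) (Suc k) (tri x y u) = tri x y (bdto (H x y) e i k u)"
  by (induction k arbitrary: u) (auto simp: bdto.simps(2))

lemma bdto_glue_0 [simp]: "bdto glue Src 0 (Suc k) (tri x y u) = x" "bdto glue Tgt 0 (Suc k) (tri x y u) = y"
  by (induction k arbitrary: u) (simp_all add: bdto.simps(2))

lemma comp_defined_glue_cases: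
  assumes a: "comp_defined (Suc n) glue i k l p q"
  obtains (wr) m x y z u v where "i = 0" "k = Suc 0" "l = Suc m" "m \<le> n" "x \<in> X" "y \<in> X" "z \<in> X"
      "p = tri x y u" "q = tri y z v" "u \<in> cells (H x y) 0" "v \<in> cells (H y z) m"
  | (wl) m x y z u v where "i = 0" "k = Suc m" "l = Suc 0" "m \<le> n" "x \<in> X" "y \<in> X" "z \<in> X"
      "p = tri x y u" "q = tri y z v" "u \<in> cells (H x y) m" "v \<in> cells (H y z) 0"
  | (inner) j k' l' x y u v where "i = Suc j" "k = Suc k'" "l = Suc l'" "x \<in> X" "y \<in> X"
      "p = tri x y u" "q = tri x y v" "comp_defined n (H x y) j k' l' u v"
proof -
  have D: "0 < k" "k \<le> Suc n" "0 < l" "l \<le> Suc n" "i < k" "i < l" "i = min k l - 1"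
    "p \<in> cells glue k" "q \<in> cells glue l" "bdto glue Tgt i k p = bdto glue Src i l q"
    using a by (auto simp: comp_defined_def i_composable_def)
  obtain k' l' where kl: "k = Suc k'" "l = Suc l'" using D(1,3) by (cases k; cases l) auto
  obtain x y u where p: "p = tri x y u" "x \<in> X" "y \<in> X" "u \<in> cells (H x y) k'"
    using D(8) kl by (auto simp: cells_glue_Suc)
  obtain y' z v where q: "q = tri y' z v" "y' \<in> X" "z \<in> X" "v \<in> cells (H y' z) l'"
    using D(9) kl by (auto simp: cells_glue_Suc)
  show thesis
  proof (cases i)
    case 0
    have y': "y' = y" using D(10) 0 kl p q by simp
    have "k' = 0 \<or> l' = 0" using 0 D(7) kl by auto
    then show thesis
    proof
      assume "k' = 0"
      then show thesis using wr[OF 0 _ kl(2) _ p(2,3) q(3) p(1) q(1)[unfolded y']] kl p q y' D(4) by simp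
    next
      assume "l' = 0"
      then show thesis using wl[OF 0 kl(1) _ _ p(2,3) q(3) p(1) q(1)[unfolded y']] kl p q y' D(2) by simp
    qed
  next
    case (Suc j)
    have e: "y' = x" "z = y" "bdto (H x y) Tgt j k' u = bdto (H x y) Src j l' v"
      using D(10) Suc kl p q by auto
    have "comp_defined n (H x y) j k' l' u v"
      using D(2,4,5,6,7) kl p(4) q(4) e Suc by (auto simp: comp_defined_def i_composable_def)
    then show thesis using inner[OF Suc kl p(2,3,1) q(1)[unfolded e]] by simp
  qed
qed

lemma comp_defined_glue_hom: "x \<in> X \<Longrightarrow> y \<in> X \<Longrightarrow>
  comp_defined (Suc n) glue (Suc j) (Suc k) (Suc l) (tri x y u) (tri x y v) \<longleftrightarrow> comp_defined n (H x y) j k l u v"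
  by (auto simp: comp_defined_def i_composable_def)

lemma premor_wl_cells: "\<lbrakk>x \<in> X; y \<in> X; z \<in> X; k \<le> n; u \<in> cells (H x y) k; v \<in> cells (H y z) 0\<rbrakk> \<Longrightarrow> wl x y z k u v \<in> cells (H x z) k"
  using premor.map_cells[OF wl] by blast

lemma premor_wr_cells: "\<lbrakk>x \<in> X; y \<in> X; z \<in> X; k \<le> n; u \<in> cells (H x y) 0; v \<in> cells (H y z) k\<rbrakk> \<Longrightarrow> wr x y z k u v \<in> cells (H x z) k"
  using premor.map_cells[OF wr] by blast

text \<open>For composition in positive dimension the axioms are those of the homs. Along 0-cells
  they are the unit and associativity laws of the whiskerings and the fact that whiskerings are
  morphisms.\<close>

lemma precategory_glue: "precategory (Suc n) glue"
proof (rule precategory.intro, goal_cases)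
  case (1 i p e)
  then show ?case
    by (cases i; cases e) (auto simp: cells_glue_Suc precategory.bd_cells[OF hom])
next
  case (2 i p e)
  then show ?case
    by (cases i; cases e) (auto simp: cells_glue_Suc precategory.globular[OF hom])
next
  case (3 k p)
  then show ?case
    by (cases k) (auto simp: cells_glue_Suc unit_cells precategory.idn_cells[OF hom])
next
  case (4 i k l p q)
  then show ?case
  proof (cases rule: comp_defined_glue_cases)
    case (inner j k' l' x y u v)
    then show ?thesis
      using precategory.cmp_cells[OF hom[OF inner(4,5)] inner(8)]
      by (auto simp: comp_defined_def)
  qed (auto simp: premor_wl_cells premor_wr_cells)
next
  case (5 k p e)
  then show ?case
    by (cases k; cases e) (auto simp: cells_glue_Suc precategory.bd_idn[OF hom])
next
  case (6 i k l p q e)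
  from 6(1) show ?case
  proof (cases rule: comp_defined_glue_cases)
    case (wr m x y z u v)
    then obtain m' where m: "m = Suc m'" using 6(2) by (cases m) auto
    show ?thesis using wr m premor.map_bd[OF whiskered.wr[OF whiskered_axioms wr(5,6,7,10)], of m' v e] by simp
  next
    case (inner j k' l' x y u v)
    then obtain m where m: "l' = Suc m" using 6(2) by (cases l') auto
    have "0 < k'" "0 < m" using 6(2) inner m by (auto simp: comp_defined_def)
    then show ?thesis
      using precategory.bd_cmp_less[OF hom[OF inner(4,5)] inner(8), of e] inner m 6(2) by simp
  qed (use 6(2) in auto)
next
  case (7 i k l p q e)
  from 7(1) show ?case
  proof (cases rule: comp_defined_glue_cases)
    case (wl m x y z u v)
    then obtain m' where m: "m = Suc m'" using 7(2) by (cases m) auto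
    have "bd (H x y) e m' u \<in> cells (H x y) m'"
      using wl m precategory.bd_cells[OF hom[OF wl(5,6)]] by simp
    then show ?thesis using wl m premor.map_bd[OF whiskered.wl[OF whiskered_axioms wl(5,6,7,11)], of m' u e] by simp
  next
    case (inner j k' l' x y u v)
    then obtain m where m: "k' = Suc m" using 7(2) by (cases k') auto
    have "0 < l'" "0 < m" using 7(2) inner m by (auto simp: comp_defined_def)
    then show ?thesis
      using precategory.bd_cmp_greater[OF hom[OF inner(4,5)] inner(8), of e] inner m 7(2) by simp
  qed (use 7(2) in auto)
next
  case (8 i k p q)
  then show ?case
  proof (cases rule: comp_defined_glue_cases)
    case (inner j k' l' x y u v)
    then obtain m where m: "k' = Suc m" by (cases k') (auto simp: comp_defined_def)
    then show ?thesis
      using precategory.src_cmp_eq[OF hom[OF inner(4,5)], of j k' u v] inner by simp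
  qed auto
next
  case (9 i k p q)
  then show ?case
  proof (cases rule: comp_defined_glue_cases)
    case (inner j k' l' x y u v)
    then obtain m where m: "k' = Suc m" by (cases k') (auto simp: comp_defined_def)
    then show ?thesis
      using precategory.tgt_cmp_eq[OF hom[OF inner(4,5)], of j k' u v] inner by simp
  qed auto
next
  case (10 p k i l q)
  from 10(2) show ?case
  proof (cases rule: comp_defined_glue_cases)
    case (wr m x y z u v)
    then show ?thesis using 10 unit_left[of y z m v] by auto
  next
    case (wl m x y z u v)
    \<comment> \<open>Here \<open>l = 1\<close> forces \<open>k = 0\<close>: the left factor is the
      identity of an object, and \<open>wl\<close> has to be exchanged for \<open>wr\<close> before
      the unit law applies.\<close>
    then show ?thesis using 10 unit_left[of y z 0 v] wl_wr[of y y z "\<epsilon> y" v] by (auto simp: unit_cells)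
  next
    case (inner j k' l' x y u v)
    then obtain m where k: "k' = Suc m" by (cases k') (auto simp: comp_defined_def)
    obtain w where w: "p = tri x y w" "u = idn (H x y) m w" "w \<in> cells (H x y) m"
      using 10(1) inner k by (auto simp: cells_glue_Suc)
    have "0 < l'" using inner(8) by (simp add: comp_defined_def)
    then show ?thesis
      using precategory.idn_cmp_le[OF hom[OF inner(4,5)] w(3), of j l' v] inner k w 10(3) by simp
  qed
next
  case (11 p k i l q)
  from 11(2) show ?case
  proof (cases rule: comp_defined_glue_cases)
    case (wr m x y z u v)
    then show ?thesis using 11 by simp
  next
    case (wl m x y z u v)
    then obtain m' where m: "m = Suc m'" using 11 by (cases m) auto
    obtain w where w: "p = tri x y w" "u = idn (H x y) m' w" "w \<in> cells (H x y) m'"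
      using 11(1) wl m by (auto simp: cells_glue_Suc)
    show ?thesis
      using premor.map_idn[OF whiskered.wl[OF whiskered_axioms wl(5,6,7,11)], of m' w] wl m w by simp
  next
    case (inner j k' l' x y u v)
    then obtain m where k: "k' = Suc m" by (cases k') (auto simp: comp_defined_def)
    obtain w where w: "p = tri x y w" "u = idn (H x y) m w" "w \<in> cells (H x y) m"
      using 11(1) inner k by (auto simp: cells_glue_Suc)
    have "0 < l'" "0 < m" using inner(3,8) 11(3) inner(2) k by (auto simp: comp_defined_def)
    then show ?thesis
      using precategory.idn_cmp_greater[OF hom[OF inner(4,5)] w(3), of j l' v] inner k w 11(3) by simp
  qed
next
  case (12 p k i l q)
  from 12(2) show ?case
  proof (cases rule: comp_defined_glue_cases)
    case (wr m x y z u v)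
    then show ?thesis using 12 unit_right[of x y 0 u] wl_wr[of x y y u "\<epsilon> y"] by (auto simp: unit_cells)
  next
    case (wl m x y z u v)
    then show ?thesis using 12 unit_right[of x y m u] by (auto simp: unit_cells)
  next
    case (inner j k' l' x y u v)
    then obtain m where k: "l' = Suc m" by (cases l') (auto simp: comp_defined_def)
    obtain w where w: "p = tri x y w" "v = idn (H x y) m w" "w \<in> cells (H x y) m"
      using 12(1) inner k by (auto simp: cells_glue_Suc)
    have "0 < k'" using inner(8) by (simp add: comp_defined_def)
    then show ?thesis
      using precategory.cmp_idn_le[OF hom[OF inner(4,5)] w(3), of j k' u] inner k w 12(3) by simp
  qed
next
  case (13 p k i l q)
  from 13(2) show ?case
  proof (cases rule: comp_defined_glue_cases)
    case (wl m x y z u v)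
    then show ?thesis using 13 by simp
  next
    case (wr m x y z u v)
    then obtain m' where m: "m = Suc m'" using 13 by (cases m) auto
    obtain w where w: "p = tri y z w" "v = idn (H y z) m' w" "w \<in> cells (H y z) m'"
      using 13(1) wr m by (auto simp: cells_glue_Suc)
    show ?thesis
      using premor.map_idn[OF whiskered.wr[OF whiskered_axioms wr(5,6,7,10)], of m' w] wr m w by simp
  next
    case (inner j k' l' x y u v)
    then obtain m where k: "l' = Suc m" by (cases l') (auto simp: comp_defined_def)
    obtain w where w: "p = tri x y w" "v = idn (H x y) m w" "w \<in> cells (H x y) m"
      using 13(1) inner k by (auto simp: cells_glue_Suc)
    have "0 < k'" "0 < m" using inner(3,8) 13(3) inner(2) k by (auto simp: comp_defined_def)
    then show ?thesis
      using precategory.cmp_idn_greater[OF hom[OF inner(4,5)] w(3), of j k' u] inner k w 13(3) by simp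
  qed
next
  case (14 i k l p q m r)
  have D: "i = min k l - 1" "i = min (max k l) m - 1" "i = min l m - 1" "0 < k" "0 < l" "0 < m"
    using 14 by (auto simp: comp_defined_def)
  show ?case
  proof (cases i)
    case 0
    obtain k' l' m' where klm: "k = Suc k'" "l = Suc l'" "m = Suc m'"
      using D(4-6) by (cases k; cases l; cases m) auto
    obtain x y z u v where pq: "p = tri x y u" "q = tri y z v" and xyz: "x \<in> X" "y \<in> X" "z \<in> X"
      and uv: "u \<in> cells (H x y) k'" "v \<in> cells (H y z) l'" "k' \<le> n" "l' \<le> n"
      using 14(1) by (cases rule: comp_defined_glue_cases) (use 0 klm in auto)
    obtain w t where r: "r = tri z w t" and w: "w \<in> X" and t: "t \<in> cells (H z w) m'" "m' \<le> n"
      using 14(3) by (cases rule: comp_defined_glue_cases) (use 0 klm pq in auto)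
    \<comment> \<open>Along 0-cells at most one of the three factors has dimension greater than 1.
      Its position selects the associativity law of the whiskerings.\<close>
    have "(k' = 0 \<and> l' = 0) \<or> (k' = 0 \<and> m' = 0) \<or> (l' = 0 \<and> m' = 0)"
      using 0 D klm by (auto simp: min_def max_def split: if_splits)
    then show ?thesis
    proof (elim disjE conjE)
      assume "k' = 0" "l' = 0"
      then show ?thesis using wr_wr[OF xyz w t(2) _ _ t(1), of u v] wl_wr[OF xyz, of u v] pq r klm uv t xyz w
        by (simp add: premor_wr_cells)
    next
      assume "k' = 0" "m' = 0"
      then show ?thesis using wl_wr_assoc[OF xyz w uv(4) _ uv(2), of u t] pq r klm uv t xyz w
        by (simp add: premor_wr_cells premor_wl_cells)
    next
      assume "l' = 0" "m' = 0"
      then show ?thesis using wl_wl[OF xyz w uv(3,1), of v t] wl_wr[OF xyz(2,3) w, of v t] pq r klm uv t xyz w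
        by (simp add: premor_wl_cells premor_wr_cells)
    qed
  next
    case (Suc j)
    obtain k' l' x y u v where kl: "k = Suc k'" "l = Suc l'" and pq: "p = tri x y u" "q = tri x y v"
      and xy: "x \<in> X" "y \<in> X" and uv: "comp_defined n (H x y) j k' l' u v"
      using 14(1) by (cases rule: comp_defined_glue_cases) (use Suc in auto)
    obtain m' w where m: "m = Suc m'" and r: "r = tri x y w" and vw: "comp_defined n (H x y) j l' m' v w"
      using 14(3) by (cases rule: comp_defined_glue_cases) (use Suc kl pq in auto)
    have pos: "0 < k'" "0 < l'" "0 < m'" using uv vw by (auto simp: comp_defined_def)
    have "comp_defined n (H x y) j (max k' l') m' (cmp (H x y) k' l' u v) w"
      using 14(2) comp_defined_glue_hom[OF xy, of j "max k' l'" m' "cmp (H x y) k' l' u v" w] kl m pq r Suc pos by simp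
    moreover have "comp_defined n (H x y) j k' (max l' m') u (cmp (H x y) l' m' v w)"
      using 14(4) comp_defined_glue_hom[OF xy, of j k' "max l' m'" u "cmp (H x y) l' m' v w"] kl m pq r Suc pos by simp
    ultimately show ?thesis
      using precategory.cmp_assoc[OF hom[OF xy] uv _ vw] kl m pq r pos by (simp add: less_max_iff_disj)
  qed
next
  case (15 i j p k l q q')
  from 15(3) show ?case
  proof (cases rule: comp_defined_glue_cases)
    case (inner j' k' l' x y v v')
    have pos: "0 < k'" "0 < l'" using inner(8) by (auto simp: comp_defined_def)
    obtain x' y' u where p: "p = tri x' y' u" "x' \<in> X" "y' \<in> X" "u \<in> cells (H x' y') i"
      using 15(2) by (auto simp: cells_glue_Suc)
    show ?thesis
    \<comment> \<open>For \<open>i = 0\<close> distributivity says that whiskering preserves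
      composition; for positive \<open>i\<close> all cells lie in one hom and its own distributivity
      applies.\<close>
    proof (cases i)
      case 0
      then have "y' = x" using 15(4) inner p by (simp add: i_composable_def)
      then show ?thesis
        using premor.map_cmp[OF wr[OF p(2) inner(4,5)] inner(8), of u] inner p pos 0 by simp
    next
      case (Suc i')
      have e: "x' = x" "y' = y" "bdto (H x y) Tgt i' i u = bdto (H x y) Src i' k' v"
        using 15(4) inner p Suc by (auto simp: i_composable_def)
      have ic: "i_composable (H x y) i' (Suc i') k' u v"
        using 15(1) inner(1,8) p e Suc by (auto simp: i_composable_def comp_defined_def)
      have uc: "u \<in> cells (H x y) (Suc i')" using p(4) e Suc by simp
      have "i' < j'" using 15(1) inner(1) Suc by simp
      then show ?thesis
        using precategory.cmp_distrib_left[OF hom[OF inner(4,5)] _ uc inner(8) ic] inner p e pos Suc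
        by (simp add: less_max_iff_disj)
    qed
  qed (use 15(1) in auto)
next
  case (16 i j p k l q q')
  from 16(3) show ?case
  proof (cases rule: comp_defined_glue_cases)
    case (inner j' k' l' x y v v')
    have pos: "0 < k'" "0 < l'" using inner(8) by (auto simp: comp_defined_def)
    obtain x' y' u where p: "p = tri x' y' u" "x' \<in> X" "y' \<in> X" "u \<in> cells (H x' y') i"
      using 16(2) by (auto simp: cells_glue_Suc)
    show ?thesis
    proof (cases i)
      case 0
      then have x': "x' = y" using 16(4) inner p by (simp add: i_composable_def)
      have vc: "v \<in> cells (H x y) k'" "v' \<in> cells (H x y) l'"
        "cmp (H x y) k' l' v v' \<in> cells (H x y) (max k' l')"
        using inner(8) precategory.cmp_cells[OF hom[OF inner(4,5)] inner(8)]
        by (auto simp: comp_defined_def i_composable_def)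
      show ?thesis
        using premor.map_cmp[OF wl[OF inner(4,5) p(3)] inner(8), of u] inner p pos 0 x' vc by simp
    next
      case (Suc i')
      have e: "x' = x" "y' = y" "bdto (H x y) Tgt i' k' v = bdto (H x y) Src i' i u"
        using 16(4) inner p Suc by (auto simp: i_composable_def)
      have ic: "i_composable (H x y) i' k' (Suc i') v u"
        using 16(1) inner(1,8) p e Suc by (auto simp: i_composable_def comp_defined_def)
      have uc: "u \<in> cells (H x y) (Suc i')" using p(4) e Suc by simp
      have "i' < j'" using 16(1) inner(1) Suc by simp
      then show ?thesis
        using precategory.cmp_distrib_right[OF hom[OF inner(4,5)] _ uc inner(8) ic] inner p e pos Suc
        by (simp add: less_max_iff_disj)
    qed
  qed (use 16(1) in auto)
qed

lemma cells_phom_glue: "x \<in> X \<Longrightarrow> y \<in> X \<Longrightarrow> p \<in> cells (phom glue x y) k \<longleftrightarrow> (\<exists>u \<in> cells (H x y) k. p = tri x y u)"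
  by (auto simp: cells_phom cells_glue_Suc)

end

section \<open>Essential surjectivity and the equivalence\<close>

context funny_tensor begin

lemma penr_eso:
  assumes E: "enriched_category (FunnyPCat n) E"
  shows "\<exists>C :: 'a precat. precategory (Suc n) C \<and> (\<exists>e. iso_in (EnrCat (FunnyPCat n)) (penr C) E e)"
proof -
  interpret E: pre_enriched T n E using E by (rule pre_enriched_if_enriched)
  interpret glueing T n "eobj E" "ehom E" "eunit E" "ewl n E" "ewr n E"
    using E by (auto simp: E.enriched_category_iff_whiskered glueing_def coding_axioms)
  note G = precategory_glue
  interpret G: precategory_Suc n glue using G by (rule precategory_SucI)
  have EG: "enriched_category (FunnyPCat n) (penr glue)" by (rule enriched_penr[OF G])
  \<comment> \<open>Objects are unchanged by glueing, so the isomorphism is the identity on them; on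
    homs \<open>e\<close> removes the tags and \<open>d\<close> restores them.\<close>
  define e where "e = \<lparr>efobj = (\<lambda>x. if x \<in> eobj E then x else undefined),
    efmap = (\<lambda>x y. if x \<in> eobj E \<and> y \<in> eobj E
      then prestrict n (phom glue x y) (\<lambda>k p. psnd (psnd p)) else undefined)\<rparr>"
  define d where "d = \<lparr>efobj = (\<lambda>x. if x \<in> eobj E then x else undefined),
    efmap = (\<lambda>x y. if x \<in> eobj E \<and> y \<in> eobj E
      then prestrict n (ehom E x y) (\<lambda>k u. tri x y u) else undefined)\<rparr>"
  have e_simps: "efobj e x = x" "efmap e x y = prestrict n (phom glue x y) (\<lambda>k p. psnd (psnd p))"
    and d_simps: "efobj d x = x" "efmap d x y = prestrict n (ehom E x y) (\<lambda>k u. tri x y u)"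
    if "x \<in> eobj E" "y \<in> eobj E" for x y
    using that by (auto simp: e_def d_def)
  have undef: "x \<notin> eobj E \<Longrightarrow> efobj e x = undefined" "\<not> (x \<in> eobj E \<and> y \<in> eobj E) \<Longrightarrow> efmap e x y = undefined"
    "x \<notin> eobj E \<Longrightarrow> efobj d x = undefined" "\<not> (x \<in> eobj E \<and> y \<in> eobj E) \<Longrightarrow> efmap d x y = undefined" for x y
    by (auto simp: e_def d_def)
  have e: "whiskered_functor n (penr glue) E e"
  proof (rule whiskered_functor.intro, unfold penr_simps cells_glue_0, goal_cases)
    case (2 x y)
    have "premor n (phom glue x y) (ehom E x y) (\<lambda>k p. psnd (psnd p))"
    proof (rule premor.intro, goal_cases)
      case (4 i k l p q)
      then obtain u v where pq: "p = tri x y u" "q = tri x y v"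
        using cells_phom_glue[OF 2] by (auto simp: comp_defined_def i_composable_def)
      have "0 < k" "0 < l" using 4 by (auto simp: comp_defined_def)
      then show ?case using pq by simp
    qed (use 2 in \<open>auto simp: cells_phom_glue\<close>)
    from prefunctor_prestrict[OF G.precategory_phom this] show ?case using 2 by (simp add: e_simps)
  next
    case (3 x)
    have "idn glue 0 x \<in> cells (phom glue x x) 0" using 3 by (simp add: cells_phom_glue unit_cells)
    then show ?case using 3 by (simp add: e_simps)
  next
    case (4 x y z k p v')
    obtain u v where p: "p = tri x y u" "v' = tri y z v" "u \<in> cells (ehom E x y) k" "v \<in> cells (ehom E y z) 0"
      using 4 by (auto simp: cells_phom_glue)
    have "tri x z (ewl n E x y z k u v) \<in> cells (phom glue x z) k"
      using 4 p by (simp add: cells_phom_glue premor_wl_cells)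
    then show ?case using 4 p by (simp add: e_simps ewl_penr[OF G])
  next
    case (5 x y z k u' p)
    obtain u v where p: "u' = tri x y u" "p = tri y z v" "u \<in> cells (ehom E x y) 0" "v \<in> cells (ehom E y z) k"
      using 5 by (auto simp: cells_phom_glue)
    have "tri x z (ewr n E x y z k u v) \<in> cells (phom glue x z) k"
      using 5 p by (simp add: cells_phom_glue premor_wr_cells)
    then show ?case using 5 p by (simp add: e_simps ewr_penr[OF G])
  qed (auto simp: e_simps undef)
  have d: "whiskered_functor n E (penr glue) d"
  proof (rule whiskered_functor.intro, unfold penr_simps cells_glue_0, goal_cases)
    case (2 x y)
    have "premor n (ehom E x y) (phom glue x y) (\<lambda>k u. tri x y u)"
    proof (rule premor.intro, goal_cases)
      case (4 i k l u v)
      then have "0 < k" "0 < l" by (auto simp: comp_defined_def)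
      then show ?case by simp
    qed (use 2 in \<open>auto simp: cells_phom_glue\<close>)
    from prefunctor_prestrict[OF E.hom[OF 2] this] show ?case using 2 by (simp add: d_simps)
  next
    case (4 x y z k u v)
    then have "ewl n E x y z k u v \<in> cells (ehom E x z) k" by (simp add: premor_wl_cells)
    then show ?case using 4 by (simp add: d_simps ewl_penr[OF G] cells_phom_glue)
  next
    case (5 x y z k u v)
    then have "ewr n E x y z k u v \<in> cells (ehom E x z) k" by (simp add: premor_wr_cells)
    then show ?case using 5 by (simp add: d_simps ewr_penr[OF G] cells_phom_glue)
  qed (auto simp: d_simps undef unit_cells)
  let ?V = "EnrCat (FunnyPCat n) :: (('a, 'a precat, 'a pmap) ecat, ('a, 'a pmap) efun) cat"
  have de: "Comp ?V (penr glue) E (penr glue) d e = Ide ?V (penr glue)"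
  proof (rule efun_eqI, goal_cases)
    case (2 x y)
    show ?case
      by (auto simp: EnrCat_Comp EnrCat_Ide e_simps d_simps pid_def pcomp_def cells_phom_glue intro!: prestrict_eqI)
  qed (simp add: EnrCat_Comp EnrCat_Ide e_simps d_simps)
  have ed: "Comp ?V E (penr glue) E e d = Ide ?V E"
  proof (rule efun_eqI, goal_cases)
    case (2 x y)
    show ?case
      by (auto simp: EnrCat_Comp EnrCat_Ide e_simps d_simps pid_def pcomp_def cells_phom_glue intro!: prestrict_eqI)
  qed (simp add: EnrCat_Comp EnrCat_Ide e_simps d_simps)
  have "iso_in ?V (penr glue) E e"
    unfolding iso_in_def EnrCat_Hom enriched_functorE[OF EG E]
    using e d de ed enriched_functorE[OF E EG] EnrCat_Hom by blast
  then show ?thesis using G by blast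
qed

lemma equivalent_PCat_EnrCat: "equivalent_categories (PCat (Suc n) :: ('a precat, 'a pmap) cat)
    (EnrCat (FunnyPCat n) :: (('a, 'a precat, 'a pmap) ecat, ('a, 'a pmap) efun) cat)"
proof (rule equivalent_categories_if_fully_faithful[OF category_PCat category_EnrCat is_functor_penr],
    unfold PCat_simps EnrCat_Obj EnrCat_Hom, goal_cases)
  case (1 C D f g)
  then show ?case using penr_faithful[of C D f g] by (simp add: penr_functor_def)
next
  case (2 C D h)
  then show ?case
    using penr_full[of C D h] enriched_functorE[OF enriched_penr enriched_penr]
    by (auto simp: penr_functor_def PCat_simps)
next
  case (3 E)
  then show ?case using penr_eso[of E] by (auto simp: penr_functor_def PCat_simps)
qed

end

theorem mainTheorem1:
  fixes n :: nat
  assumes "infinite (UNIV :: 'a set)"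
  shows "equivalent_categories
           (PCat (Suc n) :: ('a precat, 'a pmap) cat)
           (EnrCat (FunnyPCat n) :: (('a, 'a precat, 'a pmap) ecat, ('a, 'a pmap) efun) cat)"
proof -
  interpret funny_tensor "TYPE('a)" n
    by (intro funny_tensor.intro coding.intro assms)
  show ?thesis by (rule equivalent_PCat_EnrCat)
qed

end
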